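(* Let $X$ be a unital operator space which is also a dual operator space. Then there exist a Hilbert space $\mathcal{H}$ and a completely isometric unital weak* homeomorphism from $X$ onto a weak* closed unital subspace of $B(\mathcal{H})$.
   Context: A unital operator space is a vector space of operators on a Hilbert space $H$ containing the identity operator $I_H$ (not necessarily selfadjoint), considered with its inherited matrix norms and its unit $1=I_H$. A dual operator space is an operator space $X$ completely isometrically isomorphic to the operator space dual $V^{\sharp}$ of some operator space $V$; the weak* topology on $X$ comes from this identification (no compatibility with the concrete embedding of $X$ in operators on $H$ is assumed). $B(\mathcal{H})$ carries its usual weak* topology, and a unital subspace of $B(\mathcal{H})$ is a linear subspace containing $I_{\mathcal{H}}$. A unital map is one taking the unit to the unit. *)

theory Defs
  imports "HOL-Analysis.Analysis" "HOL-Library.Function_Algebras"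
begin

section \<open>Complex vector spaces\<close>

class complex_vector = ab_group_add +
  fixes scaleC :: "complex \<Rightarrow> 'a \<Rightarrow> 'a" (infixr "*\<^sub>C" 75)
  assumes scaleC_add_right: "a *\<^sub>C (x + y) = a *\<^sub>C x + a *\<^sub>C y"
    and scaleC_add_left: "(a + b) *\<^sub>C x = a *\<^sub>C x + b *\<^sub>C x"
    and scaleC_scaleC: "a *\<^sub>C (b *\<^sub>C x) = (a * b) *\<^sub>C x"
    and scaleC_one: "1 *\<^sub>C x = x"

global_interpretation complex_vector: vector_space
  "scaleC :: complex \<Rightarrow> 'a \<Rightarrow> 'a :: complex_vector"
  defines csubspace = complex_vector.subspace
  by standard (rule scaleC_add_right scaleC_add_left scaleC_scaleC scaleC_one)+

instantiation complex :: complex_vector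
begin
definition scaleC_complex :: "complex \<Rightarrow> complex \<Rightarrow> complex"
  where "scaleC_complex a x = a * x"
instance by standard (simp_all add: scaleC_complex_def algebra_simps)
end

instantiation "fun" :: (type, complex_vector) complex_vector
begin
definition scaleC_fun :: "complex \<Rightarrow> ('a \<Rightarrow> 'b) \<Rightarrow> 'a \<Rightarrow> 'b"
  where "scaleC_fun a f = (\<lambda>x. a *\<^sub>C f x)"
instance
  by standard (simp_all add: scaleC_fun_def fun_eq_iff scaleC_add_right scaleC_add_left
      scaleC_scaleC scaleC_one)
end

definition clinear_on :: "'a::complex_vector set \<Rightarrow> ('a \<Rightarrow> 'b::complex_vector) \<Rightarrow> bool" where
  "clinear_on S f \<longleftrightarrow>
     (\<forall>x\<in>S. \<forall>y\<in>S. f (x + y) = f x + f y) \<and> (\<forall>c. \<forall>x\<in>S. f (c *\<^sub>C x) = c *\<^sub>C f x)"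

definition complete_wrt :: "('a::ab_group_add \<Rightarrow> real) \<Rightarrow> 'a set \<Rightarrow> bool" where
  "complete_wrt N S \<longleftrightarrow>
     (\<forall>s :: nat \<Rightarrow> 'a. (\<forall>n. s n \<in> S) \<and> (\<forall>e>0. \<exists>M. \<forall>m\<ge>M. \<forall>n\<ge>M. N (s m - s n) < e)
        \<longrightarrow> (\<exists>l\<in>S. (\<lambda>n. N (s n - l)) \<longlonglongrightarrow> 0))"

section \<open>Hilbert spaces and bounded operators\<close>

text \<open>A Hilbert space is a complex subspace of some ambient vector space (a type), together
  with an inner product on it, so that one can quantify over Hilbert spaces.  The inner product
  is linear in the first argument; its values off the carrier are irrelevant.\<close>

record 'h hspace =
  hcarrier :: "'h set"
  hinner :: "'h \<Rightarrow> 'h \<Rightarrow> complex"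

definition hnorm :: "'h hspace \<Rightarrow> 'h \<Rightarrow> real" where
  "hnorm H x = sqrt (Re (hinner H x x))"

locale hilbert_space =
  fixes H :: "'h::complex_vector hspace"
  assumes subspace: "csubspace (hcarrier H)"
    and inner_linear: "y \<in> hcarrier H \<Longrightarrow> clinear_on (hcarrier H) (\<lambda>x. hinner H x y)"
    and inner_commute: "\<lbrakk>x \<in> hcarrier H; y \<in> hcarrier H\<rbrakk> \<Longrightarrow> hinner H y x = cnj (hinner H x y)"
    and inner_pos: "\<lbrakk>x \<in> hcarrier H; x \<noteq> 0\<rbrakk> \<Longrightarrow> Re (hinner H x x) > 0"
    and complete: "complete_wrt (hnorm H) (hcarrier H)"

text \<open>Operators are extended by \<open>0\<close> off the carrier.  This makes them unique as functions and
  makes \<open>bounded_ops H\<close> a subspace of the function type with its pointwise operations.\<close>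

definition bounded_ops :: "'h::complex_vector hspace \<Rightarrow> ('h \<Rightarrow> 'h) set" where
  "bounded_ops H = {A. clinear_on (hcarrier H) A \<and> A ` hcarrier H \<subseteq> hcarrier H \<and>
     (\<forall>x. x \<notin> hcarrier H \<longrightarrow> A x = 0) \<and>
     (\<exists>C. \<forall>x\<in>hcarrier H. hnorm H (A x) \<le> C * hnorm H x)}"

definition id_op :: "'h::complex_vector hspace \<Rightarrow> 'h \<Rightarrow> 'h" where
  "id_op H = (\<lambda>x. if x \<in> hcarrier H then x else 0)"

text \<open>The norm of the matrix \<open>x\<close>, indexed by the finite set \<open>I\<close>, as an operator on the Hilbert
  space direct sum of \<open>I\<close> copies of \<open>H\<close>.  Entries with an index outside \<open>I\<close> are ignored.\<close>

definition mat_norm :: "'h::complex_vector hspace \<Rightarrow> 'i set \<Rightarrow> ('i \<Rightarrow> 'i \<Rightarrow> 'h \<Rightarrow> 'h) \<Rightarrow> real" where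
  "mat_norm H I x = Sup {sqrt (\<Sum>i\<in>I. (hnorm H (\<Sum>j\<in>I. x i j (\<xi> j)))\<^sup>2) | \<xi>.
     (\<forall>j\<in>I. \<xi> j \<in> hcarrier H) \<and> (\<Sum>j\<in>I. (hnorm H (\<xi> j))\<^sup>2) \<le> 1}"

abbreviation op_mnorm ::
    "'h::complex_vector hspace \<Rightarrow> nat \<Rightarrow> (nat \<Rightarrow> nat \<Rightarrow> 'h \<Rightarrow> 'h) \<Rightarrow> real" where
  "op_mnorm H n x \<equiv> mat_norm H {..<n} x"

definition op_norm :: "'h::complex_vector hspace \<Rightarrow> ('h \<Rightarrow> 'h) \<Rightarrow> real" where
  "op_norm H A = op_mnorm H 1 (\<lambda>_ _. A)"

text \<open>The one-dimensional Hilbert space, for the norms of scalar matrices.\<close>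

definition complex_hspace :: "complex hspace" where
  "complex_hspace = \<lparr>hcarrier = UNIV, hinner = (\<lambda>x y. x * cnj y)\<rparr>"

definition scalar_mat_norm :: "'i set \<Rightarrow> ('i \<Rightarrow> 'i \<Rightarrow> complex) \<Rightarrow> real" where
  "scalar_mat_norm I a = mat_norm complex_hspace I (\<lambda>p q z. a p q * z)"

section \<open>Operator spaces and complete isometries\<close>

definition unital_operator_space ::
    "'h::complex_vector hspace \<Rightarrow> ('h \<Rightarrow> 'h) set \<Rightarrow> bool" where
  "unital_operator_space H X \<longleftrightarrow> X \<subseteq> bounded_ops H \<and> csubspace X \<and> id_op H \<in> X"

text \<open>Operator spaces are norm complete.  This matters for a predual \<open>V\<close>: passing to a dense
  subspace changes neither the dual of \<open>V\<close> nor its matrix norms, but it does change the weak*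
  topology.\<close>

definition operator_space :: "'h::complex_vector hspace \<Rightarrow> ('h \<Rightarrow> 'h) set \<Rightarrow> bool" where
  "operator_space H V \<longleftrightarrow> V \<subseteq> bounded_ops H \<and> csubspace V \<and> complete_wrt (op_norm H) V"

text \<open>In a family \<open>N\<close> of matrix norms, \<open>N n\<close> looks only at the entries with indices below \<open>n\<close>.\<close>

definition mats :: "nat \<Rightarrow> 'x set \<Rightarrow> (nat \<Rightarrow> nat \<Rightarrow> 'x) set" where
  "mats n X = {x. \<forall>i<n. \<forall>j<n. x i j \<in> X}"

definition complete_isometry ::
    "'x::complex_vector set \<Rightarrow> (nat \<Rightarrow> (nat \<Rightarrow> nat \<Rightarrow> 'x) \<Rightarrow> real) \<Rightarrow>
     'y::complex_vector set \<Rightarrow> (nat \<Rightarrow> (nat \<Rightarrow> nat \<Rightarrow> 'y) \<Rightarrow> real) \<Rightarrow> ('x \<Rightarrow> 'y) \<Rightarrow> bool" where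
  "complete_isometry X N Y N' T \<longleftrightarrow> clinear_on X T \<and> T ` X \<subseteq> Y \<and>
     (\<forall>n. \<forall>x\<in>mats n X. N' n (\<lambda>i j. T (x i j)) = N n x)"

section \<open>The operator space dual\<close>

definition dual_space ::
    "'k::complex_vector hspace \<Rightarrow> ('k \<Rightarrow> 'k) set \<Rightarrow> (('k \<Rightarrow> 'k) \<Rightarrow> complex) set" where
  "dual_space K V = {f. clinear_on V f \<and> (\<forall>v. v \<notin> V \<longrightarrow> f v = 0) \<and>
     (\<exists>C. \<forall>v\<in>V. cmod (f v) \<le> C * op_norm K v)}"

text \<open>The matrix \<open>f\<close> of functionals is normed as the completely bounded map
  \<open>v \<mapsto> [f i j v]\<close> from \<open>V\<close> into the \<open>n \<times> n\<close> matrices.  Its \<open>m\<close>-th amplification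
  sends \<open>[v k l]\<close> to an \<open>m n \<times> m n\<close> scalar matrix indexed by pairs.\<close>

definition dual_mnorm ::
    "'k::complex_vector hspace \<Rightarrow> ('k \<Rightarrow> 'k) set \<Rightarrow> nat \<Rightarrow>
     (nat \<Rightarrow> nat \<Rightarrow> ('k \<Rightarrow> 'k) \<Rightarrow> complex) \<Rightarrow> real" where
  "dual_mnorm K V n f =
     Sup {scalar_mat_norm ({..<m} \<times> {..<n}) (\<lambda>(k, i) (l, j). f i j (v k l)) | m v.
       v \<in> mats m V \<and> op_mnorm K m v \<le> 1}"

section \<open>Weak* topologies\<close>

text \<open>The coarsest topology on \<open>S\<close> for which all functions in \<open>F\<close> are continuous.\<close>

definition initial_topology :: "'x set \<Rightarrow> ('x \<Rightarrow> complex) set \<Rightarrow> 'x topology" where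
  "initial_topology S F =
     pullback_topology S (\<lambda>x. \<lambda>f\<in>F. f x) (product_topology (\<lambda>_. euclidean) F)"

definition dual_weakstar ::
    "'k::complex_vector hspace \<Rightarrow> ('k \<Rightarrow> 'k) set \<Rightarrow> (('k \<Rightarrow> 'k) \<Rightarrow> complex) topology" where
  "dual_weakstar K V = initial_topology (dual_space K V) ((\<lambda>v f. f v) ` V)"

text \<open>The weak* (that is, ultraweak) topology of \<open>B(H)\<close>: the normal functionals, which form the
  predual (the trace class), are the maps \<open>A \<mapsto> \<Sum>\<langle>A \<xi>\<^sub>n, \<eta>\<^sub>n\<rangle>\<close> for square summable
  sequences of vectors.\<close>

definition normal_functionals :: "'h::complex_vector hspace \<Rightarrow> (('h \<Rightarrow> 'h) \<Rightarrow> complex) set" where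
  "normal_functionals H = {(\<lambda>A. \<Sum>n. hinner H (A (\<xi> n)) (\<eta> n)) | (\<xi> :: nat \<Rightarrow> 'h) \<eta>.
     range \<xi> \<subseteq> hcarrier H \<and> range \<eta> \<subseteq> hcarrier H \<and>
     summable (\<lambda>n. (hnorm H (\<xi> n))\<^sup>2) \<and> summable (\<lambda>n. (hnorm H (\<eta> n))\<^sup>2)}"

definition op_weakstar :: "'h::complex_vector hspace \<Rightarrow> ('h \<Rightarrow> 'h) topology" where
  "op_weakstar H = initial_topology (bounded_ops H) (normal_functionals H)"

section \<open>The ambient type of the representing Hilbert space\<close>

text \<open>HOL cannot quantify existentially over types, so a Hilbert space that is asserted to exist
  needs an ambient type which depends on the given \<open>X\<close> only through its type.  This index type has
  room for the standard basis vectors of the direct sum of the spaces \<open>\<complex>\<^sup>n\<close> over all \<open>n\<close> and all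
  maps from \<open>X\<close> to the \<open>n \<times> n\<close> matrices.\<close>

type_synonym 'h rep_index = "nat \<times> (('h \<Rightarrow> 'h) \<Rightarrow> nat \<Rightarrow> nat \<Rightarrow> complex) \<times> nat"

end

theory Submission
  imports Defs
begin

text \<open>Write the weak* continuous functionals on \<open>X\<close> as \<open>x \<mapsto> T x v\<close> with \<open>v \<in> V\<close>.  The idea is to
  represent \<open>X\<close> on the Hilbert space direct sum \<open>L\<close> of copies of \<open>\<complex>\<^sup>k\<close>, one for each matrix
  state, that is, each weak* continuous unital map from \<open>X\<close> to the \<open>k \<times> k\<close> matrices that extends to a
  completely positive map on the selfadjoint space spanned by \<open>X\<close> and the adjoints, and to let \<open>\<Phi>\<close> be the direct sum of all of them.

  Since \<open>X\<close> need not be selfadjoint, positivity is replaced by accretivity: a matrix \<open>c\<close> over \<open>X\<close> is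
  accretive if \<open>Re \<langle>c \<xi>, \<xi>\<rangle> \<ge> 0\<close> for all \<open>\<xi>\<close>.  The norm of a matrix \<open>x\<close> is at most \<open>s\<close> if and only if
  the block matrix with diagonal blocks \<open>s\<close> and the single off-diagonal block \<open>-2 x\<close> is accretive
  (\<open>norm_le_iff_accretive_block\<close>).  So a unital map that preserves and reflects accretivity of matrices
  of all sizes is completely isometric, and everything depends on having enough matrix states: if
  \<open>x\<close> is not accretive, some matrix state has to detect this (\<open>matrix_state_detects\<close>).

  Accretivity is also determined by norms: for \<open>c\<close> of norm at most \<open>R\<close>, it means that
  \<open>\<parallel>1 - t c\<parallel>\<^sup>2 \<le> 1 + t\<^sup>2 R\<^sup>2\<close> for all \<open>t > 0\<close> (\<open>accretive_iff_norm\<close>).  Norm balls of matrices over a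
  dual operator space are weak* closed, hence the accretive contractions form a weak* compact convex
  set.  A theorem of Krein--Smulian type then separates the cone of accretive matrices from any
  matrix outside by a weak* continuous functional (\<open>weakstar_separation\<close>).  It is proved here from a
  minimax theorem for compact convex sets (\<open>minimax\<close>): minimax provides functionals that are positive
  up to a small error, minimax also halves this error at the cost of a perturbation of the same
  size, and the perturbations add up because \<open>V\<close> is complete.  The separating functional has the
  entries of a completely accretive map from \<open>X\<close> to matrices, and compressing this map to an
  orthonormal basis for the form that it assigns to the unit makes it unital.

  The same method shows that the map of preduals is onto: each \<open>v \<in> V\<close> comes from a normal functional
  \<open>f\<close> on \<open>B(L)\<close>, in the sense that \<open>f (\<Phi> x) = T x v\<close>, with control of the norm (\<open>predual_lifting\<close>).
  Conversely, \<open>f \<circ> \<Phi>\<close> is weak* continuous for each normal \<open>f\<close>, as it is a norm limit of combinations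
  of entries of matrix states (\<open>represented_normal\<close>).  So the two weak* topologies on \<open>X\<close> coincide,
  and \<open>\<Phi> ` X\<close> is the set of all operators that are annihilated by the normal functionals that vanish
  on it, which is weak* closed.\<close>

section \<open>Hilbert spaces and bounded operators\<close>

lemma clinear_on_add: "clinear_on S f \<Longrightarrow> x \<in> S \<Longrightarrow> y \<in> S \<Longrightarrow> f (x + y) = f x + f y"
  and clinear_on_scaleC: "clinear_on S f \<Longrightarrow> x \<in> S \<Longrightarrow> f (c *\<^sub>C x) = c *\<^sub>C f x"
  by (auto simp: clinear_on_def)

lemma clinear_on_zero: "clinear_on S f \<Longrightarrow> csubspace S \<Longrightarrow> f 0 = 0"
  using clinear_on_scaleC[of S f 0 0] complex_vector.subspace_0[of S] by simp

lemma clinear_on_sum: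
  assumes "clinear_on S f" "csubspace S" "\<And>i. i \<in> I \<Longrightarrow> g i \<in> S"
  shows "f (\<Sum>i\<in>I. g i) = (\<Sum>i\<in>I. f (g i))"
  using assms(3)
proof (induction I rule: infinite_finite_induct)
  case (insert i I)
  then show ?case
    by (simp add: clinear_on_add[OF assms(1)] complex_vector.subspace_sum[OF assms(2)])
qed (simp_all add: clinear_on_zero[OF assms(1,2)])

lemma clinear_on_diff:
  assumes "clinear_on S f" "csubspace S" "x \<in> S" "y \<in> S"
  shows "f (x - y) = f x - f y"
  using clinear_on_add[OF assms(1), of "x - y" y] complex_vector.subspace_diff[OF assms(2-4)] assms(4)
  by (simp add: eq_diff_eq)

context hilbert_space
begin

lemma zero_in [simp]: "0 \<in> hcarrier H"
  using subspace complex_vector.subspace_0 by blast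

lemma add_in [simp]: "x \<in> hcarrier H \<Longrightarrow> y \<in> hcarrier H \<Longrightarrow> x + y \<in> hcarrier H"
  using subspace complex_vector.subspace_add by blast

lemma diff_in [simp]: "x \<in> hcarrier H \<Longrightarrow> y \<in> hcarrier H \<Longrightarrow> x - y \<in> hcarrier H"
  using subspace complex_vector.subspace_diff by blast

lemma scaleC_in [simp]: "x \<in> hcarrier H \<Longrightarrow> c *\<^sub>C x \<in> hcarrier H"
  using subspace complex_vector.subspace_scale by blast

lemma sum_in [simp]: "(\<And>i. i \<in> I \<Longrightarrow> f i \<in> hcarrier H) \<Longrightarrow> sum f I \<in> hcarrier H"
  using subspace complex_vector.subspace_sum by blast

lemma inner_add_left:
  "\<lbrakk>x \<in> hcarrier H; y \<in> hcarrier H; z \<in> hcarrier H\<rbrakk>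
    \<Longrightarrow> hinner H (x + y) z = hinner H x z + hinner H y z"
  using clinear_on_add[OF inner_linear] by auto

lemma inner_scaleC_left:
  "\<lbrakk>x \<in> hcarrier H; z \<in> hcarrier H\<rbrakk> \<Longrightarrow> hinner H (c *\<^sub>C x) z = c * hinner H x z"
  using clinear_on_scaleC[OF inner_linear] by (auto simp: scaleC_complex_def)

lemma inner_sum_left:
  "\<lbrakk>\<And>i. i \<in> I \<Longrightarrow> f i \<in> hcarrier H; z \<in> hcarrier H\<rbrakk>
    \<Longrightarrow> hinner H (sum f I) z = (\<Sum>i\<in>I. hinner H (f i) z)"
  using clinear_on_sum[OF inner_linear subspace] by auto

lemma inner_add_right:
  "\<lbrakk>x \<in> hcarrier H; y \<in> hcarrier H; z \<in> hcarrier H\<rbrakk>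
    \<Longrightarrow> hinner H z (x + y) = hinner H z x + hinner H z y"
  using inner_commute[of z x] inner_commute[of z y] inner_commute[of z "x + y"]
    inner_commute[of x z] inner_commute[of y z] inner_commute[of "x + y" z]
  by (simp add: inner_add_left)

lemma inner_scaleC_right:
  "\<lbrakk>x \<in> hcarrier H; z \<in> hcarrier H\<rbrakk> \<Longrightarrow> hinner H z (c *\<^sub>C x) = cnj c * hinner H z x"
  using inner_commute[of x z] inner_commute[of "c *\<^sub>C x" z]
  by (simp add: inner_scaleC_left)

lemma inner_zero_left [simp]: "z \<in> hcarrier H \<Longrightarrow> hinner H 0 z = 0"
  using inner_scaleC_left[of 0 z 0] by simp

lemma inner_zero_right [simp]: "z \<in> hcarrier H \<Longrightarrow> hinner H z 0 = 0"
  using inner_scaleC_right[of 0 z 0] by simp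

lemma inner_sum_right:
  "\<lbrakk>\<And>i. i \<in> I \<Longrightarrow> f i \<in> hcarrier H; z \<in> hcarrier H\<rbrakk>
    \<Longrightarrow> hinner H z (sum f I) = (\<Sum>i\<in>I. hinner H z (f i))"
proof (induction I rule: infinite_finite_induct)
  case (insert i I)
  then show ?case by (simp add: inner_add_right)
qed simp_all

lemma inner_self: "x \<in> hcarrier H \<Longrightarrow> hinner H x x = of_real ((hnorm H x)\<^sup>2)"
proof -
  assume x: "x \<in> hcarrier H"
  have "Im (hinner H x x) = 0"
    using arg_cong[OF inner_commute[OF x x], of Im] by simp
  moreover have "Re (hinner H x x) \<ge> 0"
    using inner_pos[OF x] x by (cases "x = 0") auto
  ultimately show ?thesis
    by (simp add: hnorm_def complex_eq_iff)
qed

lemma hnorm_nonneg [simp]: "x \<in> hcarrier H \<Longrightarrow> hnorm H x \<ge> 0"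
  using inner_pos[of x] by (cases "x = 0") (auto simp: hnorm_def)

lemma hnorm_zero [simp]: "hnorm H 0 = 0"
  by (simp add: hnorm_def)

lemma hnorm_eq_0: "x \<in> hcarrier H \<Longrightarrow> hnorm H x = 0 \<longleftrightarrow> x = 0"
  using inner_pos[of x] by (cases "x = 0") (auto simp: hnorm_def)

lemma hnorm_sq: "x \<in> hcarrier H \<Longrightarrow> (hnorm H x)\<^sup>2 = Re (hinner H x x)"
  by (simp add: inner_self)

lemma hnorm_scaleC [simp]: "x \<in> hcarrier H \<Longrightarrow> hnorm H (c *\<^sub>C x) = cmod c * hnorm H x"
proof -
  assume x: "x \<in> hcarrier H"
  have "hinner H (c *\<^sub>C x) (c *\<^sub>C x) = c * cnj c * hinner H x x"
    using x by (simp add: inner_scaleC_left inner_scaleC_right)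
  also have "\<dots> = of_real ((cmod c)\<^sup>2 * (hnorm H x)\<^sup>2)"
    using x by (simp add: inner_self complex_norm_square[symmetric])
  finally have "hinner H (c *\<^sub>C x) (c *\<^sub>C x) = of_real ((cmod c)\<^sup>2 * (hnorm H x)\<^sup>2)" .
  then show ?thesis
    using x by (simp add: hnorm_def[of H "c *\<^sub>C x"] real_sqrt_mult)
qed

lemma hnorm_add_sq:
  assumes "x \<in> hcarrier H" "y \<in> hcarrier H"
  shows "(hnorm H (x + y))\<^sup>2 = (hnorm H x)\<^sup>2 + 2 * Re (hinner H x y) + (hnorm H y)\<^sup>2"
  using assms inner_commute[of x y]
  by (simp add: hnorm_sq inner_add_left inner_add_right)

lemma cauchy_schwarz:
  assumes x: "x \<in> hcarrier H" and y: "y \<in> hcarrier H"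
  shows "cmod (hinner H x y) \<le> hnorm H x * hnorm H y"
proof (cases "y = 0")
  case False
  define n where "n = (hnorm H y)\<^sup>2"
  have n: "n > 0" using False y hnorm_eq_0[OF y] by (simp add: n_def)
  define c where "c = - hinner H x y / of_real n"
  have cy: "(hnorm H (c *\<^sub>C y))\<^sup>2 = (cmod (hinner H x y))\<^sup>2 / n"
    using y n
    by (simp only: hnorm_scaleC power_mult_distrib n_def[symmetric])
      (simp add: c_def norm_divide power_divide power2_eq_square)
  have "Re (hinner H x (c *\<^sub>C y)) = - (cmod (hinner H x y))\<^sup>2 / n"
    unfolding inner_scaleC_right[OF y x] using n
    by (simp add: c_def cmod_power2 add_divide_distrib power2_eq_square[of "Re _"] power2_eq_square[of "Im _"]
        diff_divide_distrib)
  then have "(cmod (hinner H x y))\<^sup>2 / n \<le> (hnorm H x)\<^sup>2"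
    using hnorm_add_sq[OF x scaleC_in[OF y, of c]] cy zero_le_power2[of "hnorm H (x + c *\<^sub>C y)"]
    by linarith
  then have "(cmod (hinner H x y))\<^sup>2 \<le> (hnorm H x)\<^sup>2 * n"
    by (simp only: pos_divide_le_eq[OF n])
  then have "(cmod (hinner H x y))\<^sup>2 \<le> (hnorm H x * hnorm H y)\<^sup>2"
    by (simp only: n_def power_mult_distrib)
  then show ?thesis
    by (rule power2_le_imp_le) (use x y in simp)
qed (use x in simp)

lemma hnorm_triangle:
  assumes "x \<in> hcarrier H" "y \<in> hcarrier H"
  shows "hnorm H (x + y) \<le> hnorm H x + hnorm H y"
proof (rule power2_le_imp_le)
  have "Re (hinner H x y) \<le> hnorm H x * hnorm H y"
    using cauchy_schwarz[OF assms] complex_Re_le_cmod order_trans by blast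
  then show "(hnorm H (x + y))\<^sup>2 \<le> (hnorm H x + hnorm H y)\<^sup>2"
    using hnorm_add_sq[OF assms] by (simp add: power2_sum)
qed (use assms in simp)

lemma hnorm_sum:
  "(\<And>i. i \<in> I \<Longrightarrow> f i \<in> hcarrier H) \<Longrightarrow> hnorm H (sum f I) \<le> (\<Sum>i\<in>I. hnorm H (f i))"
proof (induction I rule: infinite_finite_induct)
  case (insert i I)
  then have "hnorm H (f i + sum f I) \<le> hnorm H (f i) + hnorm H (sum f I)"
    by (intro hnorm_triangle) auto
  with insert show ?case by simp
qed simp_all

lemma bounded_opsD:
  assumes "A \<in> bounded_ops H"
  shows "clinear_on (hcarrier H) A" "\<And>x. x \<in> hcarrier H \<Longrightarrow> A x \<in> hcarrier H"
    "\<And>x. x \<notin> hcarrier H \<Longrightarrow> A x = 0"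
  using assms by (auto simp: bounded_ops_def)

lemma bounded_ops_bound:
  assumes "A \<in> bounded_ops H"
  obtains C where "C \<ge> 0" "\<And>x. x \<in> hcarrier H \<Longrightarrow> hnorm H (A x) \<le> C * hnorm H x"
proof -
  obtain C where C: "\<And>x. x \<in> hcarrier H \<Longrightarrow> hnorm H (A x) \<le> C * hnorm H x"
    using assms by (auto simp: bounded_ops_def)
  have "hnorm H (A x) \<le> max C 0 * hnorm H x" if "x \<in> hcarrier H" for x
    using C[OF that] mult_right_mono[of C "max C 0" "hnorm H x"] that by auto
  then show ?thesis using that[of "max C 0"] by auto
qed

lemma csubspace_bounded_ops: "csubspace (bounded_ops H)"
proof (rule complex_vector.subspaceI)
  show "0 \<in> bounded_ops H"
    by (auto simp: bounded_ops_def clinear_on_def intro!: exI[of _ 0])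
next
  fix A B assume A: "A \<in> bounded_ops H" and B: "B \<in> bounded_ops H"
  obtain a where a: "\<And>x. x \<in> hcarrier H \<Longrightarrow> hnorm H (A x) \<le> a * hnorm H x"
    using bounded_ops_bound[OF A] by metis
  obtain b where b: "\<And>x. x \<in> hcarrier H \<Longrightarrow> hnorm H (B x) \<le> b * hnorm H x"
    using bounded_ops_bound[OF B] by metis
  have "hnorm H (A x + B x) \<le> (a + b) * hnorm H x" if "x \<in> hcarrier H" for x
    using hnorm_triangle[of "A x" "B x"] bounded_opsD(2)[OF A that] bounded_opsD(2)[OF B that]
      a[OF that] b[OF that] by (simp add: algebra_simps)
  then show "A + B \<in> bounded_ops H"
    using bounded_opsD[OF A] bounded_opsD[OF B]
    by (auto simp: bounded_ops_def clinear_on_def scaleC_add_right algebra_simps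
        intro!: exI[of _ "a + b"])
next
  fix A c assume A: "A \<in> bounded_ops H"
  obtain a where a: "\<And>x. x \<in> hcarrier H \<Longrightarrow> hnorm H (A x) \<le> a * hnorm H x"
    using bounded_ops_bound[OF A] by metis
  have "cmod c * hnorm H (A x) \<le> cmod c * a * hnorm H x" if "x \<in> hcarrier H" for x
    using a[OF that] mult_left_mono[of _ _ "cmod c"] by (simp add: mult.assoc)
  then show "c *\<^sub>C A \<in> bounded_ops H"
    using bounded_opsD[OF A]
    by (auto simp: bounded_ops_def clinear_on_def scaleC_add_right scaleC_fun_def scaleC_scaleC
        mult.commute intro!: exI[of _ "cmod c * a"])
qed

lemma id_op_in: "id_op H \<in> bounded_ops H"
  by (auto simp: bounded_ops_def id_op_def clinear_on_def intro!: exI[of _ 1])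

lemma id_op_apply [simp]: "x \<in> hcarrier H \<Longrightarrow> id_op H x = x"
  by (simp add: id_op_def)

subsection \<open>The matrix norm\<close>

lemma mat_apply_bounded:
  assumes I: "finite I" and x: "\<And>i j. i \<in> I \<Longrightarrow> j \<in> I \<Longrightarrow> x i j \<in> bounded_ops H"
  obtains C where "C \<ge> 0" "\<And>\<xi>. (\<And>j. j \<in> I \<Longrightarrow> \<xi> j \<in> hcarrier H) \<Longrightarrow>
      L2_set (\<lambda>i. hnorm H (\<Sum>j\<in>I. x i j (\<xi> j))) I \<le> C * L2_set (\<lambda>j. hnorm H (\<xi> j)) I"
proof -
  have "\<forall>i\<in>I. \<forall>j\<in>I. \<exists>C\<ge>0. \<forall>\<xi>\<in>hcarrier H. hnorm H (x i j \<xi>) \<le> C * hnorm H \<xi>"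
    using bounded_ops_bound[OF x] by metis
  then obtain c where c: "\<And>i j. i \<in> I \<Longrightarrow> j \<in> I \<Longrightarrow> c i j \<ge> 0"
    "\<And>i j \<xi>. i \<in> I \<Longrightarrow> j \<in> I \<Longrightarrow> \<xi> \<in> hcarrier H \<Longrightarrow> hnorm H (x i j \<xi>) \<le> c i j * hnorm H \<xi>"
    by metis
  define C where "C = (\<Sum>i\<in>I. \<Sum>j\<in>I. c i j)"
  have "C \<ge> 0" unfolding C_def by (intro sum_nonneg c)
  moreover have "L2_set (\<lambda>i. hnorm H (\<Sum>j\<in>I. x i j (\<xi> j))) I \<le> C * L2_set (\<lambda>j. hnorm H (\<xi> j)) I"
    if \<xi>: "\<And>j. j \<in> I \<Longrightarrow> \<xi> j \<in> hcarrier H" for \<xi>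
  proof -
    have in_H: "x i j (\<xi> j) \<in> hcarrier H" if "i \<in> I" "j \<in> I" for i j
      using bounded_opsD(2)[OF x[OF that] \<xi>[OF that(2)]] .
    have le: "hnorm H (\<xi> j) \<le> L2_set (\<lambda>j. hnorm H (\<xi> j)) I" if "j \<in> I" for j
      using member_le_L2_set[OF I that, of "\<lambda>j. hnorm H (\<xi> j)"] .
    have "L2_set (\<lambda>i. hnorm H (\<Sum>j\<in>I. x i j (\<xi> j))) I \<le> (\<Sum>i\<in>I. hnorm H (\<Sum>j\<in>I. x i j (\<xi> j)))"
      by (intro L2_set_le_sum hnorm_nonneg sum_in in_H)
    also have "\<dots> \<le> (\<Sum>i\<in>I. \<Sum>j\<in>I. c i j * L2_set (\<lambda>j. hnorm H (\<xi> j)) I)"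
    proof (intro sum_mono order_trans[OF hnorm_sum])
      fix i j assume ij: "i \<in> I" "j \<in> I"
      show "hnorm H (x i j (\<xi> j)) \<le> c i j * L2_set (\<lambda>j. hnorm H (\<xi> j)) I"
        using c(2)[OF ij \<xi>[OF ij(2)]] mult_left_mono[OF le[OF ij(2)] c(1)[OF ij]] by linarith
    qed (simp add: in_H)
    finally show ?thesis by (simp add: C_def sum_distrib_right)
  qed
  ultimately show ?thesis using that by blast
qed

lemma mat_norm_alt:
  "mat_norm H I x = Sup {L2_set (\<lambda>i. hnorm H (\<Sum>j\<in>I. x i j (\<xi> j))) I | \<xi>.
     (\<forall>j\<in>I. \<xi> j \<in> hcarrier H) \<and> L2_set (\<lambda>j. hnorm H (\<xi> j)) I \<le> 1}"
  unfolding mat_norm_def L2_set_def by simp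

lemma mat_norm_bdd_above:
  assumes I: "finite I" and x: "\<And>i j. i \<in> I \<Longrightarrow> j \<in> I \<Longrightarrow> x i j \<in> bounded_ops H"
  shows "bdd_above {L2_set (\<lambda>i. hnorm H (\<Sum>j\<in>I. x i j (\<xi> j))) I | \<xi>.
     (\<forall>j\<in>I. \<xi> j \<in> hcarrier H) \<and> L2_set (\<lambda>j. hnorm H (\<xi> j)) I \<le> 1}"
proof -
  obtain C where C: "C \<ge> 0" "\<And>\<xi>. (\<And>j. j \<in> I \<Longrightarrow> \<xi> j \<in> hcarrier H) \<Longrightarrow>
      L2_set (\<lambda>i. hnorm H (\<Sum>j\<in>I. x i j (\<xi> j))) I \<le> C * L2_set (\<lambda>j. hnorm H (\<xi> j)) I"
    by (rule mat_apply_bounded[of I x]) (use I x in auto)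
  show ?thesis
  proof (rule bdd_aboveI, safe)
    fix \<xi> assume "\<forall>j\<in>I. \<xi> j \<in> hcarrier H" "L2_set (\<lambda>j. hnorm H (\<xi> j)) I \<le> 1"
    then show "L2_set (\<lambda>i. hnorm H (\<Sum>j\<in>I. x i j (\<xi> j))) I \<le> C"
      using order_trans[OF C(2) mult_left_le[OF _ C(1)]] by blast
  qed
qed

lemma mat_norm_apply:
  assumes I: "finite I" and x: "\<And>i j. i \<in> I \<Longrightarrow> j \<in> I \<Longrightarrow> x i j \<in> bounded_ops H"
    and \<xi>: "\<And>j. j \<in> I \<Longrightarrow> \<xi> j \<in> hcarrier H"
  shows "L2_set (\<lambda>i. hnorm H (\<Sum>j\<in>I. x i j (\<xi> j))) I
    \<le> mat_norm H I x * L2_set (\<lambda>j. hnorm H (\<xi> j)) I"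
proof -
  obtain C where C: "C \<ge> 0" "\<And>\<xi>. (\<And>j. j \<in> I \<Longrightarrow> \<xi> j \<in> hcarrier H) \<Longrightarrow>
      L2_set (\<lambda>i. hnorm H (\<Sum>j\<in>I. x i j (\<xi> j))) I \<le> C * L2_set (\<lambda>j. hnorm H (\<xi> j)) I"
    by (rule mat_apply_bounded[of I x]) (use I x in auto)
  define r where "r = L2_set (\<lambda>j. hnorm H (\<xi> j)) I"
  have r0: "r \<ge> 0" by (simp add: r_def)
  show ?thesis
  proof (cases "r = 0")
    case True
    then show ?thesis using C(2)[of \<xi>] \<xi> by (simp add: r_def)
  next
    case False
    with r0 have r: "r > 0" by simp
    define \<zeta> where "\<zeta> j = complex_of_real (1 / r) *\<^sub>C \<xi> j" for j
    have \<zeta>: "\<zeta> j \<in> hcarrier H" if "j \<in> I" for j using \<xi>[OF that] by (simp add: \<zeta>_def)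
    have 1: "L2_set (\<lambda>j. hnorm H (\<zeta> j)) I = 1"
    proof -
      have "L2_set (\<lambda>j. hnorm H (\<zeta> j)) I = L2_set (\<lambda>j. (1 / r) * hnorm H (\<xi> j)) I"
        using \<xi> r by (intro L2_set_cong refl) (simp add: \<zeta>_def norm_divide)
      also have "\<dots> = (1 / r) * r"
        unfolding r_def using r by (intro L2_set_right_distrib[symmetric]) (simp add: r_def)
      finally show ?thesis using r by simp
    qed
    have in_H: "x i j (\<xi> j) \<in> hcarrier H" if "i \<in> I" "j \<in> I" for i j
      using bounded_opsD(2)[OF x[OF that] \<xi>[OF that(2)]] .
    have "L2_set (\<lambda>i. hnorm H (\<Sum>j\<in>I. x i j (\<zeta> j))) I
        = L2_set (\<lambda>i. (1 / r) * hnorm H (\<Sum>j\<in>I. x i j (\<xi> j))) I"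
    proof (intro L2_set_cong refl)
      fix i assume i: "i \<in> I"
      have "(\<Sum>j\<in>I. x i j (\<zeta> j)) = complex_of_real (1 / r) *\<^sub>C (\<Sum>j\<in>I. x i j (\<xi> j))"
        unfolding \<zeta>_def complex_vector.scale_sum_right
        by (intro sum.cong refl clinear_on_scaleC[OF bounded_opsD(1)[OF x[OF i]]] \<xi>)
      then show "hnorm H (\<Sum>j\<in>I. x i j (\<zeta> j)) = (1 / r) * hnorm H (\<Sum>j\<in>I. x i j (\<xi> j))"
        using in_H[OF i] r by (simp add: norm_divide)
    qed
    also have "\<dots> = (1 / r) * L2_set (\<lambda>i. hnorm H (\<Sum>j\<in>I. x i j (\<xi> j))) I"
      using r by (intro L2_set_right_distrib[symmetric]) simp
    finally have eq: "L2_set (\<lambda>i. hnorm H (\<Sum>j\<in>I. x i j (\<zeta> j))) I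
        = L2_set (\<lambda>i. hnorm H (\<Sum>j\<in>I. x i j (\<xi> j))) I / r"
      by simp
    have "L2_set (\<lambda>i. hnorm H (\<Sum>j\<in>I. x i j (\<zeta> j))) I \<le> mat_norm H I x"
      unfolding mat_norm_alt
    proof (rule cSup_upper)
      show "bdd_above {L2_set (\<lambda>i. hnorm H (\<Sum>j\<in>I. x i j (\<xi> j))) I | \<xi>.
         (\<forall>j\<in>I. \<xi> j \<in> hcarrier H) \<and> L2_set (\<lambda>j. hnorm H (\<xi> j)) I \<le> 1}"
        by (rule mat_norm_bdd_above) (use I x in auto)
    qed (use 1 \<zeta> in auto)
    then show ?thesis
      using r unfolding eq by (simp add: field_simps r_def)
  qed
qed

lemma mat_norm_le:
  assumes I: "finite I" and C: "C \<ge> 0"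
    and "\<And>\<xi>. (\<And>j. j \<in> I \<Longrightarrow> \<xi> j \<in> hcarrier H) \<Longrightarrow>
      L2_set (\<lambda>i. hnorm H (\<Sum>j\<in>I. x i j (\<xi> j))) I \<le> C * L2_set (\<lambda>j. hnorm H (\<xi> j)) I"
  shows "mat_norm H I x \<le> C"
  unfolding mat_norm_alt
proof (rule cSup_least)
  show "{L2_set (\<lambda>i. hnorm H (\<Sum>j\<in>I. x i j (\<xi> j))) I | \<xi>.
     (\<forall>j\<in>I. \<xi> j \<in> hcarrier H) \<and> L2_set (\<lambda>j. hnorm H (\<xi> j)) I \<le> 1} \<noteq> {}"
    by (auto intro!: exI[of _ "\<lambda>_. 0"] simp: L2_set_def)
next
  fix y assume "y \<in> {L2_set (\<lambda>i. hnorm H (\<Sum>j\<in>I. x i j (\<xi> j))) I | \<xi>.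
     (\<forall>j\<in>I. \<xi> j \<in> hcarrier H) \<and> L2_set (\<lambda>j. hnorm H (\<xi> j)) I \<le> 1}"
  then obtain \<xi> where \<xi>: "\<forall>j\<in>I. \<xi> j \<in> hcarrier H" "L2_set (\<lambda>j. hnorm H (\<xi> j)) I \<le> 1"
    and y: "y = L2_set (\<lambda>i. hnorm H (\<Sum>j\<in>I. x i j (\<xi> j))) I" by blast
  show "y \<le> C"
    using assms(3)[of \<xi>] \<xi> y mult_left_mono[OF \<xi>(2) C] by auto
qed

lemma mat_norm_nonneg:
  assumes I: "finite I" and x: "\<And>i j. i \<in> I \<Longrightarrow> j \<in> I \<Longrightarrow> x i j \<in> bounded_ops H"
  shows "mat_norm H I x \<ge> 0"
proof -
  have "L2_set (\<lambda>i. hnorm H (\<Sum>j\<in>I. x i j 0)) I \<le> mat_norm H I x"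
    unfolding mat_norm_alt
    by (rule cSup_upper[OF _ mat_norm_bdd_above]) (use I x in \<open>auto intro!: exI[of _ "\<lambda>_. 0"] simp: L2_set_def\<close>)
  then show ?thesis using L2_set_nonneg order_trans by blast
qed

definition form :: "'i set \<Rightarrow> ('i \<Rightarrow> 'i \<Rightarrow> 'h \<Rightarrow> 'h) \<Rightarrow> ('i \<Rightarrow> 'h) \<Rightarrow> ('i \<Rightarrow> 'h) \<Rightarrow> complex" where
  "form I x \<xi> \<eta> = (\<Sum>i\<in>I. \<Sum>j\<in>I. hinner H (x i j (\<xi> j)) (\<eta> i))"

lemma form_alt:
  assumes x: "\<And>i j. i \<in> I \<Longrightarrow> j \<in> I \<Longrightarrow> x i j \<in> bounded_ops H"
    and \<xi>: "\<And>j. j \<in> I \<Longrightarrow> \<xi> j \<in> hcarrier H" and \<eta>: "\<And>j. j \<in> I \<Longrightarrow> \<eta> j \<in> hcarrier H"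
  shows "form I x \<xi> \<eta> = (\<Sum>i\<in>I. hinner H (\<Sum>j\<in>I. x i j (\<xi> j)) (\<eta> i))"
  unfolding form_def using bounded_opsD(2)[OF x] \<xi> \<eta>
  by (intro sum.cong refl inner_sum_left[symmetric]) auto

lemma form_le:
  assumes I: "finite I" and x: "\<And>i j. i \<in> I \<Longrightarrow> j \<in> I \<Longrightarrow> x i j \<in> bounded_ops H"
    and \<xi>: "\<And>j. j \<in> I \<Longrightarrow> \<xi> j \<in> hcarrier H" and \<eta>: "\<And>j. j \<in> I \<Longrightarrow> \<eta> j \<in> hcarrier H"
  shows "cmod (form I x \<xi> \<eta>)
    \<le> mat_norm H I x * L2_set (\<lambda>j. hnorm H (\<xi> j)) I * L2_set (\<lambda>j. hnorm H (\<eta> j)) I"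
proof -
  have in_H: "(\<Sum>j\<in>I. x i j (\<xi> j)) \<in> hcarrier H" if "i \<in> I" for i
    using bounded_opsD(2)[OF x[OF that] \<xi>] by simp
  have eq: "form I x \<xi> \<eta> = (\<Sum>i\<in>I. hinner H (\<Sum>j\<in>I. x i j (\<xi> j)) (\<eta> i))"
    by (rule form_alt) (use x \<xi> \<eta> in auto)
  have "cmod (form I x \<xi> \<eta>) \<le> (\<Sum>i\<in>I. hnorm H (\<Sum>j\<in>I. x i j (\<xi> j)) * hnorm H (\<eta> i))"
    unfolding eq
    by (intro order_trans[OF norm_sum] sum_mono cauchy_schwarz in_H \<eta>)
  also have "\<dots> = (\<Sum>i\<in>I. \<bar>hnorm H (\<Sum>j\<in>I. x i j (\<xi> j))\<bar> * \<bar>hnorm H (\<eta> i)\<bar>)"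
    using in_H \<eta> by (intro sum.cong) auto
  also have "\<dots> \<le> L2_set (\<lambda>i. hnorm H (\<Sum>j\<in>I. x i j (\<xi> j))) I * L2_set (\<lambda>j. hnorm H (\<eta> j)) I"
    by (rule L2_set_mult_ineq)
  also have "\<dots> \<le> mat_norm H I x * L2_set (\<lambda>j. hnorm H (\<xi> j)) I * L2_set (\<lambda>j. hnorm H (\<eta> j)) I"
    by (intro mult_right_mono mat_norm_apply I x \<xi>) auto
  finally show ?thesis .
qed

text \<open>For one direction use \<open>2 a b \<le> a\<^sup>2 + b\<^sup>2\<close>; for the other, the quadratic inequality
  with \<open>\<eta> = s\<inverse> x \<xi>\<close> reads \<open>\<parallel>x \<xi>\<parallel> \<le> s \<parallel>\<xi>\<parallel>\<close>.\<close>

lemma mat_norm_le_quadratic_iff: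
  assumes I: "finite I" and x: "\<And>i j. i \<in> I \<Longrightarrow> j \<in> I \<Longrightarrow> x i j \<in> bounded_ops H" and s: "s > 0"
  shows "mat_norm H I x \<le> s \<longleftrightarrow>
    (\<forall>\<xi> \<eta>. (\<forall>j\<in>I. \<xi> j \<in> hcarrier H) \<longrightarrow> (\<forall>j\<in>I. \<eta> j \<in> hcarrier H) \<longrightarrow>
      2 * Re (form I x \<xi> \<eta>) \<le> s * ((\<Sum>j\<in>I. (hnorm H (\<xi> j))\<^sup>2) + (\<Sum>j\<in>I. (hnorm H (\<eta> j))\<^sup>2)))"
    (is "_ \<longleftrightarrow> ?R")
proof
  assume le: "mat_norm H I x \<le> s"
  show ?R
  proof (intro allI impI)
    fix \<xi> \<eta> assume \<xi>: "\<forall>j\<in>I. \<xi> j \<in> hcarrier H" and \<eta>: "\<forall>j\<in>I. \<eta> j \<in> hcarrier H"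
    define a b where "a = L2_set (\<lambda>j. hnorm H (\<xi> j)) I" and "b = L2_set (\<lambda>j. hnorm H (\<eta> j)) I"
    have ab: "a \<ge> 0" "b \<ge> 0" "a\<^sup>2 = (\<Sum>j\<in>I. (hnorm H (\<xi> j))\<^sup>2)" "b\<^sup>2 = (\<Sum>j\<in>I. (hnorm H (\<eta> j))\<^sup>2)"
      by (auto simp: a_def b_def L2_set_def sum_nonneg)
    have "Re (form I x \<xi> \<eta>) \<le> mat_norm H I x * (a * b)"
      using form_le[where x = x and \<xi> = \<xi> and \<eta> = \<eta>, OF I x] \<xi> \<eta> complex_Re_le_cmod[of "form I x \<xi> \<eta>"]
      by (simp add: a_def b_def mult.assoc)
    also have "\<dots> \<le> s * (a * b)" using le ab by (intro mult_right_mono) auto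
    finally have "2 * Re (form I x \<xi> \<eta>) \<le> s * (2 * a * b)" by simp
    also have "\<dots> \<le> s * (a\<^sup>2 + b\<^sup>2)"
      using s by (intro mult_left_mono sum_squares_bound) auto
    finally show "2 * Re (form I x \<xi> \<eta>) \<le>
        s * ((\<Sum>j\<in>I. (hnorm H (\<xi> j))\<^sup>2) + (\<Sum>j\<in>I. (hnorm H (\<eta> j))\<^sup>2))"
      by (simp add: ab)
  qed
next
  assume R: ?R
  show "mat_norm H I x \<le> s"
  proof (rule mat_norm_le[OF I])
    fix \<xi> assume \<xi>: "\<And>j. j \<in> I \<Longrightarrow> \<xi> j \<in> hcarrier H"
    define y where "y i = (\<Sum>j\<in>I. x i j (\<xi> j))" for i
    have y: "y i \<in> hcarrier H" if "i \<in> I" for i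
      unfolding y_def using bounded_opsD(2)[OF x[OF that] \<xi>] by simp
    define N where "N = (\<Sum>j\<in>I. (hnorm H (y j))\<^sup>2)"
    define \<eta> where "\<eta> i = complex_of_real (1 / s) *\<^sub>C y i" for i
    have \<eta>: "\<And>i. i \<in> I \<Longrightarrow> \<eta> i \<in> hcarrier H" using y by (simp add: \<eta>_def)
    have "form I x \<xi> \<eta> = (\<Sum>i\<in>I. hinner H (y i) (\<eta> i))"
      using form_alt[OF x \<xi> \<eta>] by (simp add: y_def)
    also have "\<dots> = (\<Sum>i\<in>I. of_real ((1 / s) * (hnorm H (y i))\<^sup>2))"
      using y by (intro sum.cong refl) (simp add: \<eta>_def inner_scaleC_right inner_self)
    finally have f: "Re (form I x \<xi> \<eta>) = N / s"
      by (simp add: N_def sum_divide_distrib)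
    have "(\<Sum>j\<in>I. (hnorm H (\<eta> j))\<^sup>2) = (\<Sum>j\<in>I. (1 / s)\<^sup>2 * (hnorm H (y j))\<^sup>2)"
      using y s by (intro sum.cong refl) (simp add: \<eta>_def norm_divide power_divide)
    then have e: "(\<Sum>j\<in>I. (hnorm H (\<eta> j))\<^sup>2) = N / s\<^sup>2"
      by (simp add: N_def sum_divide_distrib power_divide)
    have "2 * (N / s) \<le> s * ((\<Sum>j\<in>I. (hnorm H (\<xi> j))\<^sup>2) + N / s\<^sup>2)"
      using R[rule_format, of \<xi> \<eta>] \<xi> \<eta> f e by simp
    then have "N \<le> s\<^sup>2 * (\<Sum>j\<in>I. (hnorm H (\<xi> j))\<^sup>2)"
      using s by (simp add: field_simps power2_eq_square)
    then have "sqrt N \<le> sqrt (s\<^sup>2 * (\<Sum>j\<in>I. (hnorm H (\<xi> j))\<^sup>2))" by simp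
    then show "L2_set (\<lambda>i. hnorm H (\<Sum>j\<in>I. x i j (\<xi> j))) I \<le> s * L2_set (\<lambda>j. hnorm H (\<xi> j)) I"
      using s by (simp add: L2_set_def N_def y_def real_sqrt_mult)
  qed (use s in simp)
qed

lemma mat_norm_le_form:
  assumes I: "finite I" and x: "\<And>i j. i \<in> I \<Longrightarrow> j \<in> I \<Longrightarrow> x i j \<in> bounded_ops H" and C: "C \<ge> 0"
    and le: "\<And>\<xi> \<eta>. (\<And>j. j \<in> I \<Longrightarrow> \<xi> j \<in> hcarrier H) \<Longrightarrow> (\<And>j. j \<in> I \<Longrightarrow> \<eta> j \<in> hcarrier H) \<Longrightarrow>
      cmod (form I x \<xi> \<eta>) \<le> C * L2_set (\<lambda>j. hnorm H (\<xi> j)) I * L2_set (\<lambda>j. hnorm H (\<eta> j)) I"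
  shows "mat_norm H I x \<le> C"
proof (rule field_le_epsilon)
  fix e :: real assume e: "e > 0"
  note iff = mat_norm_le_quadratic_iff[where x = x, OF I x add_nonneg_pos[OF C e]]
  show "mat_norm H I x \<le> C + e"
  proof (rule iff[THEN iffD2], assumption, assumption, intro allI impI)
    fix \<xi> \<eta> assume \<xi>: "\<forall>j\<in>I. \<xi> j \<in> hcarrier H" and \<eta>: "\<forall>j\<in>I. \<eta> j \<in> hcarrier H"
    define a b where "a = L2_set (\<lambda>j. hnorm H (\<xi> j)) I" and "b = L2_set (\<lambda>j. hnorm H (\<eta> j)) I"
    have ab: "a \<ge> 0" "b \<ge> 0" "a\<^sup>2 = (\<Sum>j\<in>I. (hnorm H (\<xi> j))\<^sup>2)" "b\<^sup>2 = (\<Sum>j\<in>I. (hnorm H (\<eta> j))\<^sup>2)"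
      by (auto simp: a_def b_def L2_set_def sum_nonneg)
    have "Re (form I x \<xi> \<eta>) \<le> C * (a * b)"
      using le[of \<xi> \<eta>] \<xi> \<eta> complex_Re_le_cmod[of "form I x \<xi> \<eta>"]
      by (simp add: a_def b_def mult.assoc)
    also have "\<dots> \<le> (C + e) * (a * b)" using e ab by (intro mult_right_mono) auto
    finally have "2 * Re (form I x \<xi> \<eta>) \<le> (C + e) * (2 * a * b)" by simp
    also have "\<dots> \<le> (C + e) * (a\<^sup>2 + b\<^sup>2)"
      using C e by (intro mult_left_mono sum_squares_bound) auto
    finally show "2 * Re (form I x \<xi> \<eta>) \<le>
        (C + e) * ((\<Sum>j\<in>I. (hnorm H (\<xi> j))\<^sup>2) + (\<Sum>j\<in>I. (hnorm H (\<eta> j))\<^sup>2))"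
      by (simp add: ab)
  qed
qed

subsection \<open>The operator norm\<close>

lemma lessThan_1: "{..<1::nat} = {0}" by auto

lemma op_norm_nonneg: "A \<in> bounded_ops H \<Longrightarrow> op_norm H A \<ge> 0"
  unfolding op_norm_def by (rule mat_norm_nonneg) auto

lemma op_norm_apply:
  "\<lbrakk>A \<in> bounded_ops H; \<xi> \<in> hcarrier H\<rbrakk> \<Longrightarrow> hnorm H (A \<xi>) \<le> op_norm H A * hnorm H \<xi>"
  using mat_norm_apply[of "{..<1::nat}" "\<lambda>_ _. A" "\<lambda>_. \<xi>"] bounded_opsD(2)[of A \<xi>]
  by (simp add: op_norm_def lessThan_1 L2_set_def)

lemma op_norm_le:
  "\<lbrakk>A \<in> bounded_ops H; C \<ge> 0; \<And>\<xi>. \<xi> \<in> hcarrier H \<Longrightarrow> hnorm H (A \<xi>) \<le> C * hnorm H \<xi>\<rbrakk>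
    \<Longrightarrow> op_norm H A \<le> C"
  using bounded_opsD(2)[of A]
  unfolding op_norm_def by (intro mat_norm_le) (auto simp: lessThan_1 L2_set_def)

lemma op_norm_le_form:
  assumes "A \<in> bounded_ops H" "C \<ge> 0"
    "\<And>\<xi> \<eta>. \<xi> \<in> hcarrier H \<Longrightarrow> \<eta> \<in> hcarrier H \<Longrightarrow>
      cmod (hinner H (A \<xi>) \<eta>) \<le> C * hnorm H \<xi> * hnorm H \<eta>"
  shows "op_norm H A \<le> C"
  unfolding op_norm_def using assms
  by (intro mat_norm_le_form) (auto simp: form_def lessThan_1 L2_set_def)

lemma op_norm_form:
  assumes "A \<in> bounded_ops H" "\<xi> \<in> hcarrier H" "\<eta> \<in> hcarrier H"
  shows "cmod (hinner H (A \<xi>) \<eta>) \<le> op_norm H A * hnorm H \<xi> * hnorm H \<eta>"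
  using cauchy_schwarz[OF bounded_opsD(2)[OF assms(1,2)] assms(3)]
    mult_right_mono[OF op_norm_apply[OF assms(1,2)] hnorm_nonneg[OF assms(3)]] by linarith

lemma op_norm_add:
  assumes A: "A \<in> bounded_ops H" and B: "B \<in> bounded_ops H"
  shows "op_norm H (A + B) \<le> op_norm H A + op_norm H B"
proof (rule op_norm_le)
  show "A + B \<in> bounded_ops H"
    using complex_vector.subspace_add[OF csubspace_bounded_ops A B] .
  fix \<xi> assume \<xi>: "\<xi> \<in> hcarrier H"
  show "hnorm H ((A + B) \<xi>) \<le> (op_norm H A + op_norm H B) * hnorm H \<xi>"
    using hnorm_triangle[OF bounded_opsD(2)[OF A \<xi>] bounded_opsD(2)[OF B \<xi>]]
      op_norm_apply[OF A \<xi>] op_norm_apply[OF B \<xi>] by (simp add: algebra_simps)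
qed (use op_norm_nonneg A B in simp)

lemma op_norm_scaleC_le:
  assumes A: "A \<in> bounded_ops H"
  shows "op_norm H (c *\<^sub>C A) \<le> cmod c * op_norm H A"
proof (rule op_norm_le)
  show "c *\<^sub>C A \<in> bounded_ops H"
    using complex_vector.subspace_scale[OF csubspace_bounded_ops A] .
  fix \<xi> assume \<xi>: "\<xi> \<in> hcarrier H"
  show "hnorm H ((c *\<^sub>C A) \<xi>) \<le> cmod c * op_norm H A * hnorm H \<xi>"
    using mult_left_mono[OF op_norm_apply[OF A \<xi>], of "cmod c"] bounded_opsD(2)[OF A \<xi>]
    by (simp add: scaleC_fun_def mult.assoc)
qed (use op_norm_nonneg A in simp)

lemma op_norm_scaleC:
  assumes A: "A \<in> bounded_ops H"
  shows "op_norm H (c *\<^sub>C A) = cmod c * op_norm H A"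
proof (cases "c = 0")
  case True
  then show ?thesis
    using op_norm_scaleC_le[OF A, of 0] complex_vector.subspace_0[OF csubspace_bounded_ops]
      op_norm_nonneg[of "0"] by auto
next
  case False
  have cA: "c *\<^sub>C A \<in> bounded_ops H"
    using complex_vector.subspace_scale[OF csubspace_bounded_ops A] .
  have "op_norm H A \<le> cmod (inverse c) * op_norm H (c *\<^sub>C A)"
    using op_norm_scaleC_le[OF cA, of "inverse c"] False by (simp add: scaleC_scaleC scaleC_one)
  then show ?thesis
    using op_norm_scaleC_le[OF A, of c] False by (auto simp: field_simps norm_divide)
qed

lemma op_norm_eq_0:
  assumes A: "A \<in> bounded_ops H" and "op_norm H A = 0"
  shows "A = 0"
proof
  fix x
  show "A x = 0 x"
  proof (cases "x \<in> hcarrier H")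
    case True
    then show ?thesis
      using op_norm_apply[OF A True] assms(2) bounded_opsD(2)[OF A True] hnorm_eq_0[of "A x"]
        hnorm_nonneg[of "A x"] by (auto simp del: hnorm_nonneg)
  qed (use bounded_opsD(3)[OF A] in simp)
qed

lemma op_norm_zero [simp]: "op_norm H 0 = 0"
  using op_norm_scaleC[OF complex_vector.subspace_0[OF csubspace_bounded_ops], of 0] by simp

end

subsection \<open>Scalar matrices\<close>

lemma hnorm_complex_hspace [simp]: "hnorm complex_hspace z = cmod z"
  by (simp add: hnorm_def complex_hspace_def complex_mult_cnj cmod_def power2_eq_square)

lemma hcarrier_complex_hspace [simp]: "hcarrier complex_hspace = UNIV"
  by (simp add: complex_hspace_def)

lemma hinner_complex_hspace [simp]: "hinner complex_hspace x y = x * cnj y"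
  by (simp add: complex_hspace_def)

interpretation complex_hspace: hilbert_space complex_hspace
proof
  show "complete_wrt (hnorm complex_hspace) (hcarrier complex_hspace)"
    unfolding complete_wrt_def
  proof (intro allI impI)
    fix s :: "nat \<Rightarrow> complex"
    assume "(\<forall>n. s n \<in> hcarrier complex_hspace) \<and>
      (\<forall>e>0. \<exists>M. \<forall>m\<ge>M. \<forall>n\<ge>M. hnorm complex_hspace (s m - s n) < e)"
    then have "Cauchy s" by (simp add: Cauchy_def dist_norm)
    then obtain l where "s \<longlonglongrightarrow> l" using convergent_eq_Cauchy convergent_def by blast
    then have "(\<lambda>n. s n - l) \<longlonglongrightarrow> 0" by (simp add: LIM_zero)
    then show "\<exists>l\<in>hcarrier complex_hspace. (\<lambda>n. hnorm complex_hspace (s n - l)) \<longlonglongrightarrow> 0"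
      by (auto simp: tendsto_norm_zero_iff)
  qed
qed (auto simp: clinear_on_def algebra_simps scaleC_complex_def complex_vector.subspace_UNIV
    complex_eq_iff sum_squares_gt_zero_iff)

lemma scalar_op_in: "(\<lambda>z. a * z) \<in> bounded_ops complex_hspace"
  by (auto simp: bounded_ops_def clinear_on_def algebra_simps scaleC_complex_def norm_mult
      intro!: exI[of _ "cmod a"])

lemma scalar_form_le:
  assumes "finite I"
  shows "cmod (\<Sum>p\<in>I. \<Sum>q\<in>I. a p q * \<xi> q * cnj (\<eta> p))
    \<le> scalar_mat_norm I a * L2_set (\<lambda>q. cmod (\<xi> q)) I * L2_set (\<lambda>p. cmod (\<eta> p)) I"
  using complex_hspace.form_le[OF assms, of "\<lambda>p q z. a p q * z" \<xi> \<eta>] scalar_op_in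
  by (simp add: scalar_mat_norm_def complex_hspace.form_def)

lemma scalar_mat_norm_le:
  assumes "finite I" "C \<ge> 0"
    "\<And>\<xi> \<eta>. cmod (\<Sum>p\<in>I. \<Sum>q\<in>I. a p q * \<xi> q * cnj (\<eta> p))
      \<le> C * L2_set (\<lambda>q. cmod (\<xi> q)) I * L2_set (\<lambda>p. cmod (\<eta> p)) I"
  shows "scalar_mat_norm I a \<le> C"
  unfolding scalar_mat_norm_def using assms scalar_op_in
  by (intro complex_hspace.mat_norm_le_form) (auto simp: complex_hspace.form_def)

section \<open>A minimax theorem\<close>

lemma continuous_map_real_pair:
  assumes "continuous_map Y euclideanreal f" "continuous_map Y euclideanreal g"
  shows "continuous_map Y (euclidean :: (real \<times> real) topology) (\<lambda>c. (f c, g c))"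
  using continuous_map_paired[of Y euclideanreal euclideanreal f g] assms
  by simp

text \<open>The image of \<open>Y\<close> in the plane is compact, convex and disjoint from the closed negative quadrant.
  The coefficients of a separating line are nonnegative, since the line would meet the quadrant otherwise.\<close>

lemma minimax_two:
  fixes f g :: "'a \<Rightarrow> real"
  assumes Y: "compact_space Y"
    and cont: "continuous_map Y euclideanreal f" "continuous_map Y euclideanreal g"
    and conv: "\<And>c d t. \<lbrakk>c \<in> topspace Y; d \<in> topspace Y; 0 \<le> t; t \<le> 1\<rbrakk> \<Longrightarrow>
      \<exists>e\<in>topspace Y. f e = (1 - t) * f c + t * f d \<and> g e = (1 - t) * g c + t * g d"
    and pos: "\<And>c. c \<in> topspace Y \<Longrightarrow> f c > 0 \<or> g c > 0"
  shows "\<exists>t. 0 \<le> t \<and> t \<le> 1 \<and> (\<forall>c\<in>topspace Y. (1 - t) * f c + t * g c > 0)"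
proof (cases "topspace Y = {}")
  case True
  then show ?thesis by (auto intro!: exI[of _ 0])
next
  case False
  define S where "S = (\<lambda>c. (f c, g c)) ` topspace Y"
  define N where "N = {..0::real} \<times> {..0::real}"
  have S: "compact S"
    using image_compactin[OF Y[unfolded compact_space_def] continuous_map_real_pair[OF cont]]
    by (simp add: S_def)
  have "convex S"
    unfolding convex_alt
  proof (intro ballI allI impI)
    fix x y t assume "x \<in> S" "y \<in> S" and t: "0 \<le> (t::real) \<and> t \<le> 1"
    then obtain c d where "c \<in> topspace Y" "x = (f c, g c)" "d \<in> topspace Y" "y = (f d, g d)"
      by (auto simp: S_def)
    then show "(1 - t) *\<^sub>R x + t *\<^sub>R y \<in> S"
      using conv[of c d t] t by (force simp: S_def)
  qed
  moreover have "convex N" "closed N"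
    by (auto simp: N_def intro: convex_Times closed_Times)
  moreover have "S \<inter> N = {}" "S \<noteq> {}"
    using pos False by (force simp: S_def N_def)+
  ultimately obtain a b where a: "\<And>x. x \<in> S \<Longrightarrow> inner a x < b" "\<And>x. x \<in> N \<Longrightarrow> inner a x > b"
    using separating_hyperplane_compact_closed[of S N] S by blast
  obtain p q where pq: "a = (p, q)" by (cases a)
  have b: "b < 0" using a(2)[of "(0, 0)"] by (simp add: N_def pq)
  have p: "p \<le> 0"
    using a(2)[of "(b / p, 0)"] b by (cases "p > 0") (auto simp: N_def pq divide_le_0_iff)
  have q: "q \<le> 0"
    using a(2)[of "(0, b / q)"] b by (cases "q > 0") (auto simp: N_def pq divide_le_0_iff)
  have S': "p * f c + q * g c < b" if "c \<in> topspace Y" for c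
    using a(1)[of "(f c, g c)"] that by (auto simp: S_def pq)
  have "p + q \<noteq> 0"
  proof
    assume "p + q = 0"
    then have "p = 0" "q = 0" using p q by auto
    then show False using S' \<open>topspace Y \<noteq> {}\<close> b by fastforce
  qed
  then have neg: "p + q < 0" using p q by auto
  have "(1 - q / (p + q)) * f c + q / (p + q) * g c > 0" if "c \<in> topspace Y" for c
  proof -
    have "1 - q / (p + q) = p / (p + q)"
      using neg by (simp add: field_simps)
    then have "(1 - q / (p + q)) * f c + q / (p + q) * g c = (p * f c + q * g c) / (p + q)"
      by (simp add: add_divide_distrib)
    also have "\<dots> > 0" using S'[OF that] b neg by (intro divide_neg_neg) auto
    finally show ?thesis .
  qed
  moreover have "0 \<le> q / (p + q)" "q / (p + q) \<le> 1"
    using p q neg by (auto simp: divide_le_eq zero_le_divide_iff)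
  ultimately show ?thesis by blast
qed

text \<open>The functions are removed one at a time: where \<open>\<theta> \<le> 0\<close>, the remaining functions suffice, by
  induction; the function that they yield is then combined with \<open>\<theta>\<close>.\<close>

lemma minimax_finite:
  fixes \<Theta> :: "('a \<Rightarrow> real) set"
  assumes "finite F" "F \<subseteq> \<Theta>" "\<Theta> \<noteq> {}"
    and Y: "compact_space Y"
    and cont: "\<And>f. f \<in> \<Theta> \<Longrightarrow> continuous_map Y euclideanreal f"
    and convY: "\<And>c d t. \<lbrakk>c \<in> topspace Y; d \<in> topspace Y; 0 \<le> t; t \<le> 1\<rbrakk> \<Longrightarrow>
      \<exists>e\<in>topspace Y. \<forall>f\<in>\<Theta>. f e = (1 - t) * f c + t * f d"
    and conv\<Theta>: "\<And>f g t. \<lbrakk>f \<in> \<Theta>; g \<in> \<Theta>; 0 \<le> t; t \<le> 1\<rbrakk> \<Longrightarrow>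
      \<exists>h\<in>\<Theta>. \<forall>c\<in>topspace Y. h c = (1 - t) * f c + t * g c"
    and pos: "\<And>c. c \<in> topspace Y \<Longrightarrow> \<exists>f\<in>F. f c > 0"
  shows "\<exists>f\<in>\<Theta>. \<forall>c\<in>topspace Y. f c > 0"
  using assms
proof (induction F arbitrary: Y rule: finite_induct)
  case empty
  then show ?case by fastforce
next
  case (insert \<theta> F)
  define K where "K = {c \<in> topspace Y. \<theta> c \<le> 0}"
  have "closedin Y K"
    using closedin_continuous_map_preimage[of Y euclideanreal \<theta> "{..0}"] insert.prems
    by (auto simp: K_def)
  then have K: "compact_space (subtopology Y K)"
    using \<open>compact_space Y\<close> closedin_compact_space compact_space_subtopology by blast
  have top: "topspace (subtopology Y K) = K" by (auto simp: K_def)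
  have "\<exists>f\<in>\<Theta>. \<forall>c\<in>topspace (subtopology Y K). f c > 0"
  proof (rule insert.IH[OF _ insert.prems(2) K]; (unfold top)?)
    show "F \<subseteq> \<Theta>" using insert.prems by auto
    show "continuous_map (subtopology Y K) euclideanreal f" if "f \<in> \<Theta>" for f
      using insert.prems(4)[OF that] by (rule continuous_map_from_subtopology)
    show "\<exists>e\<in>K. \<forall>f\<in>\<Theta>. f e = (1 - t) * f c + t * f d"
      if cd: "c \<in> K" "d \<in> K" "0 \<le> t" "t \<le> 1" for c d t
    proof -
      obtain e where e: "e \<in> topspace Y" "\<forall>f\<in>\<Theta>. f e = (1 - t) * f c + t * f d"
        using insert.prems(5)[of c d t] cd unfolding K_def by blast
      have "\<theta> e = (1 - t) * \<theta> c + t * \<theta> d"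
        using e(2) insert.prems(1) by auto
      also have "\<dots> \<le> 0"
        using cd by (intro add_nonpos_nonpos mult_nonneg_nonpos) (auto simp: K_def)
      finally have "\<theta> e \<le> 0" .
      then show ?thesis using e by (auto simp: K_def)
    qed
    show "\<exists>h\<in>\<Theta>. \<forall>c\<in>K. h c = (1 - t) * f c + t * g c"
      if "f \<in> \<Theta>" "g \<in> \<Theta>" "0 \<le> t" "t \<le> 1" for f g t
      using insert.prems(6)[OF that] by (auto simp: K_def)
    show "\<exists>f\<in>F. f c > 0" if "c \<in> K" for c
      using insert.prems(7)[of c] that by (auto simp: K_def)
  qed
  then obtain \<theta>' where \<theta>': "\<theta>' \<in> \<Theta>" "\<And>c. c \<in> K \<Longrightarrow> \<theta>' c > 0" unfolding top by blast
  have \<theta>: "\<theta> \<in> \<Theta>" using insert.prems by auto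
  have "\<exists>t. 0 \<le> t \<and> t \<le> 1 \<and> (\<forall>c\<in>topspace Y. (1 - t) * \<theta> c + t * \<theta>' c > 0)"
  proof (rule minimax_two[OF insert.prems(3) insert.prems(4)[OF \<theta>] insert.prems(4)[OF \<theta>'(1)]])
    show "\<exists>e\<in>topspace Y. \<theta> e = (1 - t) * \<theta> c + t * \<theta> d \<and> \<theta>' e = (1 - t) * \<theta>' c + t * \<theta>' d"
      if "c \<in> topspace Y" "d \<in> topspace Y" "0 \<le> t" "t \<le> 1" for c d t
      using insert.prems(5)[OF that] \<theta> \<theta>'(1) by blast
    show "\<theta> c > 0 \<or> \<theta>' c > 0" if "c \<in> topspace Y" for c
      using \<theta>'(2)[of c] that by (force simp: K_def)
  qed
  then obtain t where t: "0 \<le> t" "t \<le> 1" "\<forall>c\<in>topspace Y. (1 - t) * \<theta> c + t * \<theta>' c > 0" by blast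
  obtain h where "h \<in> \<Theta>" "\<forall>c\<in>topspace Y. h c = (1 - t) * \<theta> c + t * \<theta>' c"
    using insert.prems(6)[OF \<theta> \<theta>'(1) t(1,2)] by blast
  then show ?case using t(3) by (intro bexI[of _ h]) auto
qed

text \<open>Only finitely many of the sets \<open>f > 0\<close> are needed to cover the compact space \<open>Y\<close>.  Convexity of
  \<open>Y\<close> and of \<open>\<Theta>\<close> is expressed through the values of the functions, so that neither has to be a subset of a
  vector space.\<close>

theorem minimax:
  fixes \<Theta> :: "('a \<Rightarrow> real) set"
  assumes Y: "compact_space Y" and ne: "\<Theta> \<noteq> {}"
    and cont: "\<And>f. f \<in> \<Theta> \<Longrightarrow> continuous_map Y euclideanreal f"
    and convY: "\<And>c d t. \<lbrakk>c \<in> topspace Y; d \<in> topspace Y; 0 \<le> t; t \<le> 1\<rbrakk> \<Longrightarrow>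
      \<exists>e\<in>topspace Y. \<forall>f\<in>\<Theta>. f e = (1 - t) * f c + t * f d"
    and conv\<Theta>: "\<And>f g t. \<lbrakk>f \<in> \<Theta>; g \<in> \<Theta>; 0 \<le> t; t \<le> 1\<rbrakk> \<Longrightarrow>
      \<exists>h\<in>\<Theta>. \<forall>c\<in>topspace Y. h c = (1 - t) * f c + t * g c"
    and pos: "\<And>c. c \<in> topspace Y \<Longrightarrow> \<exists>f\<in>\<Theta>. f c > 0"
  shows "\<exists>f\<in>\<Theta>. \<forall>c\<in>topspace Y. f c > 0"
proof -
  define U where "U f = {c \<in> topspace Y. f c > 0}" for f :: "'a \<Rightarrow> real"
  have "openin Y (U f)" if "f \<in> \<Theta>" for f
    using openin_continuous_map_preimage[OF cont[OF that], of "{0<..}"] by (auto simp: U_def)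
  moreover have "topspace Y \<subseteq> \<Union>(U ` \<Theta>)"
    using pos by (fastforce simp: U_def)
  ultimately obtain \<F> where "finite \<F>" "\<F> \<subseteq> U ` \<Theta>" "topspace Y \<subseteq> \<Union>\<F>"
    using compact_space_alt[THEN iffD1, rule_format, OF Y, of "U ` \<Theta>"] by blast
  then obtain F where F: "finite F" "F \<subseteq> \<Theta>" "topspace Y \<subseteq> \<Union>(U ` F)"
    by (metis finite_subset_image)
  show ?thesis
    by (rule minimax_finite[OF F(1,2) ne Y cont convY conv\<Theta>])
      (use F(3) in \<open>auto simp: U_def subset_iff\<close>)
qed

section \<open>The duality between \<open>X\<close> and \<open>V\<close>\<close>

lemma sum_fun_apply: "(\<Sum>i\<in>I. f i) x = (\<Sum>i\<in>I. f i x)"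
  for f :: "'i \<Rightarrow> 'a \<Rightarrow> 'b::comm_monoid_add"
  by (induction I rule: infinite_finite_induct) simp_all

lemma L2_set_scale: "r \<ge> 0 \<Longrightarrow> L2_set (\<lambda>i. f i * r) I = L2_set f I * r"
  by (rule L2_set_left_distrib[symmetric])

lemma sum_pairs:
  "(\<Sum>p\<in>A \<times> B. \<Sum>q\<in>A \<times> B. g p q) = (\<Sum>i\<in>B. \<Sum>j\<in>B. \<Sum>k\<in>A. \<Sum>l\<in>A. g (k, i) (l, j))"
proof -
  have "(\<Sum>p\<in>A \<times> B. \<Sum>q\<in>A \<times> B. g p q) = (\<Sum>k\<in>A. \<Sum>i\<in>B. \<Sum>l\<in>A. \<Sum>j\<in>B. g (k, i) (l, j))"
    by (simp add: sum.cartesian_product')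
  also have "\<dots> = (\<Sum>i\<in>B. \<Sum>k\<in>A. \<Sum>l\<in>A. \<Sum>j\<in>B. g (k, i) (l, j))"
    by (rule sum.swap)
  also have "\<dots> = (\<Sum>i\<in>B. \<Sum>k\<in>A. \<Sum>j\<in>B. \<Sum>l\<in>A. g (k, i) (l, j))"
    by (intro sum.cong refl sum.swap)
  also have "\<dots> = (\<Sum>i\<in>B. \<Sum>j\<in>B. \<Sum>k\<in>A. \<Sum>l\<in>A. g (k, i) (l, j))"
    by (intro sum.cong refl sum.swap)
  finally show ?thesis .
qed

text \<open>The matrix coefficients of \<open>b\<^sup>* v a\<close> for scalar columns \<open>a\<close>, \<open>b\<close> are matrix coefficients of \<open>v\<close>, at the
  vectors with entries \<open>a l *\<^sub>C \<xi>\<close> and \<open>b k *\<^sub>C \<eta>\<close>.\<close>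

lemma (in hilbert_space) op_norm_compress_le:
  fixes m :: nat
  assumes v: "\<And>k l. k < m \<Longrightarrow> l < m \<Longrightarrow> v k l \<in> bounded_ops H"
  shows "op_norm H (\<Sum>k<m. \<Sum>l<m. (cnj (b k) * a l) *\<^sub>C v k l)
    \<le> op_mnorm H m v * L2_set (\<lambda>l. cmod (a l)) {..<m} * L2_set (\<lambda>k. cmod (b k)) {..<m}"
proof (rule op_norm_le_form)
  show "(\<Sum>k<m. \<Sum>l<m. (cnj (b k) * a l) *\<^sub>C v k l) \<in> bounded_ops H"
    by (intro complex_vector.subspace_sum complex_vector.subspace_scale csubspace_bounded_ops v) auto
  show "0 \<le> op_mnorm H m v * L2_set (\<lambda>l. cmod (a l)) {..<m} * L2_set (\<lambda>k. cmod (b k)) {..<m}"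
    using v by (intro mult_nonneg_nonneg mat_norm_nonneg L2_set_nonneg) auto
  fix \<xi> \<eta> assume \<xi>: "\<xi> \<in> hcarrier H" and \<eta>: "\<eta> \<in> hcarrier H"
  have in_H: "v k l \<zeta> \<in> hcarrier H" if "k < m" "l < m" "\<zeta> \<in> hcarrier H" for k l \<zeta>
    using bounded_opsD(2)[OF v[OF that(1,2)] that(3)] .
  have "hinner H ((\<Sum>k<m. \<Sum>l<m. (cnj (b k) * a l) *\<^sub>C v k l) \<xi>) \<eta>
    = hinner H (\<Sum>k<m. \<Sum>l<m. (cnj (b k) * a l) *\<^sub>C v k l \<xi>) \<eta>"
    by (simp add: sum_fun_apply scaleC_fun_def)
  also have "\<dots> = (\<Sum>k<m. hinner H (\<Sum>l<m. (cnj (b k) * a l) *\<^sub>C v k l \<xi>) \<eta>)"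
    using \<xi> \<eta> by (intro inner_sum_left sum_in scaleC_in in_H) auto
  also have "\<dots> = (\<Sum>k<m. \<Sum>l<m. hinner H ((cnj (b k) * a l) *\<^sub>C v k l \<xi>) \<eta>)"
    using \<xi> \<eta> by (intro sum.cong refl inner_sum_left scaleC_in in_H) auto
  also have "\<dots> = form {..<m} v (\<lambda>l. a l *\<^sub>C \<xi>) (\<lambda>k. b k *\<^sub>C \<eta>)"
    unfolding form_def
  proof (intro sum.cong refl)
    fix k l assume kl: "k \<in> {..<m}" "l \<in> {..<m}"
    have "v k l (a l *\<^sub>C \<xi>) = a l *\<^sub>C v k l \<xi>"
      using kl \<xi> by (intro clinear_on_scaleC[OF bounded_opsD(1)[OF v]]) auto
    then show "hinner H ((cnj (b k) * a l) *\<^sub>C v k l \<xi>) \<eta> = hinner H (v k l (a l *\<^sub>C \<xi>)) (b k *\<^sub>C \<eta>)"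
      using kl in_H \<xi> \<eta> by (simp add: inner_scaleC_left inner_scaleC_right)
  qed
  also have "cmod \<dots> \<le> op_mnorm H m v * L2_set (\<lambda>l. hnorm H (a l *\<^sub>C \<xi>)) {..<m}
      * L2_set (\<lambda>k. hnorm H (b k *\<^sub>C \<eta>)) {..<m}"
    using v \<xi> \<eta> by (intro form_le) auto
  also have "\<dots> = op_mnorm H m v * L2_set (\<lambda>l. cmod (a l)) {..<m} * L2_set (\<lambda>k. cmod (b k)) {..<m}
      * hnorm H \<xi> * hnorm H \<eta>"
    using \<xi> \<eta> by (simp add: L2_set_scale)
  finally show "cmod (hinner H ((\<Sum>k<m. \<Sum>l<m. (cnj (b k) * a l) *\<^sub>C v k l) \<xi>) \<eta>)
    \<le> op_mnorm H m v * L2_set (\<lambda>l. cmod (a l)) {..<m} * L2_set (\<lambda>k. cmod (b k)) {..<m}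
      * hnorm H \<xi> * hnorm H \<eta>" .
qed

text \<open>A matrix of bounded functionals is completely bounded: a matrix coefficient of the
  amplification of a functional \<open>f\<close> is the value of \<open>f\<close> at a compression of the matrix.\<close>

lemma (in hilbert_space) scalar_mat_norm_functionals_le:
  fixes m n :: nat
  assumes V: "V \<subseteq> bounded_ops H" "csubspace V"
    and f: "\<And>i j. i < n \<Longrightarrow> j < n \<Longrightarrow> clinear_on V (f i j)"
    and C: "\<And>i j. i < n \<Longrightarrow> j < n \<Longrightarrow> C i j \<ge> 0"
    and le: "\<And>i j v. i < n \<Longrightarrow> j < n \<Longrightarrow> v \<in> V \<Longrightarrow> cmod (f i j v) \<le> C i j * op_norm H v"
    and v: "v \<in> mats m V" "op_mnorm H m v \<le> 1"
  shows "scalar_mat_norm ({..<m} \<times> {..<n}) (\<lambda>(k, i) (l, j). f i j (v k l)) \<le> (\<Sum>i<n. \<Sum>j<n. C i j)"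
proof (rule scalar_mat_norm_le)
  show "0 \<le> (\<Sum>i<n. \<Sum>j<n. C i j)" using C by (intro sum_nonneg) auto
  fix \<xi> \<eta> :: "nat \<times> nat \<Rightarrow> complex"
  let ?I = "{..<m} \<times> {..<n}"
  define a b where "a = L2_set (\<lambda>q. cmod (\<xi> q)) ?I" and "b = L2_set (\<lambda>q. cmod (\<eta> q)) ?I"
  have vV: "v k l \<in> V" if "k < m" "l < m" for k l using v(1) that by (auto simp: mats_def)
  define W where "W i j = (\<Sum>k<m. \<Sum>l<m. (cnj (\<eta> (k, i)) * \<xi> (l, j)) *\<^sub>C v k l)" for i j
  have WV: "W i j \<in> V" for i j
    unfolding W_def using vV by (intro complex_vector.subspace_sum complex_vector.subspace_scale V) auto
  have slice: "L2_set (\<lambda>l. cmod (\<zeta> (l, j))) {..<m} \<le> L2_set (\<lambda>q. cmod (\<zeta> q)) ?I" if "j < n"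
    for \<zeta> :: "nat \<times> nat \<Rightarrow> complex" and j
  proof -
    have "(\<Sum>l<m. (cmod (\<zeta> (l, j)))\<^sup>2) = (\<Sum>q\<in>{..<m} \<times> {j}. (cmod (\<zeta> q))\<^sup>2)"
      by (simp add: sum.cartesian_product')
    also have "\<dots> \<le> (\<Sum>q\<in>?I. (cmod (\<zeta> q))\<^sup>2)"
      using that by (intro sum_mono2) auto
    finally show ?thesis by (simp add: L2_set_def)
  qed
  have W: "op_norm H (W i j) \<le> a * b" if "i < n" "j < n" for i j
  proof -
    have "op_norm H (W i j) \<le> op_mnorm H m v * L2_set (\<lambda>l. cmod (\<xi> (l, j))) {..<m}
        * L2_set (\<lambda>k. cmod (\<eta> (k, i))) {..<m}"
      unfolding W_def using vV V by (intro op_norm_compress_le) auto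
    also have "\<dots> \<le> 1 * a * b"
      using v(2) slice that unfolding a_def b_def
      by (intro mult_mono) (auto intro!: mult_nonneg_nonneg mult_mono)
    finally show ?thesis by simp
  qed
  have "(\<Sum>p\<in>?I. \<Sum>q\<in>?I. (case p of (k, i) \<Rightarrow> \<lambda>(l, j). f i j (v k l)) q * \<xi> q * cnj (\<eta> p))
    = (\<Sum>i<n. \<Sum>j<n. \<Sum>k<m. \<Sum>l<m. f i j (v k l) * \<xi> (l, j) * cnj (\<eta> (k, i)))"
    by (simp add: sum_pairs)
  also have "\<dots> = (\<Sum>i<n. \<Sum>j<n. f i j (W i j))"
  proof (intro sum.cong refl)
    fix i j assume "i \<in> {..<n}" "j \<in> {..<n}"
    then have fij: "clinear_on V (f i j)" using f by auto
    have in_V: "(\<Sum>l<m. (cnj (\<eta> (k, i)) * \<xi> (l, j)) *\<^sub>C v k l) \<in> V" if "k < m" for k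
      using vV that by (intro complex_vector.subspace_sum complex_vector.subspace_scale V) auto
    have "f i j (W i j) = (\<Sum>k<m. f i j (\<Sum>l<m. (cnj (\<eta> (k, i)) * \<xi> (l, j)) *\<^sub>C v k l))"
      unfolding W_def using in_V by (intro clinear_on_sum[OF fij V(2)]) auto
    also have "\<dots> = (\<Sum>k<m. \<Sum>l<m. f i j ((cnj (\<eta> (k, i)) * \<xi> (l, j)) *\<^sub>C v k l))"
      using vV by (intro sum.cong refl clinear_on_sum[OF fij V(2)] complex_vector.subspace_scale V) auto
    also have "\<dots> = (\<Sum>k<m. \<Sum>l<m. f i j (v k l) * \<xi> (l, j) * cnj (\<eta> (k, i)))"
      using vV by (intro sum.cong refl) (simp add: clinear_on_scaleC[OF fij] scaleC_complex_def)
    finally show "(\<Sum>k<m. \<Sum>l<m. f i j (v k l) * \<xi> (l, j) * cnj (\<eta> (k, i))) = f i j (W i j)" ..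
  qed
  also have "cmod \<dots> \<le> (\<Sum>i<n. \<Sum>j<n. C i j * (a * b))"
  proof (intro order_trans[OF norm_sum] sum_mono)
    fix i j assume ij: "i \<in> {..<n}" "j \<in> {..<n}"
    show "cmod (f i j (W i j)) \<le> C i j * (a * b)"
      using le[of i j "W i j"] mult_left_mono[OF W, of i j "C i j"] C[of i j] WV ij by force
  qed
  finally show "cmod (\<Sum>p\<in>?I. \<Sum>q\<in>?I. (case p of (k, i) \<Rightarrow> \<lambda>(l, j). f i j (v k l)) q * \<xi> q * cnj (\<eta> p))
      \<le> (\<Sum>i<n. \<Sum>j<n. C i j) * L2_set (\<lambda>q. cmod (\<xi> q)) ?I * L2_set (\<lambda>p. cmod (\<eta> p)) ?I"
    by (simp add: a_def b_def sum_distrib_right mult.assoc)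
qed simp

subsection \<open>Initial topologies\<close>

lemma topspace_initial_topology [simp]: "topspace (initial_topology S F) = S"
  by (auto simp: initial_topology_def topspace_pullback_topology)

lemma continuous_map_initial_topology:
  assumes "f \<in> F"
  shows "continuous_map (initial_topology S F) euclidean f"
proof -
  have "continuous_map (initial_topology S F) euclidean ((\<lambda>g. g f) \<circ> (\<lambda>x. \<lambda>f\<in>F. f x))"
    unfolding initial_topology_def
    by (intro continuous_map_pullback continuous_map_product_projection assms)
  then show ?thesis using assms by (simp add: o_def)
qed

lemma continuous_map_into_initial_topology:
  assumes "g \<in> topspace Z \<rightarrow> S" "\<And>f. f \<in> F \<Longrightarrow> continuous_map Z euclidean (\<lambda>z. f (g z))"
  shows "continuous_map Z (initial_topology S F) g"
  unfolding initial_topology_def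
proof (rule continuous_map_pullback')
  show "continuous_map Z (product_topology (\<lambda>_. euclidean) F) ((\<lambda>x. \<lambda>f\<in>F. f x) \<circ> g)"
    using assms(2) by (auto simp: continuous_map_componentwise)
qed (use assms(1) in auto)

lemma continuous_map_mult_left_complex:
  assumes "continuous_map Z euclidean (f :: _ \<Rightarrow> complex)"
  shows "continuous_map Z euclidean (\<lambda>z. c * f z)"
proof -
  have "continuous_map euclidean euclidean (\<lambda>z::complex. c * z)"
    by (simp add: continuous_intros)
  from continuous_map_compose[OF assms this] show ?thesis by (simp add: o_def)
qed

subsection \<open>Norms and the pairing\<close>

locale dual_unital_operator_space =
  H: hilbert_space H + K: hilbert_space K
  for H :: "'h::complex_vector hspace" and K :: "'k::complex_vector hspace" +
  fixes X :: "('h \<Rightarrow> 'h) set" and V :: "('k \<Rightarrow> 'k) set" and T :: "('h \<Rightarrow> 'h) \<Rightarrow> (('k \<Rightarrow> 'k) \<Rightarrow> complex)"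
  assumes unital: "unital_operator_space H X"
    and predual: "operator_space K V"
    and T_isometry: "complete_isometry X (op_mnorm H) (dual_space K V) (dual_mnorm K V) T"
    and T_onto: "T ` X = dual_space K V"
begin

lemma X_sub: "X \<subseteq> bounded_ops H" and X_csub: "csubspace X" and id_in: "id_op H \<in> X"
  using unital by (auto simp: unital_operator_space_def)

lemma X_bd: "x \<in> X \<Longrightarrow> x \<in> bounded_ops H" using X_sub by auto

lemma V_sub: "V \<subseteq> bounded_ops K" and V_csub: "csubspace V"
  and V_complete: "complete_wrt (op_norm K) V"
  using predual by (auto simp: operator_space_def)

lemma V_bd: "v \<in> V \<Longrightarrow> v \<in> bounded_ops K" using V_sub by auto

lemmas X_add = complex_vector.subspace_add[OF X_csub]
  and X_diff = complex_vector.subspace_diff[OF X_csub]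
  and X_scale = complex_vector.subspace_scale[OF X_csub]
  and X_zero = complex_vector.subspace_0[OF X_csub]
  and X_sum = complex_vector.subspace_sum[OF X_csub]
  and V_add = complex_vector.subspace_add[OF V_csub]
  and V_diff = complex_vector.subspace_diff[OF V_csub]
  and V_scale = complex_vector.subspace_scale[OF V_csub]
  and V_zero = complex_vector.subspace_0[OF V_csub]
  and V_sum = complex_vector.subspace_sum[OF V_csub]

lemma T_clinear: "clinear_on X T"
  using T_isometry by (simp add: complete_isometry_def)

lemma T_in: "x \<in> X \<Longrightarrow> T x \<in> dual_space K V"
  using T_onto by auto

lemma T_clinear_right: "x \<in> X \<Longrightarrow> clinear_on V (T x)"
  using T_in by (auto simp: dual_space_def)

lemma T_clinear_left: "clinear_on X (\<lambda>x. T x v)"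
  using T_clinear by (auto simp: clinear_on_def scaleC_fun_def scaleC_complex_def)

lemma T_add: "x \<in> X \<Longrightarrow> y \<in> X \<Longrightarrow> T (x + y) v = T x v + T y v"
  using clinear_on_add[OF T_clinear_left] by auto

lemma T_diff: "x \<in> X \<Longrightarrow> y \<in> X \<Longrightarrow> T (x - y) v = T x v - T y v"
  using clinear_on_diff[OF T_clinear_left X_csub] by auto

lemma T_scale: "x \<in> X \<Longrightarrow> T (c *\<^sub>C x) v = c * T x v"
  using clinear_on_scaleC[OF T_clinear_left] by (auto simp: scaleC_complex_def)

lemma T_zero: "T 0 v = 0"
  using clinear_on_zero[OF T_clinear_left X_csub] by auto

lemma T_sum: "(\<And>i. i \<in> I \<Longrightarrow> x i \<in> X) \<Longrightarrow> T (\<Sum>i\<in>I. x i) v = (\<Sum>i\<in>I. T (x i) v)"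
  using clinear_on_sum[OF T_clinear_left X_csub] by auto

lemma T_add_right: "x \<in> X \<Longrightarrow> v \<in> V \<Longrightarrow> w \<in> V \<Longrightarrow> T x (v + w) = T x v + T x w"
  using clinear_on_add[OF T_clinear_right] by auto

lemma T_diff_right: "x \<in> X \<Longrightarrow> v \<in> V \<Longrightarrow> w \<in> V \<Longrightarrow> T x (v - w) = T x v - T x w"
  using clinear_on_diff[OF T_clinear_right V_csub] by auto

lemma T_scale_right: "x \<in> X \<Longrightarrow> v \<in> V \<Longrightarrow> T x (c *\<^sub>C v) = c * T x v"
  using clinear_on_scaleC[OF T_clinear_right] by (auto simp: scaleC_complex_def)

lemma T_zero_right: "x \<in> X \<Longrightarrow> T x 0 = 0"
  using clinear_on_zero[OF T_clinear_right V_csub] by auto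

lemma T_sum_right: "x \<in> X \<Longrightarrow> (\<And>i. i \<in> I \<Longrightarrow> v i \<in> V) \<Longrightarrow> T x (\<Sum>i\<in>I. v i) = (\<Sum>i\<in>I. T x (v i))"
  using clinear_on_sum[OF T_clinear_right V_csub] by auto

lemma mnorm_eq: "x \<in> mats n X \<Longrightarrow> op_mnorm H n x = dual_mnorm K V n (\<lambda>i j. T (x i j))"
  using T_isometry by (auto simp: complete_isometry_def)

lemma mnorm_nonneg: "x \<in> mats n X \<Longrightarrow> op_mnorm H n x \<ge> 0"
  using X_sub by (intro H.mat_norm_nonneg) (auto simp: mats_def)

lemma norm_nonneg: "x \<in> X \<Longrightarrow> op_norm H x \<ge> 0" "v \<in> V \<Longrightarrow> op_norm K v \<ge> 0"
  using H.op_norm_nonneg K.op_norm_nonneg X_bd V_bd by auto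

lemma mnorm_le:
  assumes x: "x \<in> mats n X" 
    and "\<And>m v. v \<in> mats m V \<Longrightarrow> op_mnorm K m v \<le> 1 \<Longrightarrow>
      scalar_mat_norm ({..<m} \<times> {..<n}) (\<lambda>(k, i) (l, j). T (x i j) (v k l)) \<le> s"
  shows "op_mnorm H n x \<le> s"
proof -
  have "op_mnorm K 0 (\<lambda>_ _. 0) \<le> 1"
    by (rule K.mat_norm_le) auto
  moreover have "(\<lambda>_ _. 0) \<in> mats 0 V" by (simp add: mats_def)
  ultimately show ?thesis
    unfolding mnorm_eq[OF x] dual_mnorm_def using assms(2)
    by (intro cSup_least) blast+
qed

lemma mnorm_ge:
  assumes x: "x \<in> mats n X" and v: "v \<in> mats m V" "op_mnorm K m v \<le> 1"
  shows "scalar_mat_norm ({..<m} \<times> {..<n}) (\<lambda>(k, i) (l, j). T (x i j) (v k l)) \<le> op_mnorm H n x"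
proof -
  have xX: "x i j \<in> X" if "i < n" "j < n" for i j using x that by (auto simp: mats_def)
  have "\<exists>C\<ge>0. \<forall>v\<in>V. cmod (T (x i j) v) \<le> C * op_norm K v" if ij: "i < n" "j < n" for i j
  proof -
    obtain C where C: "\<And>v. v \<in> V \<Longrightarrow> cmod (T (x i j) v) \<le> C * op_norm K v"
      using T_in[OF xX[OF ij]] by (auto simp: dual_space_def)
    have "cmod (T (x i j) v) \<le> max C 0 * op_norm K v" if "v \<in> V" for v
      using C[OF that] mult_right_mono[of C "max C 0" "op_norm K v"] norm_nonneg(2)[OF that] by auto
    then show ?thesis by (intro exI[of _ "max C 0"]) auto
  qed
  then obtain C where C: "\<And>i j. i < n \<Longrightarrow> j < n \<Longrightarrow> C i j \<ge> 0"
    "\<And>i j v. i < n \<Longrightarrow> j < n \<Longrightarrow> v \<in> V \<Longrightarrow> cmod (T (x i j) v) \<le> C i j * op_norm K v"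
    by metis
  have bd: "scalar_mat_norm ({..<m} \<times> {..<n}) (\<lambda>(k, i) (l, j). T (x i j) (v k l)) \<le> (\<Sum>i<n. \<Sum>j<n. C i j)"
    if "v \<in> mats m V" "op_mnorm K m v \<le> 1" for m v
    by (intro K.scalar_mat_norm_functionals_le[OF V_sub V_csub T_clinear_right[OF xX] C] that)
  show ?thesis
    unfolding mnorm_eq[OF x] dual_mnorm_def
  proof (rule cSup_upper)
    show "bdd_above {scalar_mat_norm ({..<m} \<times> {..<n}) (\<lambda>(k, i) (l, j). T (x i j) (v k l)) |m v.
      v \<in> mats m V \<and> op_mnorm K m v \<le> 1}"
      using bd by (intro bdd_aboveI) blast
  qed (use v in blast)
qed

lemma pairing_le:
  assumes x: "x \<in> X" and v: "v \<in> V"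
  shows "cmod (T x v) \<le> op_norm H x * op_norm K v"
proof (cases "op_norm K v = 0")
  case True
  then have "v = 0" using K.op_norm_eq_0 V_bd v by blast
  then show ?thesis using T_zero_right[OF x] by simp
next
  case False
  define r where "r = op_norm K v"
  have r: "r > 0" using False norm_nonneg(2)[OF v] by (simp add: r_def)
  define w where "w = complex_of_real (1 / r) *\<^sub>C v"
  have w: "w \<in> V" using v by (simp add: w_def V_scale)
  have "op_norm K w = 1"
    using K.op_norm_scaleC[OF V_bd[OF v], of "complex_of_real (1 / r)"] r
    by (simp add: w_def r_def norm_divide)
  then have "scalar_mat_norm ({..<1::nat} \<times> {..<1::nat}) (\<lambda>(k, i) (l, j). T x w) \<le> op_norm H x"
    using mnorm_ge[of "\<lambda>_ _. x" 1 "\<lambda>_ _. w" 1] x w by (simp add: mats_def op_norm_def)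
  then have "cmod (T x w) \<le> op_norm H x"
    using scalar_form_le[of "{..<1::nat} \<times> {..<1::nat}" "\<lambda>(k, i) (l, j). T x w" "\<lambda>_. 1" "\<lambda>_. 1"]
    by (simp add: H.lessThan_1 L2_set_def)
  moreover have "cmod (T x w) = cmod (T x v) / r"
    using r T_scale_right[OF x v] by (simp add: w_def norm_mult norm_divide)
  ultimately show ?thesis using r by (simp add: r_def[symmetric] pos_divide_le_eq)
qed

text \<open>The completely bounded norm of a functional is its norm.  Hence \<open>X\<close> carries the norm of the dual
  Banach space of \<open>V\<close>.\<close>

lemma norm_le:
  assumes x: "x \<in> X" and C: "C \<ge> 0" "\<And>v. v \<in> V \<Longrightarrow> cmod (T x v) \<le> C * op_norm K v"
  shows "op_norm H x \<le> C"
proof -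
  have "op_mnorm H 1 (\<lambda>_ _. x) \<le> C"
  proof (rule mnorm_le)
    fix m v assume v: "v \<in> mats m V" "op_mnorm K m v \<le> 1"
    show "scalar_mat_norm ({..<m} \<times> {..<1::nat}) (\<lambda>(k, i) (l, j). T x (v k l)) \<le> C"
      using K.scalar_mat_norm_functionals_le[of V 1 "\<lambda>_ _. T x" "\<lambda>_ _. C" v m]
        T_clinear_right[OF x] V_sub V_csub C v by simp
  qed (use x in \<open>simp add: mats_def\<close>)
  then show ?thesis by (simp add: op_norm_def)
qed

lemma functional_representation:
  assumes g: "clinear_on V g" and C: "C \<ge> 0" "\<And>v. v \<in> V \<Longrightarrow> cmod (g v) \<le> C * op_norm K v"
  shows "\<exists>x\<in>X. op_norm H x \<le> C \<and> (\<forall>v\<in>V. T x v = g v)"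
proof -
  define g' where "g' v = (if v \<in> V then g v else 0)" for v
  have "g' \<in> T ` X"
    unfolding T_onto g'_def using g C(2) V_add V_scale by (auto simp: dual_space_def clinear_on_def)
  then obtain x where x: "g' = T x" "x \<in> X"
    by (rule imageE)
  have Tx: "T x v = g v" if "v \<in> V" for v
    using that by (simp add: x(1)[symmetric] g'_def)
  have "op_norm H x \<le> C"
    using C(2) Tx by (intro norm_le[OF x(2) C(1)]) simp
  then show ?thesis
    using x(2) Tx by (intro bexI[of _ x]) auto
qed

text \<open>The vector functionals \<open>w \<mapsto> \<langle>w \<xi>, \<eta>\<rangle>\<close> on the concrete operator space \<open>V\<close> come from elements of \<open>X\<close>,
  and they determine the norm.\<close>

lemma predual_norm_le:
  assumes v: "v \<in> V" and c: "c \<ge> 0" "\<And>x. x \<in> X \<Longrightarrow> cmod (T x v) \<le> c * op_norm H x"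
  shows "op_norm K v \<le> c"
proof (rule K.op_norm_le_form[OF V_bd[OF v] c(1)])
  fix \<xi> \<eta> assume \<xi>: "\<xi> \<in> hcarrier K" and \<eta>: "\<eta> \<in> hcarrier K"
  have "clinear_on V (\<lambda>w. hinner K (w \<xi>) \<eta>)"
    using K.bounded_opsD(2)[OF V_bd \<xi>] \<eta>
    by (auto simp: clinear_on_def K.inner_add_left K.inner_scaleC_left scaleC_fun_def scaleC_complex_def)
  moreover have "cmod (hinner K (w \<xi>) \<eta>) \<le> hnorm K \<xi> * hnorm K \<eta> * op_norm K w" if "w \<in> V" for w
    using K.op_norm_form[OF V_bd[OF that] \<xi> \<eta>] by (simp add: mult_ac)
  ultimately obtain x where x: "x \<in> X" "op_norm H x \<le> hnorm K \<xi> * hnorm K \<eta>" "T x v = hinner K (v \<xi>) \<eta>"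
    using functional_representation[of "\<lambda>w. hinner K (w \<xi>) \<eta>" "hnorm K \<xi> * hnorm K \<eta>"] \<xi> \<eta> v
    by auto
  then show "cmod (hinner K (v \<xi>) \<eta>) \<le> c * hnorm K \<xi> * hnorm K \<eta>"
    using c(2)[OF x(1)] mult_left_mono[OF x(2) c(1)] by (simp add: mult.assoc)
qed

subsection \<open>The weak* topology of \<open>X\<close>\<close>

definition weakstar :: "('h \<Rightarrow> 'h) topology" where
  "weakstar = pullback_topology X T (dual_weakstar K V)"

lemma topspace_weakstar [simp]: "topspace weakstar = X"
  using T_in by (auto simp: weakstar_def topspace_pullback_topology dual_weakstar_def)

lemma continuous_map_eval:
  assumes "v \<in> V"
  shows "continuous_map weakstar euclidean (\<lambda>x. T x v)"
proof -
  have "continuous_map weakstar euclidean ((\<lambda>f. f v) \<circ> T)"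
    unfolding weakstar_def dual_weakstar_def using assms
    by (intro continuous_map_pullback continuous_map_initial_topology) auto
  then show ?thesis by (simp add: o_def)
qed

lemma continuous_map_into_weakstar:
  assumes "g \<in> topspace Z \<rightarrow> X" "\<And>v. v \<in> V \<Longrightarrow> continuous_map Z euclidean (\<lambda>z. T (g z) v)"
  shows "continuous_map Z weakstar g"
  unfolding weakstar_def
proof (rule continuous_map_pullback')
  show "continuous_map Z (dual_weakstar K V) (T \<circ> g)"
    unfolding dual_weakstar_def using assms T_in
    by (intro continuous_map_into_initial_topology) (auto intro!: T_in simp: Pi_iff)
qed (use assms(1) in auto)

definition unit_ball :: "('h \<Rightarrow> 'h) set" where
  "unit_ball = {x \<in> X. op_norm H x \<le> 1}"

text \<open>The Banach--Alaoglu theorem: the elements of norm at most 1 of \<open>X\<close> correspond to the linear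
  elements \<open>g\<close> of a product of discs, which is compact by Tychonoff's theorem, and linearity is a closed
  condition on \<open>g\<close>.\<close>

lemma compactin_unit_ball: "compactin weakstar unit_ball"
proof -
  define P where "P = product_topology (\<lambda>_::'k \<Rightarrow> 'k. euclidean :: complex topology) V"
  define D where "D = PiE V (\<lambda>v. cball (0::complex) (op_norm K v))"
  define G where "G = {g \<in> D. \<forall>v\<in>V. \<forall>w\<in>V. \<forall>c. g (v + w) - g v - g w = 0 \<and> g (c *\<^sub>C v) - c * g v = 0}"
  have top: "topspace P = PiE V (\<lambda>_. UNIV)" by (simp add: P_def)
  have proj: "continuous_map P euclidean (\<lambda>g. g v)" if "v \<in> V" for v
    unfolding P_def using that by (rule continuous_map_product_projection)
  have D: "compactin P D"
    unfolding P_def D_def by (auto simp: compactin_PiE)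
  have closed: "closedin P {g \<in> topspace P. f g \<in> {0::complex}}" if "continuous_map P euclidean f" for f
    using that by (rule closedin_continuous_map_preimage) simp
  have cl: "closedin P {g \<in> topspace P. g (v + w) - g v - g w = 0 \<and> g (c *\<^sub>C v) - c * g v = 0}"
    if "v \<in> V" "w \<in> V" for v w c
  proof -
    have "closedin P {g \<in> topspace P. g (v + w) - g v - g w \<in> {0}}"
      using that V_add by (intro closed continuous_intros proj) auto
    moreover have "closedin P {g \<in> topspace P. g (c *\<^sub>C v) - c * g v \<in> {0}}"
      using that V_scale by (intro closed continuous_intros continuous_map_mult_left_complex proj) auto
    ultimately have "closedin P ({g \<in> topspace P. g (v + w) - g v - g w \<in> {0}} \<inter>
      {g \<in> topspace P. g (c *\<^sub>C v) - c * g v \<in> {0}})" by (rule closedin_Int)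
    moreover have "{g \<in> topspace P. g (v + w) - g v - g w \<in> {0}} \<inter>
      {g \<in> topspace P. g (c *\<^sub>C v) - c * g v \<in> {0}} =
      {g \<in> topspace P. g (v + w) - g v - g w = 0 \<and> g (c *\<^sub>C v) - c * g v = 0}" by auto
    ultimately show ?thesis by simp
  qed
  have DP: "D \<subseteq> topspace P" by (auto simp: D_def top)
  define L where "L = (\<Inter>(v, w, c) \<in> V \<times> V \<times> UNIV.
      {g \<in> topspace P. g (v + w) - g v - g w = 0 \<and> g (c *\<^sub>C v) - c * g v = 0})"
  have "closedin P L"
    unfolding L_def using V_zero cl by (intro closedin_Inter) auto
  moreover have "G = D \<inter> L"
    using V_zero DP by (auto simp: G_def L_def)
  ultimately have G: "compactin P G"
    using compact_Int_closedin[OF D] by simp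
  define \<phi> where "\<phi> g = (SOME x. x \<in> X \<and> (\<forall>v\<in>V. T x v = g v) \<and> op_norm H x \<le> 1)" for g
  have \<phi>: "\<phi> g \<in> X \<and> (\<forall>v\<in>V. T (\<phi> g) v = g v) \<and> op_norm H (\<phi> g) \<le> 1" if "g \<in> G" for g
    unfolding \<phi>_def
  proof (rule someI_ex[of "\<lambda>x. x \<in> X \<and> (\<forall>v\<in>V. T x v = g v) \<and> op_norm H x \<le> 1"])
    have "clinear_on V g" using that by (auto simp: G_def clinear_on_def scaleC_complex_def algebra_simps)
    moreover have "cmod (g v) \<le> 1 * op_norm K v" if "v \<in> V" for v
      using \<open>g \<in> G\<close> that by (auto simp: G_def D_def)
    ultimately show "\<exists>x. x \<in> X \<and> (\<forall>v\<in>V. T x v = g v) \<and> op_norm H x \<le> 1"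
      using functional_representation[of g 1] by auto
  qed
  have GP: "G \<subseteq> topspace P" using DP by (auto simp: G_def)
  have "continuous_map (subtopology P G) weakstar \<phi>"
  proof (rule continuous_map_into_weakstar)
    show "\<phi> \<in> topspace (subtopology P G) \<rightarrow> X" using \<phi> by auto
    fix v assume v: "v \<in> V"
    show "continuous_map (subtopology P G) euclidean (\<lambda>z. T (\<phi> z) v)"
      by (rule continuous_map_eq[OF continuous_map_from_subtopology[OF proj[OF v]]]) (use \<phi> v in auto)
  qed
  then have "compactin weakstar (\<phi> ` G)"
    using image_compactin[of "subtopology P G" G] G by (auto simp: compactin_subtopology)
  moreover have "\<phi> ` G = unit_ball"
  proof
    show "\<phi> ` G \<subseteq> unit_ball" using \<phi> by (auto simp: unit_ball_def)
    show "unit_ball \<subseteq> \<phi> ` G"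
    proof
      fix x assume x: "x \<in> unit_ball"
      then have xX: "x \<in> X" by (simp add: unit_ball_def)
      define g where "g = restrict (T x) V"
      have "cmod (T x v) \<le> op_norm K v" if "v \<in> V" for v
        using pairing_le[OF xX that] x mult_right_mono[of "op_norm H x" 1 "op_norm K v"] norm_nonneg(2)[OF that]
        by (simp add: unit_ball_def)
      then have g: "g \<in> G"
        using xX V_add V_scale by (auto simp: G_def D_def g_def T_add_right T_scale_right)
      have "op_norm H (\<phi> g - x) \<le> 0"
        using \<phi>[OF g] xX by (intro norm_le X_diff) (auto simp: T_diff g_def)
      then have "\<phi> g - x = 0"
        using \<phi>[OF g] norm_nonneg(1)[OF X_diff, of "\<phi> g" x] xX
        by (intro H.op_norm_eq_0[OF X_bd[OF X_diff]]) auto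
      then show "x \<in> \<phi> ` G" using g by force
    qed
  qed
  ultimately show ?thesis by simp
qed

end

section \<open>Accretive matrices\<close>

lemma sum_lessThan_add: "(\<Sum>i<n + m. f i) = (\<Sum>i<n. f i) + (\<Sum>i<m. f (n + i))"
  for f :: "nat \<Rightarrow> 'a::comm_monoid_add"
  by (induction m) (simp_all add: add.assoc)

context hilbert_space
begin

text \<open>Accretivity replaces positivity of the real part, which is not available inside a space of
  operators that is not selfadjoint.\<close>

definition accretive :: "nat \<Rightarrow> (nat \<Rightarrow> nat \<Rightarrow> 'h \<Rightarrow> 'h) \<Rightarrow> bool" where
  "accretive n c \<longleftrightarrow> (\<forall>\<xi>. (\<forall>i<n. \<xi> i \<in> hcarrier H) \<longrightarrow> 0 \<le> Re (form {..<n} c \<xi> \<xi>))"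

lemma matsD: "x \<in> mats n S \<Longrightarrow> i < n \<Longrightarrow> j < n \<Longrightarrow> x i j \<in> S"
  by (simp add: mats_def)

lemma form_cong:
  "(\<And>i j. i \<in> I \<Longrightarrow> j \<in> I \<Longrightarrow> x i j = y i j) \<Longrightarrow> form I x \<xi> \<eta> = form I y \<xi> \<eta>"
  by (simp add: form_def)

lemma accretive_cong:
  "(\<And>i j. i < n \<Longrightarrow> j < n \<Longrightarrow> x i j = y i j) \<Longrightarrow> accretive n x \<longleftrightarrow> accretive n y"
  using form_cong[of "{..<n}" x y] by (simp add: accretive_def)

lemma form_add:
  assumes "c \<in> mats n (bounded_ops H)" "d \<in> mats n (bounded_ops H)"
    and "\<And>i. i < n \<Longrightarrow> \<xi> i \<in> hcarrier H" "\<And>i. i < n \<Longrightarrow> \<eta> i \<in> hcarrier H"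
  shows "form {..<n} (\<lambda>i j. c i j + d i j) \<xi> \<eta> = form {..<n} c \<xi> \<eta> + form {..<n} d \<xi> \<eta>"
  using assms bounded_opsD(2)[OF matsD] by (simp add: form_def inner_add_left sum.distrib)

lemma form_scaleC:
  assumes "c \<in> mats n (bounded_ops H)"
    and "\<And>i. i < n \<Longrightarrow> \<xi> i \<in> hcarrier H" "\<And>i. i < n \<Longrightarrow> \<eta> i \<in> hcarrier H"
  shows "form {..<n} (\<lambda>i j. a *\<^sub>C c i j) \<xi> \<eta> = a * form {..<n} c \<xi> \<eta>"
  using assms bounded_opsD(2)[OF matsD]
  by (simp add: form_def inner_scaleC_left scaleC_fun_def sum_distrib_left)

lemma accretive_add:
  "\<lbrakk>c \<in> mats n (bounded_ops H); d \<in> mats n (bounded_ops H); accretive n c; accretive n d\<rbrakk>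
    \<Longrightarrow> accretive n (\<lambda>i j. c i j + d i j)"
  by (simp add: accretive_def form_add)

lemma accretive_scaleC:
  "\<lbrakk>c \<in> mats n (bounded_ops H); accretive n c; t \<ge> 0\<rbrakk>
    \<Longrightarrow> accretive n (\<lambda>i j. complex_of_real t *\<^sub>C c i j)"
  by (simp add: accretive_def form_scaleC)


text \<open>This is the block matrix with diagonal blocks \<open>s\<close>, upper right block \<open>-2 x\<close> and lower left block \<open>0\<close>.\<close>

definition block :: "nat \<Rightarrow> real \<Rightarrow> (nat \<Rightarrow> nat \<Rightarrow> 'h \<Rightarrow> 'h) \<Rightarrow> nat \<Rightarrow> nat \<Rightarrow> 'h \<Rightarrow> 'h" where
  "block n s x i j =
     (if i = j then of_real s *\<^sub>C id_op H
      else if i < n \<and> n \<le> j then (-2) *\<^sub>C x i (j - n) else 0)"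

lemma form_block:
  assumes x: "x \<in> mats n (bounded_ops H)"
    and \<zeta>: "\<And>i. i < n + n \<Longrightarrow> \<zeta> i \<in> hcarrier H"
  shows "form {..<n + n} (block n s x) \<zeta> \<zeta> =
    of_real s * ((\<Sum>i<n. of_real ((hnorm H (\<zeta> i))\<^sup>2)) + (\<Sum>i<n. of_real ((hnorm H (\<zeta> (n + i)))\<^sup>2)))
    - 2 * form {..<n} x (\<lambda>j. \<zeta> (n + j)) \<zeta>"
proof -
  have in_H: "x i j (\<zeta> k) \<in> hcarrier H" if "i < n" "j < n" "k < n + n" for i j k
    using bounded_opsD(2)[OF matsD[OF x]] \<zeta> that by auto
  have sq: "hinner H (\<zeta> i) (\<zeta> i) = of_real ((hnorm H (\<zeta> i))\<^sup>2)" if "i < n + n" for i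
    using inner_self[OF \<zeta>[OF that]] .
  have 1: "(\<Sum>j<n. hinner H (block n s x i j (\<zeta> j)) (\<zeta> i)) = of_real s * of_real ((hnorm H (\<zeta> i))\<^sup>2)"
    if i: "i < n" for i
  proof -
    have "(\<Sum>j<n. hinner H (block n s x i j (\<zeta> j)) (\<zeta> i))
      = (\<Sum>j<n. if j = i then of_real s * of_real ((hnorm H (\<zeta> i))\<^sup>2) else 0)"
      using i \<zeta> by (intro sum.cong refl)
        (auto simp: block_def scaleC_fun_def inner_scaleC_left sq)
    then show ?thesis using i by simp
  qed
  have 2: "(\<Sum>j<n. hinner H (block n s x i (n + j) (\<zeta> (n + j))) (\<zeta> i))
      = - 2 * (\<Sum>j<n. hinner H (x i j (\<zeta> (n + j))) (\<zeta> i))" if i: "i < n" for i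
    unfolding sum_distrib_left using i \<zeta> in_H
    by (intro sum.cong refl) (auto simp: block_def scaleC_fun_def inner_scaleC_left
      simp del: complex_vector.scale_minus_left)
  have 3: "(\<Sum>j<n. hinner H (block n s x (n + i) j (\<zeta> j)) (\<zeta> (n + i))) = 0" if i: "i < n" for i
    using i \<zeta> by (intro sum.neutral) (auto simp: block_def)
  have 4: "(\<Sum>j<n. hinner H (block n s x (n + i) (n + j) (\<zeta> (n + j))) (\<zeta> (n + i)))
    = of_real s * of_real ((hnorm H (\<zeta> (n + i)))\<^sup>2)" if i: "i < n" for i
  proof -
    have "(\<Sum>j<n. hinner H (block n s x (n + i) (n + j) (\<zeta> (n + j))) (\<zeta> (n + i)))
      = (\<Sum>j<n. if j = i then of_real s * of_real ((hnorm H (\<zeta> (n + i)))\<^sup>2) else 0)"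
      using i \<zeta> by (intro sum.cong refl)
        (auto simp: block_def scaleC_fun_def inner_scaleC_left sq)
    then show ?thesis using i by simp
  qed
  show ?thesis
    unfolding form_def[of "{..<n + n}"] sum_lessThan_add using 1 2 3 4
    by (simp add: sum.distrib sum_subtractf sum_distrib_left sum_negf form_def algebra_simps)
qed

lemma block_in:
  "\<lbrakk>x \<in> mats n S; csubspace S; id_op H \<in> S\<rbrakk> \<Longrightarrow> block n s x \<in> mats (n + n) S"
  using complex_vector.subspace_0[of S] complex_vector.subspace_scale[of S]
  by (auto simp: mats_def block_def simp del: complex_vector.scale_minus_left)

text \<open>At the vector \<open>(\<eta>, \<xi>)\<close>, the real part of the form of the block matrix is
  \<open>s (\<parallel>\<eta>\<parallel>\<^sup>2 + \<parallel>\<xi>\<parallel>\<^sup>2) - 2 Re \<langle>x \<xi>, \<eta>\<rangle>\<close>, which is nonnegative for all \<open>\<xi>\<close> and \<open>\<eta>\<close> exactly if \<open>\<parallel>x\<parallel> \<le> s\<close>.\<close>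

lemma norm_le_iff_accretive_block:
  assumes x: "x \<in> mats n (bounded_ops H)" and s: "s > 0"
  shows "op_mnorm H n x \<le> s \<longleftrightarrow> accretive (n + n) (block n s x)"
proof -
  have iff: "op_mnorm H n x \<le> s \<longleftrightarrow>
    (\<forall>\<xi> \<eta>. (\<forall>j\<in>{..<n}. \<xi> j \<in> hcarrier H) \<longrightarrow> (\<forall>j\<in>{..<n}. \<eta> j \<in> hcarrier H) \<longrightarrow>
      2 * Re (form {..<n} x \<xi> \<eta>) \<le> s * ((\<Sum>j<n. (hnorm H (\<xi> j))\<^sup>2) + (\<Sum>j<n. (hnorm H (\<eta> j))\<^sup>2)))"
    using x s by (intro mat_norm_le_quadratic_iff) (auto simp: mats_def)
  show ?thesis
  proof
    assume "op_mnorm H n x \<le> s"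
    then have le: "2 * Re (form {..<n} x \<xi> \<eta>)
        \<le> s * ((\<Sum>j<n. (hnorm H (\<xi> j))\<^sup>2) + (\<Sum>j<n. (hnorm H (\<eta> j))\<^sup>2))"
      if "\<forall>j<n. \<xi> j \<in> hcarrier H" "\<forall>j<n. \<eta> j \<in> hcarrier H" for \<xi> \<eta>
      using that unfolding iff by auto
    show "accretive (n + n) (block n s x)"
      unfolding accretive_def
    proof (intro allI impI)
      fix \<zeta> assume \<zeta>: "\<forall>i<n + n. \<zeta> i \<in> hcarrier H"
      have eq: "form {..<n + n} (block n s x) \<zeta> \<zeta> =
          of_real (s * ((\<Sum>i<n. (hnorm H (\<zeta> i))\<^sup>2) + (\<Sum>i<n. (hnorm H (\<zeta> (n + i)))\<^sup>2)))
          - 2 * form {..<n} x (\<lambda>j. \<zeta> (n + j)) \<zeta>"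
        using form_block[OF x, of \<zeta> s] \<zeta> by simp
      show "0 \<le> Re (form {..<n + n} (block n s x) \<zeta> \<zeta>)"
        unfolding eq using le[of "\<lambda>j. \<zeta> (n + j)" \<zeta>] \<zeta> by (simp add: algebra_simps)
    qed
  next
    assume acc: "accretive (n + n) (block n s x)"
    show "op_mnorm H n x \<le> s"
      unfolding iff
    proof (intro allI impI)
      fix \<xi> \<eta> assume \<xi>: "\<forall>j\<in>{..<n}. \<xi> j \<in> hcarrier H" and \<eta>: "\<forall>j\<in>{..<n}. \<eta> j \<in> hcarrier H"
      define \<zeta> where "\<zeta> i = (if i < n then \<eta> i else \<xi> (i - n))" for i
      have \<zeta>: "\<forall>i<n + n. \<zeta> i \<in> hcarrier H" using \<xi> \<eta> by (auto simp: \<zeta>_def)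
      have "form {..<n} x (\<lambda>j. \<zeta> (n + j)) \<zeta> = form {..<n} x \<xi> \<eta>"
        by (simp add: form_def \<zeta>_def)
      then have eq: "form {..<n + n} (block n s x) \<zeta> \<zeta> =
          of_real (s * ((\<Sum>i<n. (hnorm H (\<eta> i))\<^sup>2) + (\<Sum>i<n. (hnorm H (\<xi> i))\<^sup>2)))
          - 2 * form {..<n} x \<xi> \<eta>"
        using form_block[OF x, of \<zeta> s] \<zeta> by (simp add: \<zeta>_def)
      have "0 \<le> Re (form {..<n + n} (block n s x) \<zeta> \<zeta>)"
        using acc \<zeta> by (simp add: accretive_def)
      then show "2 * Re (form {..<n} x \<xi> \<eta>)
        \<le> s * ((\<Sum>j<n. (hnorm H (\<xi> j))\<^sup>2) + (\<Sum>j<n. (hnorm H (\<eta> j))\<^sup>2))"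
        unfolding eq by (simp add: algebra_simps)
    qed
  qed
qed

definition one_minus :: "real \<Rightarrow> (nat \<Rightarrow> nat \<Rightarrow> 'h \<Rightarrow> 'h) \<Rightarrow> nat \<Rightarrow> nat \<Rightarrow> 'h \<Rightarrow> 'h" where
  "one_minus t c i j = (if i = j then id_op H else 0) - of_real t *\<^sub>C c i j"

lemma one_minus_in:
  "\<lbrakk>c \<in> mats n S; csubspace S; id_op H \<in> S\<rbrakk> \<Longrightarrow> one_minus t c \<in> mats n S"
  using complex_vector.subspace_0[of S] complex_vector.subspace_scale[of S]
    complex_vector.subspace_diff[of S]
  by (auto simp: mats_def one_minus_def)

lemma norm_one_minus_apply:
  assumes c: "c \<in> mats n (bounded_ops H)" and \<xi>: "\<And>i. i < n \<Longrightarrow> \<xi> i \<in> hcarrier H"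
  shows "(\<Sum>i<n. (hnorm H (\<Sum>j<n. one_minus t c i j (\<xi> j)))\<^sup>2) =
    (\<Sum>i<n. (hnorm H (\<xi> i))\<^sup>2) - 2 * t * Re (form {..<n} c \<xi> \<xi>)
      + t\<^sup>2 * (\<Sum>i<n. (hnorm H (\<Sum>j<n. c i j (\<xi> j)))\<^sup>2)"
proof -
  define y where "y i = (\<Sum>j<n. c i j (\<xi> j))" for i
  have in_H: "c i j (\<xi> j) \<in> hcarrier H" if "i < n" "j < n" for i j
    using bounded_opsD(2)[OF matsD[OF c that] \<xi>[OF that(2)]] .
  have y: "y i \<in> hcarrier H" if "i < n" for i
    unfolding y_def using that by (intro sum_in in_H) auto
  have "(hnorm H (\<Sum>j<n. one_minus t c i j (\<xi> j)))\<^sup>2 =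
      (hnorm H (\<xi> i))\<^sup>2 - 2 * t * Re (hinner H (y i) (\<xi> i)) + t\<^sup>2 * (hnorm H (y i))\<^sup>2"
    if i: "i < n" for i
  proof -
    have "(\<Sum>j<n. one_minus t c i j (\<xi> j)) =
        (\<Sum>j<n. (if j = i then \<xi> i else 0) - of_real t *\<^sub>C c i j (\<xi> j))"
      using \<xi> by (intro sum.cong refl) (auto simp: one_minus_def scaleC_fun_def)
    also have "\<dots> = \<xi> i + (- of_real t) *\<^sub>C y i"
      using i by (simp add: sum_subtractf sum_negf y_def complex_vector.scale_sum_right)
    finally have eq: "(\<Sum>j<n. one_minus t c i j (\<xi> j)) = \<xi> i + (- of_real t) *\<^sub>C y i" .
    have "Re (hinner H (\<xi> i) (y i)) = Re (hinner H (y i) (\<xi> i))"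
      using inner_commute[OF \<xi>[OF i] y[OF i]] by simp
    then have inn: "Re (hinner H (\<xi> i) ((- of_real t) *\<^sub>C y i)) = - t * Re (hinner H (y i) (\<xi> i))"
      using \<xi>[OF i] y[OF i] by (subst inner_scaleC_right) auto
    have nrm: "(hnorm H ((- of_real t) *\<^sub>C y i))\<^sup>2 = t\<^sup>2 * (hnorm H (y i))\<^sup>2"
      using y[OF i] by (subst hnorm_scaleC) (auto simp: power_mult_distrib)
    show ?thesis
      unfolding eq hnorm_add_sq[OF \<xi>[OF i] scaleC_in[OF y[OF i]]] inn nrm by simp
  qed
  moreover have "form {..<n} c \<xi> \<xi> = (\<Sum>i<n. hinner H (y i) (\<xi> i))"
    unfolding y_def using c \<xi> by (intro form_alt) (auto simp: mats_def)
  ultimately show ?thesis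
    by (simp add: sum.distrib sum_subtractf sum_distrib_left y_def)
qed

text \<open>Since \<open>\<parallel>\<xi> - t c \<xi>\<parallel>\<^sup>2 = \<parallel>\<xi>\<parallel>\<^sup>2 - 2 t Re \<langle>c \<xi>, \<xi>\<rangle> + t\<^sup>2 \<parallel>c \<xi>\<parallel>\<^sup>2\<close>, the sign of the middle term can be read
  off the norms as \<open>t\<close> tends to \<open>0\<close>.  The point of this characterization is that norm balls are weak*
  closed, whereas \<open>Re \<langle>c \<xi>, \<xi>\<rangle>\<close> is in general not weak* continuous in \<open>c\<close>.\<close>

lemma accretive_iff_norm:
  assumes c: "c \<in> mats n (bounded_ops H)" and R: "op_mnorm H n c \<le> R"
  shows "accretive n c \<longleftrightarrow> (\<forall>t>0. op_mnorm H n (one_minus t c) \<le> sqrt (1 + t\<^sup>2 * R\<^sup>2))"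
proof
  assume acc: "accretive n c"
  show "\<forall>t>0. op_mnorm H n (one_minus t c) \<le> sqrt (1 + t\<^sup>2 * R\<^sup>2)"
  proof (intro allI impI mat_norm_le)
    fix t :: real and \<xi> assume t: "t > 0" and \<xi>': "\<And>j. j \<in> {..<n} \<Longrightarrow> \<xi> j \<in> hcarrier H"
    then have \<xi>: "\<And>j. j < n \<Longrightarrow> \<xi> j \<in> hcarrier H" by auto
    have "L2_set (\<lambda>i. hnorm H (\<Sum>j<n. c i j (\<xi> j))) {..<n} \<le> op_mnorm H n c * L2_set (\<lambda>j. hnorm H (\<xi> j)) {..<n}"
      using c \<xi> by (intro mat_norm_apply) (auto simp: mats_def)
    also have "\<dots> \<le> R * L2_set (\<lambda>j. hnorm H (\<xi> j)) {..<n}"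
      using R by (intro mult_right_mono) auto
    finally have "(L2_set (\<lambda>i. hnorm H (\<Sum>j<n. c i j (\<xi> j))) {..<n})\<^sup>2 \<le> (R * L2_set (\<lambda>j. hnorm H (\<xi> j)) {..<n})\<^sup>2"
      by (intro power_mono) auto
    then have "(\<Sum>i<n. (hnorm H (\<Sum>j<n. c i j (\<xi> j)))\<^sup>2) \<le> R\<^sup>2 * (\<Sum>i<n. (hnorm H (\<xi> i))\<^sup>2)"
      by (simp add: L2_set_def sum_nonneg power_mult_distrib)
    then have "t\<^sup>2 * (\<Sum>i<n. (hnorm H (\<Sum>j<n. c i j (\<xi> j)))\<^sup>2) \<le> t\<^sup>2 * (R\<^sup>2 * (\<Sum>i<n. (hnorm H (\<xi> i))\<^sup>2))"
      by (intro mult_left_mono) auto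
    moreover have "0 \<le> 2 * t * Re (form {..<n} c \<xi> \<xi>)"
      using acc \<xi> t by (simp add: accretive_def)
    ultimately have "(\<Sum>i<n. (hnorm H (\<Sum>j<n. one_minus t c i j (\<xi> j)))\<^sup>2)
        \<le> (1 + t\<^sup>2 * R\<^sup>2) * (\<Sum>i<n. (hnorm H (\<xi> i))\<^sup>2)"
      using norm_one_minus_apply[where t = t and \<xi> = \<xi>, OF c \<xi>] by (simp add: algebra_simps)
    then show "L2_set (\<lambda>i. hnorm H (\<Sum>j<n. one_minus t c i j (\<xi> j))) {..<n}
        \<le> sqrt (1 + t\<^sup>2 * R\<^sup>2) * L2_set (\<lambda>j. hnorm H (\<xi> j)) {..<n}"
      unfolding L2_set_def real_sqrt_mult[symmetric] by simp
  qed auto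
next
  assume le: "\<forall>t>0. op_mnorm H n (one_minus t c) \<le> sqrt (1 + t\<^sup>2 * R\<^sup>2)"
  show "accretive n c"
    unfolding accretive_def
  proof (intro allI impI)
    fix \<xi> assume \<xi>': "\<forall>i<n. \<xi> i \<in> hcarrier H"
    then have \<xi>: "\<And>j. j < n \<Longrightarrow> \<xi> j \<in> hcarrier H" by auto
    define N where "N = (\<Sum>i<n. (hnorm H (\<xi> i))\<^sup>2)"
    have le': "- 2 * Re (form {..<n} c \<xi> \<xi>) \<le> t * (R\<^sup>2 * N)" if t: "t > 0" for t
    proof -
      have om: "one_minus t c \<in> mats n (bounded_ops H)"
        using c by (intro one_minus_in csubspace_bounded_ops id_op_in)
      have "L2_set (\<lambda>i. hnorm H (\<Sum>j<n. one_minus t c i j (\<xi> j))) {..<n}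
          \<le> op_mnorm H n (one_minus t c) * L2_set (\<lambda>j. hnorm H (\<xi> j)) {..<n}"
        using om \<xi> by (intro mat_norm_apply) (auto simp: mats_def)
      also have "\<dots> \<le> sqrt (1 + t\<^sup>2 * R\<^sup>2) * L2_set (\<lambda>j. hnorm H (\<xi> j)) {..<n}"
        using le t by (intro mult_right_mono) auto
      finally have "(\<Sum>i<n. (hnorm H (\<Sum>j<n. one_minus t c i j (\<xi> j)))\<^sup>2) \<le> (1 + t\<^sup>2 * R\<^sup>2) * N"
        unfolding L2_set_def real_sqrt_mult[symmetric] N_def by simp
      then have "- 2 * t * Re (form {..<n} c \<xi> \<xi>) + t\<^sup>2 * (\<Sum>i<n. (hnorm H (\<Sum>j<n. c i j (\<xi> j)))\<^sup>2)
          \<le> t\<^sup>2 * R\<^sup>2 * N"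
        using norm_one_minus_apply[where t = t and \<xi> = \<xi>, OF c \<xi>] by (simp add: algebra_simps N_def[symmetric])
      moreover have "0 \<le> t\<^sup>2 * (\<Sum>i<n. (hnorm H (\<Sum>j<n. c i j (\<xi> j)))\<^sup>2)"
        by (intro mult_nonneg_nonneg sum_nonneg) auto
      ultimately have "t * (- 2 * Re (form {..<n} c \<xi> \<xi>)) \<le> t * (t * (R\<^sup>2 * N))"
        by (simp add: power2_eq_square mult_ac)
      then show ?thesis using t by (simp only: mult_le_cancel_left_pos)
    qed
    have "((\<lambda>t. t * (R\<^sup>2 * N)) \<longlongrightarrow> 0 * (R\<^sup>2 * N)) (at_right 0)"
      by (intro tendsto_intros)
    then have "- 2 * Re (form {..<n} c \<xi> \<xi>) \<le> 0 * (R\<^sup>2 * N)"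
    proof (rule tendsto_lowerbound)
      show "\<forall>\<^sub>F t in at_right 0. - 2 * Re (form {..<n} c \<xi> \<xi>) \<le> t * (R\<^sup>2 * N)"
        using eventually_at_right_less[of 0] by (rule eventually_mono) (rule le')
    qed simp
    then show "0 \<le> Re (form {..<n} c \<xi> \<xi>)" by simp
  qed
qed

lemma entry_norm_le_sum:
  assumes c: "c \<in> mats n (bounded_ops H)" and ij: "i < n" "j < n"
  shows "op_norm H (c i j) \<le> (\<Sum>i<n. \<Sum>j<n. op_norm H (c i j))"
proof -
  have cn: "op_norm H (c i j) \<ge> 0" if "i < n" "j < n" for i j
    using op_norm_nonneg[OF matsD[OF c that]] .
  have "op_norm H (c i j) \<le> (\<Sum>j<n. op_norm H (c i j))"
    using ij cn by (intro member_le_sum[of j "{..<n}" "\<lambda>j. op_norm H (c i j)"]) auto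
  moreover have "(\<Sum>j<n. op_norm H (c i j)) \<le> (\<Sum>i<n. \<Sum>j<n. op_norm H (c i j))"
    using ij cn by (intro member_le_sum[of i "{..<n}" "\<lambda>i. \<Sum>j<n. op_norm H (c i j)"] sum_nonneg) auto
  ultimately show ?thesis by linarith
qed

lemma mnorm_le_sum_norms:
  assumes c: "c \<in> mats n (bounded_ops H)"
  shows "op_mnorm H n c \<le> (\<Sum>i<n. \<Sum>j<n. op_norm H (c i j))"
proof (rule mat_norm_le_form)
  have nn: "op_norm H (c i j) \<ge> 0" if "i < n" "j < n" for i j
    using op_norm_nonneg[OF matsD[OF c that]] .
  then show "0 \<le> (\<Sum>i<n. \<Sum>j<n. op_norm H (c i j))" by (intro sum_nonneg) auto
  fix \<xi> \<eta> assume \<xi>: "\<And>j. j \<in> {..<n} \<Longrightarrow> \<xi> j \<in> hcarrier H" and \<eta>: "\<And>j. j \<in> {..<n} \<Longrightarrow> \<eta> j \<in> hcarrier H"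
  let ?a = "L2_set (\<lambda>j. hnorm H (\<xi> j)) {..<n}" and ?b = "L2_set (\<lambda>j. hnorm H (\<eta> j)) {..<n}"
  have "cmod (form {..<n} c \<xi> \<eta>) \<le> (\<Sum>i<n. \<Sum>j<n. op_norm H (c i j) * ?a * ?b)"
    unfolding form_def
  proof (intro order_trans[OF norm_sum] sum_mono)
    fix i j assume ij: "i \<in> {..<n}" "j \<in> {..<n}"
    have "cmod (hinner H (c i j (\<xi> j)) (\<eta> i)) \<le> op_norm H (c i j) * hnorm H (\<xi> j) * hnorm H (\<eta> i)"
      using op_norm_form[OF matsD[OF c]] ij \<xi> \<eta> by auto
    also have "\<dots> \<le> op_norm H (c i j) * ?a * ?b"
      using ij \<xi> \<eta> nn member_le_L2_set[of "{..<n}" j "\<lambda>j. hnorm H (\<xi> j)"]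
        member_le_L2_set[of "{..<n}" i "\<lambda>j. hnorm H (\<eta> j)"]
      by (intro mult_mono mult_nonneg_nonneg) auto
    finally show "cmod (hinner H (c i j (\<xi> j)) (\<eta> i)) \<le> op_norm H (c i j) * ?a * ?b" .
  qed
  then show "cmod (form {..<n} c \<xi> \<eta>) \<le> (\<Sum>i<n. \<Sum>j<n. op_norm H (c i j)) * ?a * ?b"
    by (simp add: sum_distrib_right)
qed (use c in \<open>auto simp: mats_def\<close>)

end

section \<open>Weak* continuous separation from the accretive matrices\<close>

context dual_unital_operator_space
begin

lemma mats_X_bd: "x \<in> mats n X \<Longrightarrow> x \<in> mats n (bounded_ops H)"
  using X_sub by (auto simp: mats_def)

lemma norm_zero_imp_zero: "v \<in> V \<Longrightarrow> op_norm K v = 0 \<Longrightarrow> v = 0"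
  using K.op_norm_eq_0 V_bd by blast

lemma predual_norm_commute: "v \<in> V \<Longrightarrow> w \<in> V \<Longrightarrow> op_norm K (v - w) = op_norm K (w - v)"
  using K.op_norm_scaleC[OF V_bd, of "v - w" "-1"] V_diff by simp

lemma norm_triangle3: "u \<in> V \<Longrightarrow> v \<in> V \<Longrightarrow> w \<in> V \<Longrightarrow>
    op_norm K (u - w) \<le> op_norm K (u - v) + op_norm K (v - w)"
  using K.op_norm_add[OF V_bd V_bd, of "u - v" "v - w"] V_diff by simp

lemma predual_geometric_limit:
  assumes s: "\<And>k. s k \<in> V" and a: "a \<ge> 0" and step: "\<And>k. op_norm K (s (Suc k) - s k) \<le> a / 2 ^ k"
  shows "\<exists>l\<in>V. \<forall>k. op_norm K (s k - l) \<le> 2 * a / 2 ^ k"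
proof -
  have close: "op_norm K (s (k + p) - s k) \<le> 2 * a / 2 ^ k - 2 * a / 2 ^ (k + p)" for k p
  proof (induction p)
    case (Suc p)
    have "op_norm K (s (k + Suc p) - s k) \<le> op_norm K (s (Suc (k + p)) - s (k + p)) + op_norm K (s (k + p) - s k)"
      using norm_triangle3[OF s s s] by simp
    also have "\<dots> \<le> a / 2 ^ (k + p) + (2 * a / 2 ^ k - 2 * a / 2 ^ (k + p))"
      by (intro add_mono step Suc)
    also have "\<dots> = 2 * a / 2 ^ k - 2 * a / 2 ^ (k + Suc p)" by (simp add: field_simps)
    finally show ?case .
  qed (use K.op_norm_zero in \<open>simp add: zero_fun_def\<close>)
  have close': "op_norm K (s m - s k) \<le> 2 * a / 2 ^ k" if "k \<le> m" for k m
    using close[of k "m - k"] that a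
    by (smt (verit) divide_nonneg_nonneg le_add_diff_inverse zero_le_power)
  have lim: "(\<lambda>k. 2 * a / 2 ^ k) \<longlonglongrightarrow> 0"
    using tendsto_mult_right_zero[OF LIMSEQ_power_zero[of "1/2::real"], of "2 * a"]
    by (simp add: power_divide)
  have "\<exists>M. \<forall>m\<ge>M. \<forall>n\<ge>M. op_norm K (s m - s n) < e" if e: "e > 0" for e
  proof -
    obtain M where M: "2 * a / 2 ^ M < e / 2"
      using order_tendstoD(2)[OF lim, of "e / 2"] e by (auto simp: eventually_sequentially)
    have "op_norm K (s m - s n) < e" if "m \<ge> M" "n \<ge> M" for m n
    proof -
      have "op_norm K (s m - s n) \<le> op_norm K (s m - s M) + op_norm K (s M - s n)"
        by (rule norm_triangle3[OF s s s])
      also have "op_norm K (s M - s n) = op_norm K (s n - s M)" by (rule predual_norm_commute[OF s s])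
      finally show ?thesis using close'[OF that(1)] close'[OF that(2)] M by linarith
    qed
    then show ?thesis by blast
  qed
  then obtain l where l: "l \<in> V" "(\<lambda>n. op_norm K (s n - l)) \<longlonglongrightarrow> 0"
    using V_complete s unfolding complete_wrt_def by metis
  have "op_norm K (s k - l) \<le> 2 * a / 2 ^ k" for k
  proof (rule LIMSEQ_le_const)
    show "(\<lambda>n. 2 * a / 2 ^ k + op_norm K (s n - l)) \<longlonglongrightarrow> 2 * a / 2 ^ k"
      using tendsto_add[OF tendsto_const l(2)] by simp
    have "op_norm K (s k - l) \<le> 2 * a / 2 ^ k + op_norm K (s n - l)" if "n \<ge> k" for n
      using norm_triangle3[OF s s l(1), of k n] predual_norm_commute[OF s s, of k n] close'[OF that]
      by linarith
    then show "\<exists>N. \<forall>n\<ge>N. op_norm K (s k - l) \<le> 2 * a / 2 ^ k + op_norm K (s n - l)" by blast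
  qed
  then show ?thesis using l(1) by blast
qed

subsection \<open>The compact convex set of accretive contractions\<close>

text \<open>The pairings with \<open>w \<in> mats n V\<close> are the weak* continuous functionals on the \<open>n \<times> n\<close> matrices over \<open>X\<close>.\<close>

definition pair :: "nat \<Rightarrow> (nat \<Rightarrow> nat \<Rightarrow> 'k \<Rightarrow> 'k) \<Rightarrow> (nat \<Rightarrow> nat \<Rightarrow> 'h \<Rightarrow> 'h) \<Rightarrow> complex" where
  "pair n w c = (\<Sum>i<n. \<Sum>j<n. T (c i j) (w i j))"

lemma matsD: "x \<in> mats n S \<Longrightarrow> i < n \<Longrightarrow> j < n \<Longrightarrow> x i j \<in> S"
  by (simp add: mats_def)

lemma pair_add_left:
  "\<lbrakk>w \<in> mats n V; w' \<in> mats n V; c \<in> mats n X\<rbrakk>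
    \<Longrightarrow> pair n (\<lambda>i j. w i j + w' i j) c = pair n w c + pair n w' c"
  by (simp add: pair_def sum.distrib[symmetric] T_add_right matsD)

lemma pair_scale_left:
  "\<lbrakk>w \<in> mats n V; c \<in> mats n X\<rbrakk> \<Longrightarrow> pair n (\<lambda>i j. a *\<^sub>C w i j) c = a * pair n w c"
  by (simp add: pair_def sum_distrib_left T_scale_right matsD)

lemma pair_add_right:
  "\<lbrakk>c \<in> mats n X; d \<in> mats n X\<rbrakk> \<Longrightarrow> pair n w (\<lambda>i j. c i j + d i j) = pair n w c + pair n w d"
  by (simp add: pair_def sum.distrib[symmetric] T_add matsD)

lemma pair_scale_right:
  "c \<in> mats n X \<Longrightarrow> pair n w (\<lambda>i j. a *\<^sub>C c i j) = a * pair n w c"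
  by (simp add: pair_def sum_distrib_left T_scale matsD)

lemma mats_V_add: "w \<in> mats n V \<Longrightarrow> w' \<in> mats n V \<Longrightarrow> (\<lambda>i j. w i j + w' i j) \<in> mats n V"
  and mats_V_scale: "w \<in> mats n V \<Longrightarrow> (\<lambda>i j. a *\<^sub>C w i j) \<in> mats n V"
  and mats_X_add: "c \<in> mats n X \<Longrightarrow> d \<in> mats n X \<Longrightarrow> (\<lambda>i j. c i j + d i j) \<in> mats n X"
  and mats_X_scale: "c \<in> mats n X \<Longrightarrow> (\<lambda>i j. a *\<^sub>C c i j) \<in> mats n X"
  by (auto simp: mats_def V_add V_scale X_add X_scale)

lemma norm_mono_scaleC:
  "v \<in> V \<Longrightarrow> op_norm K (a *\<^sub>C v) = cmod a * op_norm K v"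
  "x \<in> X \<Longrightarrow> op_norm H (a *\<^sub>C x) = cmod a * op_norm H x"
  using K.op_norm_scaleC[OF V_bd] H.op_norm_scaleC[OF X_bd] by auto

text \<open>Matrices are extended by \<open>0\<close>, so that they form a compact subset of a power of \<open>X\<close>.\<close>

definition cball_mats :: "nat \<Rightarrow> (nat \<Rightarrow> nat \<Rightarrow> 'h \<Rightarrow> 'h) set" where
  "cball_mats n = {c. \<forall>i j. if i < n \<and> j < n then c i j \<in> unit_ball else c i j = 0}"

definition acc_ball :: "nat \<Rightarrow> (nat \<Rightarrow> nat \<Rightarrow> 'h \<Rightarrow> 'h) set" where
  "acc_ball n = {c \<in> cball_mats n. H.accretive n c}"

lemma cball_mats_entry:
  "c \<in> cball_mats n \<Longrightarrow> i < n \<Longrightarrow> j < n \<Longrightarrow> c i j \<in> unit_ball"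
  "c \<in> cball_mats n \<Longrightarrow> \<not> (i < n \<and> j < n) \<Longrightarrow> c i j = 0"
  unfolding cball_mats_def mem_Collect_eq by (metis (full_types))+

lemma cball_matsD: "c \<in> cball_mats n \<Longrightarrow> c \<in> mats n X"
  using cball_mats_entry(1) by (auto simp: mats_def unit_ball_def)

lemma convex_unit_ball:
  assumes "x \<in> unit_ball" "y \<in> unit_ball" "0 \<le> t" "t \<le> 1"
  shows "complex_of_real (1 - t) *\<^sub>C x + complex_of_real t *\<^sub>C y \<in> unit_ball"
proof -
  have xy: "x \<in> X" "y \<in> X" "op_norm H x \<le> 1" "op_norm H y \<le> 1"
    using assms by (auto simp: unit_ball_def)
  have "op_norm H (complex_of_real (1 - t) *\<^sub>C x + complex_of_real t *\<^sub>C y)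
    \<le> op_norm H (complex_of_real (1 - t) *\<^sub>C x) + op_norm H (complex_of_real t *\<^sub>C y)"
    using xy by (intro H.op_norm_add X_bd X_scale)
  also have "\<dots> = (1 - t) * op_norm H x + t * op_norm H y"
    using xy assms norm_mono_scaleC(2)[of x "complex_of_real (1 - t)"]
      norm_mono_scaleC(2)[of y "complex_of_real t"] by (simp add: norm_of_real del: of_real_diff)
  also have "\<dots> \<le> (1 - t) * 1 + t * 1"
    using xy assms by (intro add_mono mult_left_mono) auto
  finally show ?thesis using xy by (simp add: unit_ball_def X_add X_scale del: of_real_diff)
qed

lemma convex_acc_ball:
  assumes "c \<in> acc_ball n" "d \<in> acc_ball n" "0 \<le> t" "t \<le> 1"
  shows "(\<lambda>i j. complex_of_real (1 - t) *\<^sub>C c i j + complex_of_real t *\<^sub>C d i j) \<in> acc_ball n"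
proof -
  have cd: "c \<in> cball_mats n" "d \<in> cball_mats n" "H.accretive n c" "H.accretive n d"
    using assms by (auto simp: acc_ball_def)
  have "(\<lambda>i j. complex_of_real (1 - t) *\<^sub>C c i j + complex_of_real t *\<^sub>C d i j) \<in> cball_mats n"
    using cd(1,2) assms(3,4) by (simp add: cball_mats_def convex_unit_ball del: of_real_diff)
  moreover have "H.accretive n (\<lambda>i j. complex_of_real (1 - t) *\<^sub>C c i j + complex_of_real t *\<^sub>C d i j)"
    using cd assms(3,4)
    by (intro H.accretive_add H.accretive_scaleC mats_X_bd mats_X_scale cball_matsD) auto
  ultimately show ?thesis by (simp add: acc_ball_def)
qed

definition mat_topology :: "(nat \<times> nat \<Rightarrow> 'h \<Rightarrow> 'h) topology" where
  "mat_topology = product_topology (\<lambda>_. weakstar) UNIV"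

lemma continuous_map_entry:
  "v \<in> V \<Longrightarrow> continuous_map mat_topology euclidean (\<lambda>c. T (c p) v)"
  using continuous_map_compose[OF continuous_map_product_projection[of p UNIV "\<lambda>_. weakstar"]
      continuous_map_eval, of v]
  by (simp add: mat_topology_def o_def)

lemma continuous_map_pair:
  "w \<in> mats n V \<Longrightarrow> continuous_map mat_topology euclidean (\<lambda>c. pair n w (curry c))"
  unfolding pair_def by (auto intro!: continuous_map_sum continuous_map_entry simp: matsD)

lemma topspace_mat_topology: "topspace mat_topology = {c. \<forall>p. c p \<in> X}"
  by (auto simp: mat_topology_def PiE_def)

lemma compactin_cball_mats: "compactin mat_topology {c. curry c \<in> cball_mats n}"
proof -
  have zero: "compactin weakstar {0}" by (simp add: X_zero)
  have "{c. curry c \<in> cball_mats n} = (\<Pi>\<^sub>E p\<in>UNIV. if fst p < n \<and> snd p < n then unit_ball else {0})"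
    by (fastforce simp: cball_mats_def PiE_def Pi_def split: if_splits)
  then show ?thesis
    unfolding mat_topology_def using compactin_unit_ball zero by (simp add: compactin_PiE)
qed

lemma mnorm_le_iff:
  assumes x: "x \<in> mats n X" and s: "s \<ge> 0"
  shows "op_mnorm H n x \<le> s \<longleftrightarrow> (\<forall>m v \<xi> \<eta>. v \<in> mats m V \<longrightarrow> op_mnorm K m v \<le> 1 \<longrightarrow>
    cmod (\<Sum>p\<in>{..<m} \<times> {..<n}. \<Sum>q\<in>{..<m} \<times> {..<n}.
      T (x (snd p) (snd q)) (v (fst p) (fst q)) * \<xi> q * cnj (\<eta> p))
    \<le> s * L2_set (\<lambda>q. cmod (\<xi> q)) ({..<m} \<times> {..<n}) * L2_set (\<lambda>p. cmod (\<eta> p)) ({..<m} \<times> {..<n}))"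
    (is "_ \<longleftrightarrow> ?R")
proof
  assume le: "op_mnorm H n x \<le> s"
  show ?R
  proof (intro allI impI)
    fix m v and \<xi> \<eta> :: "nat \<times> nat \<Rightarrow> complex"
    assume v: "v \<in> mats m V" "op_mnorm K m v \<le> 1"
    let ?I = "{..<m} \<times> {..<n}"
    have n: "scalar_mat_norm ?I (\<lambda>(k, i) (l, j). T (x i j) (v k l)) \<le> s"
      using mnorm_ge[OF x v] le by linarith
    have "cmod (\<Sum>p\<in>?I. \<Sum>q\<in>?I. T (x (snd p) (snd q)) (v (fst p) (fst q)) * \<xi> q * cnj (\<eta> p))
      \<le> scalar_mat_norm ?I (\<lambda>(k, i) (l, j). T (x i j) (v k l))
        * L2_set (\<lambda>q. cmod (\<xi> q)) ?I * L2_set (\<lambda>p. cmod (\<eta> p)) ?I"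
      using scalar_form_le[of ?I "\<lambda>(k, i) (l, j). T (x i j) (v k l)" \<xi> \<eta>]
      by (simp add: case_prod_beta)
    also have "\<dots> \<le> s * L2_set (\<lambda>q. cmod (\<xi> q)) ?I * L2_set (\<lambda>p. cmod (\<eta> p)) ?I"
      using n by (intro mult_right_mono) auto
    finally show "cmod (\<Sum>p\<in>?I. \<Sum>q\<in>?I. T (x (snd p) (snd q)) (v (fst p) (fst q)) * \<xi> q * cnj (\<eta> p))
      \<le> s * L2_set (\<lambda>q. cmod (\<xi> q)) ?I * L2_set (\<lambda>p. cmod (\<eta> p)) ?I" .
  qed
next
  assume R: ?R
  show "op_mnorm H n x \<le> s"
  proof (rule mnorm_le[OF x], rule scalar_mat_norm_le)
    fix m v and \<xi> \<eta> :: "nat \<times> nat \<Rightarrow> complex"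
    assume v: "v \<in> mats m V" "op_mnorm K m v \<le> 1"
    let ?I = "{..<m} \<times> {..<n}"
    show "cmod (\<Sum>p\<in>?I. \<Sum>q\<in>?I. (case p of (k, i) \<Rightarrow> \<lambda>(l, j). T (x i j) (v k l)) q * \<xi> q * cnj (\<eta> p))
      \<le> s * L2_set (\<lambda>q. cmod (\<xi> q)) ?I * L2_set (\<lambda>p. cmod (\<eta> p)) ?I"
      using R[rule_format, OF v, of \<xi> \<eta>] by (simp add: case_prod_beta)
  qed (use s in auto)
qed

text \<open>By \<open>accretive_iff_norm\<close> and \<open>mnorm_le_iff\<close>, a matrix \<open>c\<close> of contractions is accretive if and only if it satisfies
  a family of inequalities between finite sums of evaluations of its entries.  The sets \<open>Q t m v \<xi> \<eta>\<close>
  below are the solution sets of these inequalities.\<close>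

lemma compactin_acc_ball: "compactin mat_topology {c. curry c \<in> acc_ball n}"
proof -
  let ?B = "{c. curry c \<in> cball_mats n}"
  \<comment> \<open>A bound for the matrix norm, as there are \<open>n * n\<close> entries of norm at most \<open>1\<close>.\<close>
  define R where "R = real n * real n"
  define r where "r t = sqrt (1 + t\<^sup>2 * R\<^sup>2)" for t
  define Q where "Q t m v \<xi> \<eta> = {c \<in> topspace mat_topology.
    (\<Sum>p\<in>{..<m} \<times> {..<n}. \<Sum>q\<in>{..<m} \<times> {..<n}.
      (\<xi> q * cnj (\<eta> p)) * (T (if snd p = snd q then id_op H else 0) (v (fst p) (fst q))
        - of_real t * T (c (snd p, snd q)) (v (fst p) (fst q))))
      \<in> cball 0 (r t * L2_set (\<lambda>q. cmod (\<xi> q)) ({..<m} \<times> {..<n}) * L2_set (\<lambda>p. cmod (\<eta> p)) ({..<m} \<times> {..<n}))}"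
    for t m v and \<xi> \<eta> :: "nat \<times> nat \<Rightarrow> complex"
  have r: "r t \<ge> 0" for t by (simp add: r_def)
  have "closedin mat_topology (Q t m v \<xi> \<eta>)" if "v \<in> mats m V" for t m v \<xi> \<eta>
    unfolding Q_def using that
    by (intro closedin_continuous_map_preimage[where Y = euclidean] continuous_map_sum
        continuous_map_mult_left_complex continuous_map_diff continuous_map_const[THEN iffD2] continuous_map_entry)
      (auto simp: mats_def)
  then have cl: "closedin mat_topology (\<Inter>(insert (topspace mat_topology)
      {Q t m v \<xi> \<eta> | t m v \<xi> \<eta>. t > 0 \<and> v \<in> mats m V \<and> op_mnorm K m v \<le> 1}))"
    by (intro closedin_Inter) auto
  have acc: "H.accretive n (curry c) \<longleftrightarrow> (\<forall>t>0. \<forall>m v \<xi> \<eta>. v \<in> mats m V \<longrightarrow> op_mnorm K m v \<le> 1 \<longrightarrow> c \<in> Q t m v \<xi> \<eta>)"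
    if c: "c \<in> ?B" for c
  proof -
    have cX: "curry c \<in> mats n X" using c cball_matsD by auto
    have cp: "c p \<in> X" for p
      using cball_mats_entry[of "curry c" n "fst p" "snd p"] c X_zero
      by (cases "fst p < n \<and> snd p < n") (auto simp: unit_ball_def)
    have "op_mnorm H n (curry c) \<le> (\<Sum>i<n. \<Sum>j<n. op_norm H (curry c i j))"
      by (rule H.mnorm_le_sum_norms[OF mats_X_bd[OF cX]])
    also have "\<dots> \<le> (\<Sum>i<n. \<Sum>j<n. 1)"
      using cball_mats_entry(1)[of "curry c" n] c by (intro sum_mono) (auto simp: unit_ball_def)
    also have "\<dots> = R" by (simp add: R_def)
    finally have R: "op_mnorm H n (curry c) \<le> R" .
    have om: "H.one_minus t (curry c) \<in> mats n X" for t
      by (intro H.one_minus_in cX X_csub id_in)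
    have entry: "T (H.one_minus t (curry c) i j) v * a * b = (a * b) * (T (if i = j then id_op H else 0) v
        - of_real t * T (c (i, j)) v)" for t i j v a b
      unfolding H.one_minus_def using cp id_in X_zero by (simp add: T_diff T_scale X_scale)
    show ?thesis
      unfolding H.accretive_iff_norm[OF mats_X_bd[OF cX] R] r_def[symmetric] mnorm_le_iff[OF om r] entry
      using cp by (auto simp: Q_def topspace_mat_topology)
  qed
  have "{c. curry c \<in> acc_ball n} = ?B \<inter> \<Inter>(insert (topspace mat_topology)
      {Q t m v \<xi> \<eta> | t m v \<xi> \<eta>. t > 0 \<and> v \<in> mats m V \<and> op_mnorm K m v \<le> 1})"
    (is "?L = ?B \<inter> ?R")
  proof (intro set_eqI iffI)
    fix c assume "c \<in> ?L"
    then have c: "c \<in> ?B" "H.accretive n (curry c)" by (auto simp: acc_ball_def)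
    moreover have "c \<in> topspace mat_topology"
      using compactin_subset_topspace[OF compactin_cball_mats[of n]] c by blast
    moreover have "c \<in> Q t m v \<xi> \<eta>" if "t > 0" "v \<in> mats m V" "op_mnorm K m v \<le> 1" for t m v \<xi> \<eta>
      using acc[OF c(1), THEN iffD1, OF c(2)] that by simp
    ultimately show "c \<in> ?B \<inter> ?R" by auto
  next
    fix c assume c: "c \<in> ?B \<inter> ?R"
    have "c \<in> Q t m v \<xi> \<eta>" if "t > 0" "v \<in> mats m V" "op_mnorm K m v \<le> 1" for t m v \<xi> \<eta>
    proof -
      have "Q t m v \<xi> \<eta> \<in> insert (topspace mat_topology)
          {Q t m v \<xi> \<eta> | t m v \<xi> \<eta>. t > 0 \<and> v \<in> mats m V \<and> op_mnorm K m v \<le> 1}"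
        using that by blast
      then show ?thesis using c by (metis (no_types, lifting) IntD2 InterD)
    qed
    then have "H.accretive n (curry c)"
      using c by (intro acc[THEN iffD2]) auto
    then show "c \<in> ?L" using c by (simp add: acc_ball_def)
  qed
  then show ?thesis
    using compact_Int_closedin[OF compactin_cball_mats cl, of n] by simp
qed

text \<open>To find one weak* continuous functional in a convex set that is almost positive on all accretive
  contractions, it is enough to find one for each accretive contraction separately.\<close>

lemma accretive_minimax:
  assumes W: "W \<subseteq> mats n V" "W \<noteq> {}"
    and conv: "\<And>w w' t. \<lbrakk>w \<in> W; w' \<in> W; 0 \<le> t; t \<le> 1\<rbrakk> \<Longrightarrow>
      (\<lambda>i j. complex_of_real (1 - t) *\<^sub>C w i j + complex_of_real t *\<^sub>C w' i j) \<in> W"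
    and ex: "\<And>c. c \<in> acc_ball n \<Longrightarrow> \<exists>w\<in>W. Re (pair n w c) > - a"
  shows "\<exists>w\<in>W. \<forall>c\<in>acc_ball n. Re (pair n w c) > - a"
proof -
  define Y where "Y = subtopology mat_topology {c. curry c \<in> acc_ball n}"
  have top: "topspace Y = {c. curry c \<in> acc_ball n}"
    unfolding Y_def using compactin_subset_topspace[OF compactin_acc_ball[of n]] by auto
  have accD: "c \<in> mats n X" if "c \<in> acc_ball n" for c
    using that cball_matsD by (auto simp: acc_ball_def)
  define \<Theta> where "\<Theta> = (\<lambda>w c. Re (pair n w (curry c)) + a) ` W"
  have "\<exists>f\<in>\<Theta>. \<forall>c\<in>topspace Y. f c > 0"
  proof (rule minimax)
    show "compact_space Y" unfolding Y_def
      by (intro compact_space_subtopology compactin_acc_ball)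
    show "\<Theta> \<noteq> {}" using W by (simp add: \<Theta>_def)
    show "continuous_map Y euclideanreal f" if f: "f \<in> \<Theta>" for f
    proof -
      obtain w where w: "w \<in> W" "f = (\<lambda>c. Re (pair n w (curry c)) + a)" using f by (auto simp: \<Theta>_def)
      have "continuous_map mat_topology euclideanreal (Re \<circ> (\<lambda>c. pair n w (curry c)))"
        using w W by (intro continuous_map_compose[OF continuous_map_pair]) (auto simp: continuous_on_Re)
      then show ?thesis
        unfolding w Y_def o_def
        by (intro continuous_map_add continuous_map_from_subtopology) auto
    qed
    show "\<exists>e\<in>topspace Y. \<forall>f\<in>\<Theta>. f e = (1 - t) * f c + t * f d"
      if "c \<in> topspace Y" "d \<in> topspace Y" "0 \<le> t" "t \<le> 1" for c d t
    proof
      let ?e = "\<lambda>p. complex_of_real (1 - t) *\<^sub>C c p + complex_of_real t *\<^sub>C d p"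
      have e: "curry ?e = (\<lambda>i j. complex_of_real (1 - t) *\<^sub>C curry c i j + complex_of_real t *\<^sub>C curry d i j)"
        by (simp add: curry_def)
      have cd: "curry c \<in> acc_ball n" "curry d \<in> acc_ball n" using that by (auto simp: top)
      show "?e \<in> topspace Y"
        unfolding top mem_Collect_eq e using convex_acc_ball[OF cd that(3,4)] .
      have eq: "pair n w (curry ?e) = complex_of_real (1 - t) * pair n w (curry c) + complex_of_real t * pair n w (curry d)" for w
        unfolding e using accD[OF cd(1)] accD[OF cd(2)]
        by (simp only: pair_add_right pair_scale_right mats_X_scale)
      have Re: "Re (pair n w (curry ?e)) = (1 - t) * Re (pair n w (curry c)) + t * Re (pair n w (curry d))" for w
        unfolding eq by simp
      show "\<forall>f\<in>\<Theta>. f ?e = (1 - t) * f c + t * f d"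
        unfolding \<Theta>_def ball_simps Re by (simp add: algebra_simps)
    qed
    show "\<exists>h\<in>\<Theta>. \<forall>c\<in>topspace Y. h c = (1 - t) * f c + t * g c"
      if fg: "f \<in> \<Theta>" "g \<in> \<Theta>" "0 \<le> t" "t \<le> 1" for f g t
    proof -
      obtain w w' where w: "w \<in> W" "f = (\<lambda>c. Re (pair n w (curry c)) + a)"
        "w' \<in> W" "g = (\<lambda>c. Re (pair n w' (curry c)) + a)" using fg by (auto simp: \<Theta>_def)
      let ?w = "\<lambda>i j. complex_of_real (1 - t) *\<^sub>C w i j + complex_of_real t *\<^sub>C w' i j"
      have wV: "w \<in> mats n V" "w' \<in> mats n V" using w W by auto
      have eq: "pair n ?w (curry c) = complex_of_real (1 - t) * pair n w (curry c) + complex_of_real t * pair n w' (curry c)"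
        if "c \<in> topspace Y" for c
        using accD[of "curry c"] that wV by (simp only: pair_add_left pair_scale_left mats_V_scale top mem_Collect_eq)
      have "Re (pair n ?w (curry c)) + a = (1 - t) * f c + t * g c" if "c \<in> topspace Y" for c
        unfolding eq[OF that] w by (simp add: algebra_simps)
      then have "\<forall>c\<in>topspace Y. Re (pair n ?w (curry c)) + a = (1 - t) * f c + t * g c"
        by (rule ballI)
      moreover have "(\<lambda>c. Re (pair n ?w (curry c)) + a) \<in> \<Theta>"
        unfolding \<Theta>_def by (rule imageI) (rule conv[OF w(1,3) fg(3,4)])
      ultimately show ?thesis by (rule bexI)
    qed
    show "\<exists>f\<in>\<Theta>. f c > 0" if "c \<in> topspace Y" for c
    proof -
      obtain w where "w \<in> W" "Re (pair n w (curry c)) > - a"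
        using ex[of "curry c"] \<open>c \<in> topspace Y\<close> by (auto simp: top)
      then show ?thesis
        by (intro bexI[of _ "\<lambda>c. Re (pair n w (curry c)) + a"]) (auto simp: \<Theta>_def)
    qed
  qed
  then obtain w where w: "w \<in> W" "\<forall>c\<in>topspace Y. Re (pair n w (curry c)) + a > 0" by (auto simp: \<Theta>_def)
  have "Re (pair n w c) > - a" if "c \<in> acc_ball n" for c
    using bspec[OF w(2), of "case_prod c"] that by (simp add: top)
  then show ?thesis using w(1) by blast
qed

text \<open>After division by \<open>\<mu>\<close>, the matrix \<open>c\<close> has contractive entries.\<close>

lemma pair_ge_homogeneous:
  assumes w: "\<forall>c\<in>acc_ball n. Re (pair n w c) \<ge> - a"
    and c: "c \<in> mats n X" "H.accretive n c" and \<mu>: "\<mu> > 0" "\<And>i j. i < n \<Longrightarrow> j < n \<Longrightarrow> op_norm H (c i j) \<le> \<mu>"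
  shows "Re (pair n w c) \<ge> - a * \<mu>"
proof -
  define d where "d i j = (if i < n \<and> j < n then complex_of_real (1 / \<mu>) *\<^sub>C c i j else 0)" for i j
  have "d \<in> cball_mats n"
    using c \<mu> by (auto simp: cball_mats_def d_def unit_ball_def matsD X_scale norm_mono_scaleC norm_divide
        simp del: of_real_divide)
  moreover have "H.accretive n d"
  proof -
    have "H.accretive n (\<lambda>i j. complex_of_real (1 / \<mu>) *\<^sub>C c i j)"
      using c \<mu> by (intro H.accretive_scaleC mats_X_bd) auto
    then show ?thesis
      by (subst H.accretive_cong[where y = "\<lambda>i j. complex_of_real (1 / \<mu>) *\<^sub>C c i j"]) (auto simp: d_def)
  qed
  ultimately have "Re (pair n w d) \<ge> - a" using w by (auto simp: acc_ball_def)
  moreover have "pair n w d = complex_of_real (1 / \<mu>) * pair n w c"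
    unfolding pair_scale_right[OF c(1), symmetric] by (simp add: pair_def d_def)
  ultimately show ?thesis using \<mu> by (simp add: field_simps)
qed

lemma separating_matrix:
  assumes h: "h \<in> mats n X" "i < n" "j < n" "h i j \<noteq> 0"
  shows "\<exists>w\<in>mats n V. pair n w h = 1"
proof -
  have hX: "h i j \<in> X" using h by (auto simp: mats_def)
  have "\<exists>v\<in>V. T (h i j) v \<noteq> 0"
  proof (rule ccontr)
    assume "\<not> ?thesis"
    then have "op_norm H (h i j) \<le> 0" using norm_le[OF hX, of 0] by auto
    then have "h i j = 0" using H.op_norm_eq_0[OF X_bd[OF hX]] norm_nonneg(1)[OF hX] by auto
    then show False using h by simp
  qed
  then obtain v where v: "v \<in> V" "T (h i j) v \<noteq> 0" by blast
  define w where "w i' j' = (if i' = i \<and> j' = j then inverse (T (h i j) v) *\<^sub>C v else 0)" for i' j'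
  have "w \<in> mats n V" using v V_zero V_scale by (auto simp: mats_def w_def)
  moreover have "pair n w h = 1"
  proof -
    have "pair n w h = (\<Sum>i'<n. \<Sum>j'<n. if i' = i \<and> j' = j then 1 else 0)"
      unfolding pair_def using v h hX T_zero_right
      by (intro sum.cong refl) (auto simp: w_def T_scale_right mats_def)
    also have "\<dots> = (\<Sum>i'<n. if i' = i then 1 else 0)"
      using h by (intro sum.cong refl) auto
    also have "\<dots> = 1" using h by simp
    finally show ?thesis .
  qed
  ultimately show ?thesis by blast
qed

lemma acc_ballD: "c \<in> acc_ball n \<Longrightarrow> c \<in> mats n X" "c \<in> acc_ball n \<Longrightarrow> H.accretive n c"
  using cball_matsD by (auto simp: acc_ball_def)

lemma nonaccretive_entry:
  assumes "x \<in> mats n X" "\<not> H.accretive n x"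
  shows "\<exists>i<n. \<exists>j<n. x i j \<noteq> 0"
proof (rule ccontr)
  assume "\<not> ?thesis"
  then have "H.form {..<n} x \<xi> \<xi> = 0" if "\<forall>i<n. \<xi> i \<in> hcarrier H" for \<xi>
    using that unfolding H.form_def by (intro sum.neutral ballI) auto
  then have "H.accretive n x" by (auto simp: H.accretive_def)
  then show False using assms by simp
qed

text \<open>By minimax, \<open>w\<close> may depend on \<open>c\<close>, so that only the values of \<open>w\<close> at the two matrices \<open>x\<close> and \<open>c\<close>
  matter.  Their real parts can be prescribed unless \<open>c\<close> is a real multiple of \<open>x\<close>.  A multiple by a
  nonpositive factor is harmless, and \<open>c\<close> cannot be a positive multiple, as it is accretive and \<open>x\<close> is not.\<close>

lemma approximate_separation:
  assumes x: "x \<in> mats n X" "\<not> H.accretive n x" and \<delta>: "\<delta> > 0"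
  shows "\<exists>w\<in>mats n V. Re (pair n w x) = -1 \<and> (\<forall>c\<in>acc_ball n. Re (pair n w c) > - \<delta>)"
proof -
  define W where "W = {w \<in> mats n V. Re (pair n w x) = -1}"
  obtain w0 where w0: "w0 \<in> mats n V" "pair n w0 x = 1"
    using nonaccretive_entry[OF x] separating_matrix[OF x(1)] by blast
  define w1 where "w1 = (\<lambda>i j. (-1) *\<^sub>C w0 i j)"
  have w1: "w1 \<in> mats n V" "pair n w1 x = -1"
    unfolding w1_def pair_scale_left[OF w0(1) x(1)] w0(2) by (intro mats_V_scale w0) simp
  have "\<exists>w\<in>W. \<forall>c\<in>acc_ball n. Re (pair n w c) > - \<delta>"
  proof (rule accretive_minimax)
    show "W \<subseteq> mats n V" "W \<noteq> {}" using w1 by (auto simp: W_def)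
    show "(\<lambda>i j. complex_of_real (1 - t) *\<^sub>C w i j + complex_of_real t *\<^sub>C w' i j) \<in> W"
      if "w \<in> W" "w' \<in> W" "0 \<le> t" "t \<le> 1" for w w' t
    proof -
      have w: "w \<in> mats n V" "w' \<in> mats n V" "Re (pair n w x) = -1" "Re (pair n w' x) = -1"
        using that by (auto simp: W_def)
      have eq: "pair n (\<lambda>i j. complex_of_real (1 - t) *\<^sub>C w i j + complex_of_real t *\<^sub>C w' i j) x
        = complex_of_real (1 - t) * pair n w x + complex_of_real t * pair n w' x"
        using w x by (simp only: pair_add_left pair_scale_left mats_V_scale)
      have "Re (pair n (\<lambda>i j. complex_of_real (1 - t) *\<^sub>C w i j + complex_of_real t *\<^sub>C w' i j) x) = -1"
        unfolding eq using w by simp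
      then show ?thesis using w unfolding W_def by (intro CollectI conjI mats_V_add mats_V_scale) auto
    qed
    fix c assume c: "c \<in> acc_ball n"
    then have cX: "c \<in> mats n X" by (rule acc_ballD)
    define s where "s = Re (pair n w1 c)"
    \<comment> \<open>With this \<open>s\<close>, the real part of \<open>w1\<close> vanishes at \<open>h\<close>, and \<open>c\<close> is a real multiple of \<open>x\<close> if \<open>h = 0\<close>.\<close>
    define h where "h = (\<lambda>i j. c i j + complex_of_real s *\<^sub>C x i j)"
    have hX: "h \<in> mats n X" unfolding h_def by (intro mats_X_add mats_X_scale cX x)
    have pair_h: "Re (pair n w h) = Re (pair n w c) + s * Re (pair n w x)" for w
      unfolding h_def using cX x by (simp only: pair_add_right pair_scale_right mats_X_scale) simp
    show "\<exists>w\<in>W. Re (pair n w c) > - \<delta>"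
    proof (cases "\<forall>i<n. \<forall>j<n. h i j = 0")
      case True
      have "s \<ge> 0"
      proof (rule ccontr)
        assume "\<not> s \<ge> 0"
        then have s: "s < 0" by simp
        have "H.accretive n (\<lambda>i j. complex_of_real (inverse (- s)) *\<^sub>C c i j)"
          using acc_ballD[OF c] s by (intro H.accretive_scaleC mats_X_bd) auto
        also have "H.accretive n (\<lambda>i j. complex_of_real (inverse (- s)) *\<^sub>C c i j) \<longleftrightarrow> H.accretive n x"
        proof (rule H.accretive_cong)
          fix i j assume "i < n" "j < n"
          then have "c i j = complex_of_real (- s) *\<^sub>C x i j"
            using True by (simp add: h_def add_eq_0_iff2)
          then have "complex_of_real (inverse (- s)) *\<^sub>C c i j
              = (complex_of_real (inverse (- s)) * complex_of_real (- s)) *\<^sub>C x i j"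
            by (simp only: scaleC_scaleC)
          also have "complex_of_real (inverse (- s)) * complex_of_real (- s) = 1"
            using s unfolding of_real_mult[symmetric] by simp
          finally show "complex_of_real (inverse (- s)) *\<^sub>C c i j = x i j" by (simp only: scaleC_one)
        qed
        finally show False using x by simp
      qed
      then show ?thesis using w1 \<delta> by (intro bexI[of _ w1]) (auto simp: W_def s_def)
    next
      case False
      then obtain w2 where w2: "w2 \<in> mats n V" "pair n w2 h = 1"
        using separating_matrix[OF hX] by blast
      define a where "a = Re (pair n w2 x)"
      define r where "r = \<bar>s\<bar>"
      \<comment> \<open>The bracket vanishes at \<open>x\<close> and is \<open>1\<close> at \<open>h\<close>, up to imaginary parts.\<close>
      define w where "w = (\<lambda>i j. w1 i j + complex_of_real r *\<^sub>C (w2 i j + complex_of_real a *\<^sub>C w1 i j))"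
      have wV: "w \<in> mats n V" unfolding w_def by (intro mats_V_add mats_V_scale w1 w2)
      have pair_w: "Re (pair n w d) = Re (pair n w1 d) + r * (Re (pair n w2 d) + a * Re (pair n w1 d))"
        if "d \<in> mats n X" for d
        unfolding w_def using that w1 w2 
        by (simp only: pair_add_left pair_scale_left mats_V_scale mats_V_add) simp
      have "Re (pair n w x) = -1" using pair_w[OF x(1)] w1 by (simp add: a_def)
      moreover have "Re (pair n w c) > - \<delta>"
      proof -
        have "Re (pair n w1 h) = 0" using pair_h[of w1] w1 by (simp add: s_def)
        then have "Re (pair n w h) = r" using pair_w[OF hX] w2 by simp
        then have "Re (pair n w c) = r + s" using pair_h[of w] \<open>Re (pair n w x) = -1\<close> by simp
        then show ?thesis using \<delta> by (simp add: r_def)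
      qed
      ultimately show ?thesis using wV by (auto simp: W_def)
    qed
  qed
  then show ?thesis by (auto simp: W_def)
qed

text \<open>The factor \<open>2\<close> makes up for the supremum over the unit ball of \<open>V\<close>, which need not be attained.\<close>

lemma norming_functional:
  assumes x: "x \<in> X"
  shows "\<exists>v\<in>V. op_norm K v \<le> 1 \<and> T x v = of_real (cmod (T x v)) \<and> op_norm H x \<le> 2 * cmod (T x v)"
proof (cases "op_norm H x = 0")
  case True
  then show ?thesis using V_zero T_zero_right[OF x] by (intro bexI[of _ 0]) auto
next
  case False
  then have pos: "op_norm H x > 0" using norm_nonneg(1)[OF x] by simp
  have "\<not> (\<forall>v\<in>V. cmod (T x v) \<le> op_norm H x / 2 * op_norm K v)"
    using norm_le[OF x, of "op_norm H x / 2"] pos by auto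
  then obtain u where u: "u \<in> V" "cmod (T x u) > op_norm H x / 2 * op_norm K u" by force
  then have "op_norm K u \<noteq> 0" using norm_zero_imp_zero[of u] T_zero_right[OF x] by auto
  then have up: "op_norm K u > 0" using norm_nonneg(2)[OF u(1)] by simp
  have Tu: "cmod (T x u) > 0" using u(2) mult_nonneg_nonneg[of "op_norm H x / 2" "op_norm K u"] pos up by linarith
  define \<alpha> where "\<alpha> = of_real (cmod (T x u)) / T x u / of_real (op_norm K u)"
  have \<alpha>: "\<alpha> * T x u = of_real (cmod (T x u) / op_norm K u)" "cmod \<alpha> = 1 / op_norm K u"
    using Tu up by (auto simp: \<alpha>_def norm_divide norm_mult)
  have T\<alpha>: "T x (\<alpha> *\<^sub>C u) = of_real (cmod (T x u) / op_norm K u)"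
    using T_scale_right[OF x u(1), of \<alpha>] \<alpha> by simp
  have c: "cmod (T x (\<alpha> *\<^sub>C u)) = cmod (T x u) / op_norm K u"
    unfolding T\<alpha> norm_of_real using up by simp
  show ?thesis
  proof (intro bexI[of _ "\<alpha> *\<^sub>C u"] conjI)
    show "op_norm K (\<alpha> *\<^sub>C u) \<le> 1" using norm_mono_scaleC(1)[OF u(1), of \<alpha>] \<alpha> up by simp
    show "T x (\<alpha> *\<^sub>C u) = of_real (cmod (T x (\<alpha> *\<^sub>C u)))" unfolding c by (rule T\<alpha>)
    show "op_norm H x \<le> 2 * cmod (T x (\<alpha> *\<^sub>C u))"
      unfolding c using u(2) up by (simp add: field_simps)
  qed (use u V_scale in auto)
qed

text \<open>By minimax, the perturbation of \<open>w\<close> may depend on \<open>c\<close>.  The value of \<open>w\<close> at \<open>c\<close>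
  is at least \<open>- \<delta>\<close> times the sum of the norms of the entries of \<open>c\<close>, by homogeneity, and since \<open>V\<close> norms
  \<open>X\<close>, functionals of norm \<open>2 \<delta>\<close> in each entry make up for that.\<close>

lemma improve_positivity:
  assumes w: "w \<in> mats n V" "\<forall>c\<in>acc_ball n. Re (pair n w c) > - \<delta>" and \<delta>: "\<delta> > 0"
  shows "\<exists>w'\<in>mats n V. (\<forall>i<n. \<forall>j<n. op_norm K (w' i j - w i j) \<le> 2 * \<delta>) \<and>
    (\<forall>c\<in>acc_ball n. Re (pair n w' c) > - (\<delta> / 2))"
proof -
  define W where "W = {w' \<in> mats n V. \<forall>i<n. \<forall>j<n. op_norm K (w' i j - w i j) \<le> 2 * \<delta>}"
  have "\<exists>w'\<in>W. \<forall>c\<in>acc_ball n. Re (pair n w' c) > - (\<delta> / 2)"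
  proof (rule accretive_minimax)
    show "W \<subseteq> mats n V" "W \<noteq> {}" using w \<delta> by (auto simp: W_def intro!: exI[of _ w])
    show "(\<lambda>i j. complex_of_real (1 - t) *\<^sub>C u i j + complex_of_real t *\<^sub>C u' i j) \<in> W"
      if u: "u \<in> W" "u' \<in> W" and t: "0 \<le> t" "t \<le> 1" for u u' t
    proof -
      have uV: "u \<in> mats n V" "u' \<in> mats n V" using u by (auto simp: W_def)
      have "op_norm K (complex_of_real (1 - t) *\<^sub>C u i j + complex_of_real t *\<^sub>C u' i j - w i j) \<le> 2 * \<delta>"
        if ij: "i < n" "j < n" for i j
      proof -
        have V: "u i j - w i j \<in> V" "u' i j - w i j \<in> V" using uV w ij by (auto simp: matsD V_diff)
        have eq: "complex_of_real (1 - t) *\<^sub>C u i j + complex_of_real t *\<^sub>C u' i j - w i j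
          = complex_of_real (1 - t) *\<^sub>C (u i j - w i j) + complex_of_real t *\<^sub>C (u' i j - w i j)"
          by (simp add: algebra_simps complex_vector.scale_right_diff_distrib complex_vector.scale_left_diff_distrib)
        have "op_norm K (complex_of_real (1 - t) *\<^sub>C u i j + complex_of_real t *\<^sub>C u' i j - w i j)
            \<le> op_norm K (complex_of_real (1 - t) *\<^sub>C (u i j - w i j))
            + op_norm K (complex_of_real t *\<^sub>C (u' i j - w i j))"
          unfolding eq using V by (intro K.op_norm_add V_bd V_scale)
        also have "\<dots> = (1 - t) * op_norm K (u i j - w i j) + t * op_norm K (u' i j - w i j)"
          using V t norm_mono_scaleC(1)[of _ "complex_of_real (1 - t)"]
            norm_mono_scaleC(1)[of _ "complex_of_real t"] by (simp add: norm_of_real del: of_real_diff)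
        also have "\<dots> \<le> (1 - t) * (2 * \<delta>) + t * (2 * \<delta>)"
          using u ij t by (intro add_mono mult_left_mono) (auto simp: W_def)
        finally show ?thesis by (simp add: algebra_simps)
      qed
      then show ?thesis using uV unfolding W_def by (auto intro!: mats_V_add mats_V_scale simp del: of_real_diff)
    qed
    fix c assume c: "c \<in> acc_ball n"
    then have cX: "c \<in> mats n X" by (rule acc_ballD)
    define P where "P i j v \<longleftrightarrow> v \<in> V \<and> op_norm K v \<le> 1 \<and>
      T (c i j) v = of_real (cmod (T (c i j) v)) \<and> op_norm H (c i j) \<le> 2 * cmod (T (c i j) v)" for i j v
    have "\<exists>v. i < n \<longrightarrow> j < n \<longrightarrow> P i j v" for i j
      using norming_functional[OF matsD[OF cX, of i j]] unfolding P_def by blast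
    then obtain v where P: "\<And>i j. i < n \<Longrightarrow> j < n \<Longrightarrow> P i j (v i j)" by metis
    have v: "v i j \<in> V" "op_norm K (v i j) \<le> 1"
      "T (c i j) (v i j) = of_real (cmod (T (c i j) (v i j)))"
      "op_norm H (c i j) \<le> 2 * cmod (T (c i j) (v i j))" if "i < n" "j < n" for i j
      using P[OF that] by (auto simp: P_def)
    have vV: "v \<in> mats n V" using v by (auto simp: mats_def)
    \<comment> \<open>The summand \<open>1 / 4\<close> makes \<open>\<mu>\<close> positive and costs \<open>\<delta> / 4\<close>, which is less than the error \<open>\<delta> / 2\<close>.\<close>
    define \<mu> where "\<mu> = (\<Sum>i<n. \<Sum>j<n. op_norm H (c i j)) + 1 / 4"
    have cn: "op_norm H (c i j) \<ge> 0" if "i < n" "j < n" for i j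
      using norm_nonneg(1)[OF matsD[OF cX that]] .
    have "op_norm H (c i j) \<le> \<mu>" if "i < n" "j < n" for i j
      using H.entry_norm_le_sum[OF mats_X_bd[OF cX] that] by (simp add: \<mu>_def)
    moreover have "\<mu> > 0" using cn unfolding \<mu>_def by (intro add_nonneg_pos sum_nonneg) auto
    moreover have "\<forall>c\<in>acc_ball n. - \<delta> \<le> Re (pair n w c)" using w(2) by (auto intro: less_imp_le)
    ultimately have 1: "Re (pair n w c) \<ge> - \<delta> * \<mu>"
      using acc_ballD[OF c] by (intro pair_ge_homogeneous)
    define w' where "w' = (\<lambda>i j. w i j + complex_of_real (2 * \<delta>) *\<^sub>C v i j)"
    have "(\<mu> - 1 / 4) / 2 = (\<Sum>i<n. \<Sum>j<n. op_norm H (c i j) / 2)"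
      by (simp add: \<mu>_def sum_divide_distrib)
    also have "\<dots> \<le> (\<Sum>i<n. \<Sum>j<n. Re (T (c i j) (v i j)))"
    proof (intro sum_mono)
      fix i j assume ij: "i \<in> {..<n}" "j \<in> {..<n}"
      have "Re (T (c i j) (v i j)) = cmod (T (c i j) (v i j))"
        using arg_cong[OF v(3)[of i j], of Re] ij by simp
      then show "op_norm H (c i j) / 2 \<le> Re (T (c i j) (v i j))" using v(4)[of i j] ij by simp
    qed
    also have "\<dots> = Re (pair n v c)" by (simp add: pair_def)
    finally have 2: "Re (pair n v c) \<ge> (\<mu> - 1 / 4) / 2" .
    have "Re (pair n w' c) = Re (pair n w c) + 2 * \<delta> * Re (pair n v c)"
      unfolding w'_def using w vV cX by (simp only: pair_add_left pair_scale_left mats_V_scale) simp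
    moreover have "2 * \<delta> * Re (pair n v c) \<ge> 2 * \<delta> * ((\<mu> - 1 / 4) / 2)"
      using 2 \<delta> by (intro mult_left_mono) auto
    ultimately have "Re (pair n w' c) \<ge> - (\<delta> / 4)"
      using 1 by (simp add: algebra_simps)
    then have "Re (pair n w' c) > - (\<delta> / 2)" using \<delta> by simp
    moreover have "w' \<in> W"
    proof -
      have "op_norm K (w' i j - w i j) \<le> 2 * \<delta>" if "i < n" "j < n" for i j
      proof -
        have "op_norm K (w' i j - w i j) = 2 * \<delta> * op_norm K (v i j)"
          using norm_mono_scaleC(1)[OF v(1)[OF that], of "complex_of_real (2 * \<delta>)"] \<delta>
          by (simp add: w'_def norm_mult)
        also have "\<dots> \<le> 2 * \<delta> * 1" using v(2)[OF that] \<delta> by (intro mult_left_mono) auto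
        finally show ?thesis by simp
      qed
      moreover have "w' \<in> mats n V" unfolding w'_def by (intro mats_V_add mats_V_scale w vV)
      ultimately show ?thesis by (auto simp: W_def)
    qed
    ultimately show "\<exists>w\<in>W. Re (pair n w c) > - (\<delta> / 2)" by blast
  qed
  then show ?thesis by (auto simp: W_def)
qed

lemma pair_diff_le:
  assumes "w \<in> mats n V" "w' \<in> mats n V" "c \<in> mats n X"
    and "\<And>i j. i < n \<Longrightarrow> j < n \<Longrightarrow> op_norm K (w i j - w' i j) \<le> b"
  shows "cmod (pair n w c - pair n w' c) \<le> (\<Sum>i<n. \<Sum>j<n. op_norm H (c i j)) * b"
proof -
  have "pair n w c - pair n w' c = (\<Sum>i<n. \<Sum>j<n. T (c i j) (w i j - w' i j))"
    using assms by (simp add: pair_def sum_subtractf[symmetric] T_diff_right matsD)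
  also have "cmod \<dots> \<le> (\<Sum>i<n. \<Sum>j<n. op_norm H (c i j) * b)"
  proof (intro order_trans[OF norm_sum] sum_mono)
    fix i j assume ij: "i \<in> {..<n}" "j \<in> {..<n}"
    then have c: "c i j \<in> X" and d: "w i j - w' i j \<in> V" using assms by (auto simp: matsD V_diff)
    show "cmod (T (c i j) (w i j - w' i j)) \<le> op_norm H (c i j) * b"
      using pairing_le[OF c d] mult_left_mono[OF assms(4) norm_nonneg(1)[OF c], of i j] ij by force
  qed
  finally show ?thesis by (simp add: sum_distrib_right)
qed

text \<open>The perturbations from \<open>improve_positivity\<close> decrease geometrically, hence converge in the complete
  space \<open>V\<close>; the limit is positive, and its value at \<open>x\<close> remains negative if the first defect is small.\<close>

theorem weakstar_separation:
  assumes x: "x \<in> mats n X" "\<not> H.accretive n x"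
  shows "\<exists>w\<in>mats n V. (\<forall>c\<in>mats n X. H.accretive n c \<longrightarrow> 0 \<le> Re (pair n w c)) \<and> Re (pair n w x) < 0"
proof -
  define M where "M = (\<Sum>i<n. \<Sum>j<n. op_norm H (x i j))"
  have M: "M \<ge> 0" unfolding M_def using norm_nonneg(1)[OF matsD[OF x(1)]] by (intro sum_nonneg) auto
  \<comment> \<open>The total perturbation of each entry is at most \<open>4 * \<delta> 0\<close>, which changes the value at \<open>x\<close> by less than \<open>1\<close>.\<close>
  define \<delta> where "\<delta> k = 1 / (8 * (M + 1)) / 2 ^ k" for k :: nat
  have \<delta>: "\<delta> k > 0" "\<delta> (Suc k) = \<delta> k / 2" for k using M by (auto simp: \<delta>_def)
  obtain w0 where w0: "w0 \<in> mats n V" "Re (pair n w0 x) = -1" "\<forall>c\<in>acc_ball n. Re (pair n w0 c) > - \<delta> 0"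
    using approximate_separation[OF x \<delta>(1)] by blast
  define P where "P k w \<longleftrightarrow> w \<in> mats n V \<and> (\<forall>c\<in>acc_ball n. Re (pair n w c) > - \<delta> k) \<and> (k = 0 \<longrightarrow> w = w0)" for k w
  have "\<exists>s. \<forall>k. P k (s k) \<and> (\<forall>i<n. \<forall>j<n. op_norm K (s (Suc k) i j - s k i j) \<le> 2 * \<delta> k)"
  proof (rule dependent_nat_choice)
    show "\<exists>w. P 0 w" using w0 by (auto simp: P_def)
    show "\<exists>w'. P (Suc k) w' \<and> (\<forall>i<n. \<forall>j<n. op_norm K (w' i j - w i j) \<le> 2 * \<delta> k)" if "P k w" for w k
      using improve_positivity[OF _ _ \<delta>(1)[of k], of w n] that unfolding P_def \<delta>(2) by blast
  qed
  then obtain s where s: "\<And>k. P k (s k)"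
    "\<And>k i j. i < n \<Longrightarrow> j < n \<Longrightarrow> op_norm K (s (Suc k) i j - s k i j) \<le> 2 * \<delta> k" by blast
  have sV: "s k \<in> mats n V" for k using s(1)[of k] by (simp add: P_def)
  have "\<forall>i j. \<exists>l. i < n \<longrightarrow> j < n \<longrightarrow> l \<in> V \<and> (\<forall>k. op_norm K (s k i j - l) \<le> 4 * \<delta> 0 / 2 ^ k)"
  proof (intro allI)
    fix i j
    show "\<exists>l. i < n \<longrightarrow> j < n \<longrightarrow> l \<in> V \<and> (\<forall>k. op_norm K (s k i j - l) \<le> 4 * \<delta> 0 / 2 ^ k)"
    proof (cases "i < n \<and> j < n")
      case True
      have "\<exists>l\<in>V. \<forall>k. op_norm K (s k i j - l) \<le> 2 * (2 * \<delta> 0) / 2 ^ k"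
      proof (rule predual_geometric_limit)
        show "s k i j \<in> V" for k using matsD[OF sV] True by auto
        show "op_norm K (s (Suc k) i j - s k i j) \<le> 2 * \<delta> 0 / 2 ^ k" for k
          using s(2)[of i j k] True by (simp add: \<delta>_def)
      qed (use \<delta>(1)[of 0] in simp)
      then show ?thesis by auto
    qed auto
  qed
  then obtain w where w: "\<And>i j. i < n \<Longrightarrow> j < n \<Longrightarrow> w i j \<in> V"
    "\<And>i j k. i < n \<Longrightarrow> j < n \<Longrightarrow> op_norm K (s k i j - w i j) \<le> 4 * \<delta> 0 / 2 ^ k"
    by metis
  have wV: "w \<in> mats n V" using w by (auto simp: mats_def)
  have close: "cmod (pair n (s k) c - pair n w c) \<le> (\<Sum>i<n. \<Sum>j<n. op_norm H (c i j)) * (4 * \<delta> 0 / 2 ^ k)"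
    if "c \<in> mats n X" for c k
    using sV wV that w(2) by (rule pair_diff_le)
  have "Re (pair n w x) < 0"
  proof -
    have "s 0 = w0" using s(1)[of 0] by (simp add: P_def)
    then have "cmod (pair n w0 x - pair n w x) \<le> M * (4 * \<delta> 0)"
      using close[OF x(1), of 0] by (simp add: M_def)
    also have "\<dots> < 1" using M by (simp add: \<delta>_def field_simps)
    finally have "\<bar>Re (pair n w0 x - pair n w x)\<bar> < 1"
      using abs_Re_le_cmod le_less_trans by blast
    then show ?thesis using w0 by simp
  qed
  moreover have nonneg: "- 0 \<le> Re (pair n w c)" if c: "c \<in> acc_ball n" for c
  proof -
    define B where "B = (\<Sum>i<n. \<Sum>j<n. op_norm H (c i j)) * (4 * \<delta> 0) + \<delta> 0"
    have "- (B / 2 ^ k) \<le> Re (pair n w c)" for k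
    proof -
      have "Re (pair n (s k) c) > - \<delta> k" using s(1)[of k] c by (auto simp: P_def)
      moreover have "\<bar>Re (pair n (s k) c - pair n w c)\<bar> \<le> (\<Sum>i<n. \<Sum>j<n. op_norm H (c i j)) * (4 * \<delta> 0 / 2 ^ k)"
        using close[OF acc_ballD(1)[OF c]] abs_Re_le_cmod order_trans by blast
      moreover have "\<delta> k = \<delta> 0 / 2 ^ k" by (simp add: \<delta>_def)
      ultimately show ?thesis by (simp add: B_def add_divide_distrib)
    qed
    moreover have "(\<lambda>k. - (B / 2 ^ k)) \<longlonglongrightarrow> - 0"
      using tendsto_mult_right_zero[OF LIMSEQ_power_zero[of "1/2::real"], of B]
      by (intro tendsto_minus) (simp add: power_divide)
    ultimately show ?thesis by (intro LIMSEQ_le_const2) auto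
  qed
  moreover have "0 \<le> Re (pair n w c)" if c: "c \<in> mats n X" "H.accretive n c" for c
  proof -
    define \<mu> where "\<mu> = (\<Sum>i<n. \<Sum>j<n. op_norm H (c i j)) + 1"
    have cn: "op_norm H (c i j) \<ge> 0" if "i < n" "j < n" for i j
      using norm_nonneg(1)[OF matsD[OF c(1) that]] .
    have "op_norm H (c i j) \<le> \<mu>" if "i < n" "j < n" for i j
      using H.entry_norm_le_sum[OF mats_X_bd[OF c(1)] that] by (simp add: \<mu>_def)
    moreover have "\<mu> > 0" using cn unfolding \<mu>_def by (intro add_nonneg_pos sum_nonneg) auto
    ultimately show ?thesis
      using pair_ge_homogeneous[where n = n and w = w and a = 0 and c = c and \<mu> = \<mu>] nonneg c by auto
  qed
  ultimately show ?thesis using wV by blast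
qed

end

section \<open>Matrix states\<close>

lemma sum_swap4:
  "(\<Sum>i\<in>A. \<Sum>j\<in>B. \<Sum>a\<in>C. \<Sum>b\<in>D. g i j a b) = (\<Sum>a\<in>C. \<Sum>b\<in>D. \<Sum>i\<in>A. \<Sum>j\<in>B. g i j a b)"
proof -
  have "(\<Sum>i\<in>A. \<Sum>j\<in>B. \<Sum>a\<in>C. \<Sum>b\<in>D. g i j a b) = (\<Sum>i\<in>A. \<Sum>a\<in>C. \<Sum>j\<in>B. \<Sum>b\<in>D. g i j a b)"
    by (intro sum.cong refl sum.swap)
  also have "\<dots> = (\<Sum>a\<in>C. \<Sum>i\<in>A. \<Sum>j\<in>B. \<Sum>b\<in>D. g i j a b)"
    by (rule sum.swap)
  also have "\<dots> = (\<Sum>a\<in>C. \<Sum>i\<in>A. \<Sum>b\<in>D. \<Sum>j\<in>B. g i j a b)"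
    by (intro sum.cong refl sum.swap)
  also have "\<dots> = (\<Sum>a\<in>C. \<Sum>b\<in>D. \<Sum>i\<in>A. \<Sum>j\<in>B. g i j a b)"
    by (intro sum.cong refl sum.swap)
  finally show ?thesis .
qed

subsection \<open>Orthonormalization for a semi-inner product\<close>

locale semi_inner_product =
  fixes U :: "'a::complex_vector \<Rightarrow> 'a \<Rightarrow> complex"
  assumes add_left: "U (x + y) z = U x z + U y z"
    and scale_left: "U (c *\<^sub>C x) z = c * U x z"
    and hermitian: "U y x = cnj (U x y)"
    and nonneg: "Re (U x x) \<ge> 0"
begin

lemma add_right: "U z (x + y) = U z x + U z y"
  using hermitian[of z "x + y"] hermitian[of z x] hermitian[of z y] by (simp add: add_left)

lemma scale_right: "U z (c *\<^sub>C x) = cnj c * U z x"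
  using hermitian[of z "c *\<^sub>C x"] hermitian[of z x] by (simp add: scale_left)

lemma zero_left [simp]: "U 0 z = 0"
  using scale_left[of 0 0 z] by simp

lemma sum_left: "U (\<Sum>i\<in>I. f i) z = (\<Sum>i\<in>I. U (f i) z)"
  by (induction I rule: infinite_finite_induct) (simp_all add: add_left)

lemma diff_left: "U (x - y) z = U x z - U y z"
  using add_left[of "x - y" y z] by simp

lemma self_real: "U x x = of_real (Re (U x x))"
  using arg_cong[OF hermitian[of x x], of Im] by (simp add: complex_eq_iff)

text \<open>The Cauchy--Schwarz inequality for a null vector: otherwise the form would be negative at a suitable
  \<open>c *\<^sub>C z + y\<close>.\<close>

lemma null_left:
  assumes z: "Re (U z z) = 0"
  shows "U z y = 0"
proof (rule ccontr)
  assume "U z y \<noteq> 0"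
  define p where "p = (cmod (U z y))\<^sup>2"
  have p: "p > 0" using \<open>U z y \<noteq> 0\<close> by (simp add: p_def)
  define t where "t = - (Re (U y y) + 1) / (2 * p)"
  define c where "c = of_real t * cnj (U z y)"
  have "U (c *\<^sub>C z + y) (c *\<^sub>C z + y) = c * cnj c * U z z + c * U z y + cnj (c * U z y) + U y y"
    using hermitian[of y z] by (simp add: add_left add_right scale_left scale_right algebra_simps)
  moreover have "U z z = 0" using self_real[of z] z by simp
  moreover have "c * U z y = of_real (t * p)"
  proof -
    have "cnj (U z y) * U z y = of_real p"
      using complex_norm_square[of "U z y"] by (simp add: p_def mult.commute)
    then show ?thesis by (simp add: c_def mult.assoc)
  qed
  ultimately have "Re (U (c *\<^sub>C z + y) (c *\<^sub>C z + y)) = 2 * (t * p) + Re (U y y)" by simp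
  also have "t * p = - (Re (U y y) + 1) / 2" using p by (simp add: t_def)
  also have "2 * (- (R + 1) / 2) + R < 0" for R :: real by (simp add: field_simps)
  finally have "Re (U (c *\<^sub>C z + y) (c *\<^sub>C z + y)) < 0" .
  then show False using nonneg[of "c *\<^sub>C z + y"] by simp
qed

definition residual :: "nat \<Rightarrow> (nat \<Rightarrow> 'a) \<Rightarrow> 'a \<Rightarrow> 'a" where
  "residual k e x = x - (\<Sum>a<k. U x (e a) *\<^sub>C e a)"

text \<open>The Gram--Schmidt process, in which a vector is dropped if its component orthogonal to the
  earlier ones is a null vector.  So the residuals of the given vectors need not vanish, but they are null.\<close>

lemma orthonormalization:
  "\<exists>(k::nat) e. (\<forall>a<k. \<forall>b<k. U (e a) (e b) = (if a = b then 1 else 0)) \<and>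
    (\<forall>i<N::nat. Re (U (residual k e (d i)) (residual k e (d i))) = 0)"
proof (induction N)
  case 0
  show ?case by (intro exI[of _ 0]) simp
next
  case (Suc N)
  then obtain k e where e: "\<And>a b. a < k \<Longrightarrow> b < k \<Longrightarrow> U (e a) (e b) = (if a = b then 1 else 0)"
    and null: "\<And>i. i < N \<Longrightarrow> Re (U (residual k e (d i)) (residual k e (d i))) = 0"
    by blast
  define r where "r = d N - (\<Sum>a<k. U (d N) (e a) *\<^sub>C e a)"
  show ?case
  proof (cases "Re (U r r) = 0")
    case True
    then show ?thesis
      using e null
      by (intro exI[of _ k] exI[of _ e]) (auto simp: less_Suc_eq r_def residual_def[of k e "d N"])
  next
    case False
    define q where "q = sqrt (Re (U r r))"
    have q: "q > 0" "q * q = Re (U r r)" using False nonneg[of r] by (auto simp: q_def)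
    define f where "f = e(k := complex_of_real (1 / q) *\<^sub>C r)"
    have fe: "f a = e a" if "a < k" for a using that by (simp add: f_def)
    have fk: "f k = complex_of_real (1 / q) *\<^sub>C r" by (simp add: f_def)
    have r_e: "U r (e a) = 0" if "a < k" for a
    proof -
      have "U (\<Sum>b<k. U (d N) (e b) *\<^sub>C e b) (e a) = (\<Sum>b<k. if b = a then U (d N) (e b) else 0)"
        unfolding sum_left scale_left using e that by (intro sum.cong refl) auto
      then show ?thesis using that by (simp add: r_def diff_left)
    qed
    have e_r: "U (e a) r = 0" if "a < k" for a using hermitian[of r "e a"] r_e[OF that] by simp
    have U_rr: "U r r = of_real (q * q)" using self_real[of r] q(2) by simp
    have f: "U (f a) (f b) = (if a = b then 1 else 0)" if "a < Suc k" "b < Suc k" for a b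
    proof -
      have "U (f k) (f k) = 1" using U_rr q(1) by (simp add: fk scale_left scale_right)
      then show ?thesis
        using that e r_e e_r by (auto simp: less_Suc_eq fe fk scale_left scale_right)
    qed
    have "Re (U s s) = 0" if i: "i < Suc N" and s: "s = d i - (\<Sum>a<Suc k. U (d i) (f a) *\<^sub>C f a)" for i s
    proof (cases "i = N")
      case True
      have "U (d N) r = U r r"
      proof -
        have "d N = r + (\<Sum>a<k. U (d N) (e a) *\<^sub>C e a)" by (simp add: r_def)
        then have "U (d N) r = U (r + (\<Sum>a<k. U (d N) (e a) *\<^sub>C e a)) r" by simp
        also have "\<dots> = U r r" by (simp add: add_left sum_left scale_left e_r)
        finally show ?thesis .
      qed
      then have "U (d N) (f k) = of_real q" using U_rr q(1) by (simp add: fk scale_right)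
      then have "U (d N) (f k) *\<^sub>C f k = r" using q(1) by (simp add: fk scaleC_scaleC scaleC_one)
      then have "s = 0" using s True by (simp add: fe r_def)
      then show ?thesis by simp
    next
      case False
      then have i: "i < N" using i by simp
      define t where "t = d i - (\<Sum>a<k. U (d i) (e a) *\<^sub>C e a)"
      have t: "Re (U t t) = 0" using null[OF i] by (simp add: t_def residual_def)
      have "d i = t + (\<Sum>a<k. U (d i) (e a) *\<^sub>C e a)" by (simp add: t_def)
      then have "U (d i) r = U (t + (\<Sum>a<k. U (d i) (e a) *\<^sub>C e a)) r" by simp
      also have "\<dots> = 0" using null_left[OF t] by (simp add: add_left sum_left scale_left e_r)
      finally have "U (d i) (f k) = 0" by (simp add: fk scale_right)
      then have "s = t" using s by (simp add: fe t_def)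
      then show ?thesis using t by simp
    qed
    then show ?thesis
      using f by (intro exI[of _ "Suc k"] exI[of _ f]) (simp add: residual_def del: sum.lessThan_Suc)
  qed
qed

end

subsection \<open>Completely accretive maps into matrices\<close>

context dual_unital_operator_space
begin

text \<open>The form at \<open>\<zeta>\<close> of the matrix that results from applying \<open>\<phi>\<close> to the entries of \<open>c\<close>.\<close>

definition amp :: "nat \<Rightarrow> nat \<Rightarrow> (('h \<Rightarrow> 'h) \<Rightarrow> nat \<Rightarrow> nat \<Rightarrow> complex) \<Rightarrow>
    (nat \<Rightarrow> nat \<Rightarrow> 'h \<Rightarrow> 'h) \<Rightarrow> (nat \<Rightarrow> nat \<Rightarrow> complex) \<Rightarrow> complex" where
  "amp m k \<phi> c \<zeta> = (\<Sum>i<m. \<Sum>j<m. \<Sum>a<k. \<Sum>b<k. \<phi> (c i j) a b * \<zeta> j b * cnj (\<zeta> i a))"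

text \<open>The maps from \<open>X\<close> to the \<open>k \<times> k\<close> matrices that are weak* continuous, unital and completely accretive;
  the unital completely accretive maps are those with a completely positive extension to the selfadjoint
  space spanned by \<open>X\<close> and the adjoints.\<close>

definition states :: "(nat \<times> (('h \<Rightarrow> 'h) \<Rightarrow> nat \<Rightarrow> nat \<Rightarrow> complex)) set" where
  "states = {(k, \<phi>).
     (\<exists>w\<in>mats k V. \<forall>x\<in>X. \<forall>a<k. \<forall>b<k. \<phi> x a b = T x (w a b)) \<and>
     (\<forall>a<k. \<forall>b<k. \<phi> (id_op H) a b = (if a = b then 1 else 0)) \<and>
     (\<forall>m. \<forall>c\<in>mats m X. H.accretive m c \<longrightarrow> (\<forall>\<zeta>. 0 \<le> Re (amp m k \<phi> c \<zeta>)))}"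

definition sesq :: "nat \<Rightarrow> (nat \<Rightarrow> nat \<Rightarrow> 'k \<Rightarrow> 'k) \<Rightarrow> ('h \<Rightarrow> 'h) \<Rightarrow> (nat \<Rightarrow> complex) \<Rightarrow> (nat \<Rightarrow> complex) \<Rightarrow> complex" where
  "sesq n w x \<zeta> \<eta> = (\<Sum>a<n. \<Sum>b<n. T x (w a b) * \<zeta> b * cnj (\<eta> a))"

lemma sesq_add_left: "sesq n w x (\<zeta> + \<zeta>') \<eta> = sesq n w x \<zeta> \<eta> + sesq n w x \<zeta>' \<eta>"
  by (simp add: sesq_def algebra_simps sum.distrib)

lemma sesq_scale_left: "sesq n w x (c *\<^sub>C \<zeta>) \<eta> = c * sesq n w x \<zeta> \<eta>"
  by (simp add: sesq_def scaleC_fun_def scaleC_complex_def sum_distrib_left mult_ac)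

lemma sesq_add_right: "sesq n w x \<zeta> (\<eta> + \<eta>') = sesq n w x \<zeta> \<eta> + sesq n w x \<zeta> \<eta>'"
  by (simp add: sesq_def algebra_simps sum.distrib)

lemma sesq_scale_right: "sesq n w x \<zeta> (c *\<^sub>C \<eta>) = cnj c * sesq n w x \<zeta> \<eta>"
  by (simp add: sesq_def scaleC_fun_def scaleC_complex_def sum_distrib_left mult_ac)

lemma sesq_zero: "sesq n w x 0 \<eta> = 0" "sesq n w x \<zeta> 0 = 0"
  by (simp_all add: sesq_def)

lemma sesq_sum_left: "sesq n w x (\<Sum>i\<in>I. f i) \<eta> = (\<Sum>i\<in>I. sesq n w x (f i) \<eta>)"
  by (induction I rule: infinite_finite_induct) (simp_all only: sum.infinite sum.empty sum.insert sesq_add_left sesq_zero not_False_eq_True)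

lemma sesq_sum_right: "sesq n w x \<zeta> (\<Sum>i\<in>I. f i) = (\<Sum>i\<in>I. sesq n w x \<zeta> (f i))"
  by (induction I rule: infinite_finite_induct) (simp_all only: sum.infinite sum.empty sum.insert sesq_add_right sesq_zero not_False_eq_True)

lemma sesq_op_scale: "x \<in> X \<Longrightarrow> sesq n w (c *\<^sub>C x) \<zeta> \<eta> = c * sesq n w x \<zeta> \<eta>"
  by (simp add: sesq_def T_scale sum_distrib_left mult_ac)

lemma sesq_op_zero: "sesq n w 0 \<zeta> \<eta> = 0"
  by (simp add: sesq_def T_zero)

text \<open>\<open>\<zeta>\<^sup>* c \<zeta>\<close> is accretive if \<open>c\<close> is, which turns positivity of a functional on matrices into
  complete accretivity of the matrix-valued map that has the same entries.\<close>

lemma sesq_accretive: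
  assumes w: "w \<in> mats n V" and pos: "\<And>c. c \<in> mats n X \<Longrightarrow> H.accretive n c \<Longrightarrow> 0 \<le> Re (pair n w c)"
    and c: "c \<in> mats m X" "H.accretive m c"
  shows "0 \<le> Re (\<Sum>i<m. \<Sum>j<m. sesq n w (c i j) (\<zeta> j) (\<zeta> i))"
proof -
  define d where "d a b = (\<Sum>i<m. \<Sum>j<m. (\<zeta> j b * cnj (\<zeta> i a)) *\<^sub>C c i j)" for a b
  have cX: "c i j \<in> X" if "i < m" "j < m" for i j using c that by (auto simp: mats_def)
  have dX: "d \<in> mats n X"
    unfolding mats_def d_def using cX by (auto intro!: X_sum X_scale)
  have "H.accretive n d"
    unfolding H.accretive_def
  proof (intro allI impI)
    fix \<xi> assume \<xi>: "\<forall>i<n. \<xi> i \<in> hcarrier H"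
    define \<xi>' where "\<xi>' j = (\<Sum>b<n. \<zeta> j b *\<^sub>C \<xi> b)" for j
    have \<xi>': "\<xi>' j \<in> hcarrier H" for j unfolding \<xi>'_def using \<xi> by (intro H.sum_in H.scaleC_in) auto
    have in_H: "c i j (\<xi> b) \<in> hcarrier H" if "i < m" "j < m" "b < n" for i j b
      using H.bounded_opsD(2)[OF X_bd[OF cX[OF that(1,2)]]] \<xi> that by auto
    have "H.form {..<m} c \<xi>' \<xi>' = (\<Sum>i<m. \<Sum>j<m. \<Sum>a<n. \<Sum>b<n. \<zeta> j b * cnj (\<zeta> i a) * hinner H (c i j (\<xi> b)) (\<xi> a))"
      unfolding H.form_def
    proof (intro sum.cong refl)
      fix i j assume ij: "i \<in> {..<m}" "j \<in> {..<m}"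
      have lin: "clinear_on (hcarrier H) (c i j)" using H.bounded_opsD(1)[OF X_bd[OF cX]] ij by auto
      have "c i j (\<xi>' j) = (\<Sum>b<n. c i j (\<zeta> j b *\<^sub>C \<xi> b))"
        unfolding \<xi>'_def using \<xi> by (intro clinear_on_sum[OF lin H.subspace] H.scaleC_in) auto
      also have "\<dots> = (\<Sum>b<n. \<zeta> j b *\<^sub>C c i j (\<xi> b))"
        using \<xi> by (intro sum.cong refl clinear_on_scaleC[OF lin]) auto
      finally have "hinner H (c i j (\<xi>' j)) (\<xi>' i) = hinner H (\<Sum>b<n. \<zeta> j b *\<^sub>C c i j (\<xi> b)) (\<Sum>a<n. \<zeta> i a *\<^sub>C \<xi> a)"
        by (simp add: \<xi>'_def)
      also have "\<dots> = (\<Sum>a<n. hinner H (\<Sum>b<n. \<zeta> j b *\<^sub>C c i j (\<xi> b)) (\<zeta> i a *\<^sub>C \<xi> a))"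
        using \<xi> ij in_H by (intro H.inner_sum_right H.scaleC_in H.sum_in) auto
      also have "\<dots> = (\<Sum>a<n. \<Sum>b<n. hinner H (\<zeta> j b *\<^sub>C c i j (\<xi> b)) (\<zeta> i a *\<^sub>C \<xi> a))"
        using \<xi> ij in_H by (intro sum.cong refl H.inner_sum_left H.scaleC_in) auto
      also have "\<dots> = (\<Sum>a<n. \<Sum>b<n. \<zeta> j b * cnj (\<zeta> i a) * hinner H (c i j (\<xi> b)) (\<xi> a))"
        using \<xi> ij in_H by (intro sum.cong refl) (simp add: H.inner_scaleC_left H.inner_scaleC_right)
      finally show "hinner H (c i j (\<xi>' j)) (\<xi>' i) = \<dots>" .
    qed
    also have "\<dots> = (\<Sum>a<n. \<Sum>b<n. \<Sum>i<m. \<Sum>j<m. \<zeta> j b * cnj (\<zeta> i a) * hinner H (c i j (\<xi> b)) (\<xi> a))"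
      by (rule sum_swap4)
    also have "\<dots> = H.form {..<n} d \<xi> \<xi>"
      unfolding H.form_def
    proof (intro sum.cong refl)
      fix a b assume ab: "a \<in> {..<n}" "b \<in> {..<n}"
      have "d a b (\<xi> b) = (\<Sum>i<m. \<Sum>j<m. (\<zeta> j b * cnj (\<zeta> i a)) *\<^sub>C c i j (\<xi> b))"
        by (simp add: d_def sum_fun_apply scaleC_fun_def)
      also have "hinner H \<dots> (\<xi> a) = (\<Sum>i<m. hinner H (\<Sum>j<m. (\<zeta> j b * cnj (\<zeta> i a)) *\<^sub>C c i j (\<xi> b)) (\<xi> a))"
        using \<xi> ab in_H by (intro H.inner_sum_left H.scaleC_in H.sum_in) auto
      also have "\<dots> = (\<Sum>i<m. \<Sum>j<m. hinner H ((\<zeta> j b * cnj (\<zeta> i a)) *\<^sub>C c i j (\<xi> b)) (\<xi> a))"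
        using \<xi> ab in_H by (intro sum.cong refl H.inner_sum_left H.scaleC_in) auto
      also have "\<dots> = (\<Sum>i<m. \<Sum>j<m. \<zeta> j b * cnj (\<zeta> i a) * hinner H (c i j (\<xi> b)) (\<xi> a))"
        using \<xi> ab in_H by (intro sum.cong refl H.inner_scaleC_left) auto
      finally show "(\<Sum>i<m. \<Sum>j<m. \<zeta> j b * cnj (\<zeta> i a) * hinner H (c i j (\<xi> b)) (\<xi> a)) = hinner H (d a b (\<xi> b)) (\<xi> a)"
        by (rule sym)
    qed
    finally have "H.form {..<n} d \<xi> \<xi> = H.form {..<m} c \<xi>' \<xi>'" by (rule sym)
    then show "0 \<le> Re (H.form {..<n} d \<xi> \<xi>)" using c(2) \<xi>' by (simp add: H.accretive_def)
  qed
  from pos[OF dX this] have "0 \<le> Re (pair n w d)" .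
  also have "pair n w d = (\<Sum>a<n. \<Sum>b<n. \<Sum>i<m. \<Sum>j<m. T (c i j) (w a b) * \<zeta> j b * cnj (\<zeta> i a))"
    unfolding pair_def
  proof (intro sum.cong refl)
    fix a b
    have "T (d a b) (w a b) = (\<Sum>i<m. T (\<Sum>j<m. (\<zeta> j b * cnj (\<zeta> i a)) *\<^sub>C c i j) (w a b))"
      unfolding d_def using cX by (intro T_sum X_sum X_scale) auto
    also have "\<dots> = (\<Sum>i<m. \<Sum>j<m. T ((\<zeta> j b * cnj (\<zeta> i a)) *\<^sub>C c i j) (w a b))"
      using cX by (intro sum.cong refl T_sum X_scale) auto
    also have "\<dots> = (\<Sum>i<m. \<Sum>j<m. T (c i j) (w a b) * \<zeta> j b * cnj (\<zeta> i a))"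
      using cX by (intro sum.cong refl) (simp add: T_scale)
    finally show "T (d a b) (w a b) = \<dots>" .
  qed
  also have "\<dots> = (\<Sum>i<m. \<Sum>j<m. sesq n w (c i j) (\<zeta> j) (\<zeta> i))"
    unfolding sesq_def by (rule sum_swap4)
  finally show ?thesis .
qed

lemma amp_sesq:
  assumes c: "c \<in> mats m X" and \<phi>: "\<And>x a b. x \<in> X \<Longrightarrow> a < k \<Longrightarrow> b < k \<Longrightarrow> \<phi> x a b = sesq n w x (e b) (e a)"
  shows "amp m k \<phi> c \<zeta> = (\<Sum>i<m. \<Sum>j<m. sesq n w (c i j) (\<Sum>b<k. \<zeta> j b *\<^sub>C e b) (\<Sum>a<k. \<zeta> i a *\<^sub>C e a))"
  unfolding amp_def
proof (intro sum.cong refl)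
  fix i j assume ij: "i \<in> {..<m}" "j \<in> {..<m}"
  have "sesq n w (c i j) (\<Sum>b<k. \<zeta> j b *\<^sub>C e b) (\<Sum>a<k. \<zeta> i a *\<^sub>C e a)
      = (\<Sum>a<k. \<Sum>b<k. \<zeta> j b * (cnj (\<zeta> i a) * sesq n w (c i j) (e b) (e a)))"
    unfolding sesq_sum_right sesq_sum_left sesq_scale_left sesq_scale_right
    by (intro sum.cong refl) (simp add: sum_distrib_left mult_ac)
  also have "\<dots> = (\<Sum>a<k. \<Sum>b<k. \<phi> (c i j) a b * \<zeta> j b * cnj (\<zeta> i a))"
    using ij c by (intro sum.cong refl) (simp add: \<phi> matsD mult_ac)
  finally show "(\<Sum>a<k. \<Sum>b<k. \<phi> (c i j) a b * \<zeta> j b * cnj (\<zeta> i a))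
    = sesq n w (c i j) (\<Sum>b<k. \<zeta> j b *\<^sub>C e b) (\<Sum>a<k. \<zeta> i a *\<^sub>C e a)" by (rule sym)
qed

text \<open>In applications, a form is bounded above along the multiples of a null vector.\<close>

lemma zero_if_multiples_bounded:
  assumes "\<And>t::real. 2 * Re (complex_of_real t * (cnj z * z)) \<le> B"
  shows "z = 0"
proof (rule ccontr)
  assume "z \<noteq> 0"
  then have p: "(cmod z)\<^sup>2 > 0" by simp
  have "cnj z * z = of_real ((cmod z)\<^sup>2)"
    using complex_norm_square[of z] by (simp add: mult.commute)
  then have "2 * (t * (cmod z)\<^sup>2) \<le> B" for t
    using assms[of t] by (simp only: of_real_mult[symmetric] Re_complex_of_real)
  from this[of "(B + 1) / (2 * (cmod z)\<^sup>2)"] show False using p by simp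
qed

text \<open>A separating functional yields a completely accretive map to matrices, which need not be unital.
  Its value \<open>U\<close> at the unit is a positive semidefinite form.  If \<open>e\<close> is an orthonormal basis for \<open>U\<close> modulo
  null vectors, the compression to \<open>e\<close> is unital.  The compression loses no information, since the null
  vectors of \<open>U\<close> are null vectors for all values of the map; this follows from the accretivity of
  the block matrices, which bounds the map by \<open>U\<close> (\<open>contr\<close>).\<close>

lemma matrix_state_detects:
  assumes x: "x \<in> mats n X" "\<not> H.accretive n x"
  shows "\<exists>(k, \<phi>)\<in>states. \<exists>\<zeta>. Re (amp n k \<phi> x \<zeta>) < 0"
proof -
  obtain w where w: "w \<in> mats n V" and pos: "\<And>c. c \<in> mats n X \<Longrightarrow> H.accretive n c \<Longrightarrow> 0 \<le> Re (pair n w c)"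
    and neg: "Re (pair n w x) < 0" using weakstar_separation[OF x] by blast
  define F where "F y \<zeta> \<eta> = sesq n w y \<zeta> \<eta>" for y \<zeta> \<eta>
  have F_pos: "0 \<le> Re (\<Sum>i<m. \<Sum>j<m. F (c i j) (\<zeta> j) (\<zeta> i))" if "c \<in> mats m X" "H.accretive m c" for m c \<zeta>
    unfolding F_def using sesq_accretive[OF w pos that] .
  define U where "U = F (id_op H)"
  have scalar: "0 \<le> Re (c * U \<zeta> \<zeta>)" if "Re c \<ge> 0" for c \<zeta>
  proof -
    have "(\<lambda>_ _. c *\<^sub>C id_op H) \<in> mats 1 X" using id_in X_scale by (simp add: mats_def)
    moreover have "H.accretive 1 (\<lambda>_ _. c *\<^sub>C id_op H)"
      using that by (auto simp: H.accretive_def H.form_def H.lessThan_1 scaleC_fun_def H.inner_scaleC_left H.inner_self)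
    ultimately have "0 \<le> Re (\<Sum>i<1::nat. \<Sum>j<1::nat. F (c *\<^sub>C id_op H) \<zeta> \<zeta>)"
      using F_pos[of "\<lambda>_ _. c *\<^sub>C id_op H" 1 "\<lambda>_. \<zeta>"] by simp
    then show ?thesis using id_in by (simp add: F_def U_def sesq_op_scale)
  qed
  \<comment> \<open>Both \<open>\<i>\<close> and \<open>- \<i>\<close> times the unit are accretive.\<close>
  have U_real: "Im (U \<zeta> \<zeta>) = 0" for \<zeta>
    using scalar[of \<i> \<zeta>] scalar[of "- \<i>" \<zeta>] by simp
  interpret U: semi_inner_product U
  proof
    fix \<zeta> \<eta> \<theta> :: "nat \<Rightarrow> complex" and c
    show "U (\<zeta> + \<eta>) \<theta> = U \<zeta> \<theta> + U \<eta> \<theta>" unfolding U_def F_def by (rule sesq_add_left)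
    show "U (c *\<^sub>C \<zeta>) \<eta> = c * U \<zeta> \<eta>" unfolding U_def F_def by (rule sesq_scale_left)
    show "0 \<le> Re (U \<zeta> \<zeta>)" using scalar[of 1 \<zeta>] by simp
    have 1: "U (\<zeta> + \<eta>) (\<zeta> + \<eta>) = U \<zeta> \<zeta> + U \<zeta> \<eta> + U \<eta> \<zeta> + U \<eta> \<eta>"
      unfolding U_def F_def sesq_add_left sesq_add_right by simp
    have 2: "U (\<zeta> + \<i> *\<^sub>C \<eta>) (\<zeta> + \<i> *\<^sub>C \<eta>) = U \<zeta> \<zeta> - \<i> * U \<zeta> \<eta> + \<i> * U \<eta> \<zeta> + U \<eta> \<eta>"
      unfolding U_def F_def sesq_add_left sesq_add_right sesq_scale_left sesq_scale_right
      by (simp add: complex_eq_iff)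
    have "Im (U \<zeta> \<eta>) + Im (U \<eta> \<zeta>) = 0"
      using U_real[of "\<zeta> + \<eta>"] U_real[of \<zeta>] U_real[of \<eta>] unfolding 1 by simp
    moreover have "Re (U \<eta> \<zeta>) - Re (U \<zeta> \<eta>) = 0"
      using U_real[of "\<zeta> + \<i> *\<^sub>C \<eta>"] U_real[of \<zeta>] U_real[of \<eta>] unfolding 2 by simp
    ultimately show "U \<eta> \<zeta> = cnj (U \<zeta> \<eta>)" by (simp add: complex_eq_iff)
  qed
  have contr: "2 * Re (F y \<zeta> \<eta>) \<le> s * (Re (U \<zeta> \<zeta>) + Re (U \<eta> \<eta>))"
    if y: "y \<in> X" and s: "s > 0" "op_norm H y \<le> s" for y s \<zeta> \<eta>
  proof -
    have yX: "(\<lambda>_ _. y) \<in> mats 1 X" using y by (simp add: mats_def)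
    have "H.accretive (1 + 1) (H.block 1 s (\<lambda>_ _. y))"
      using H.norm_le_iff_accretive_block[OF mats_X_bd[OF yX] s(1)] s(2) by (simp add: op_norm_def)
    then have "0 \<le> Re (\<Sum>i<1 + 1. \<Sum>j<1 + 1. F (H.block 1 s (\<lambda>_ _. y) i j) (if j = 0 then \<eta> else \<zeta>) (if i = 0 then \<eta> else \<zeta>))"
      using F_pos[OF H.block_in[OF yX X_csub id_in], of s "\<lambda>i. if i = 0 then \<eta> else \<zeta>"] by simp
    also have "(\<Sum>i<1 + 1. \<Sum>j<1 + 1. F (H.block 1 s (\<lambda>_ _. y) i j) (if j = 0 then \<eta> else \<zeta>) (if i = 0 then \<eta> else \<zeta>))
      = F (of_real s *\<^sub>C id_op H) \<eta> \<eta> + F ((-2) *\<^sub>C y) \<zeta> \<eta> + F (of_real s *\<^sub>C id_op H) \<zeta> \<zeta>"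
      by (simp add: lessThan_Suc H.block_def F_def sesq_op_zero del: complex_vector.scale_minus_left)
    also have "\<dots> = of_real s * U \<eta> \<eta> + (-2) * F y \<zeta> \<eta> + of_real s * U \<zeta> \<zeta>"
      unfolding U_def F_def sesq_op_scale[OF id_in] sesq_op_scale[OF y] ..
    finally show ?thesis by (simp add: algebra_simps)
  qed
  have bound: "\<exists>s>0. op_norm H y \<le> s" for y by (intro exI[of _ "\<bar>op_norm H y\<bar> + 1"]) auto
  have null_left: "F y z \<eta> = 0" if y: "y \<in> X" and z: "Re (U z z) = 0" for y z \<eta>
  proof -
    obtain s where s: "s > 0" "op_norm H y \<le> s" using bound by blast
    show ?thesis
    proof (rule zero_if_multiples_bounded)
      fix t :: real
      let ?c = "complex_of_real t * cnj (F y z \<eta>)"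
      have "Re (U (?c *\<^sub>C z) (?c *\<^sub>C z)) = 0"
        using U.null_left[OF z] by (simp only: U.scale_left mult_zero_right zero_complex.sel)
      then have "2 * Re (F y (?c *\<^sub>C z) \<eta>) \<le> s * Re (U \<eta> \<eta>)"
        using contr[OF y s, of "?c *\<^sub>C z" \<eta>] by simp
      moreover have "F y (?c *\<^sub>C z) \<eta> = complex_of_real t * (cnj (F y z \<eta>) * F y z \<eta>)"
        unfolding F_def sesq_scale_left by (simp add: mult.assoc)
      ultimately show "2 * Re (complex_of_real t * (cnj (F y z \<eta>) * F y z \<eta>)) \<le> s * Re (U \<eta> \<eta>)" by simp
    qed
  qed
  have null_right: "F y \<eta> z = 0" if y: "y \<in> X" and z: "Re (U z z) = 0" for y z \<eta>
  proof -
    obtain s where s: "s > 0" "op_norm H y \<le> s" using bound by blast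
    show ?thesis
    proof (rule zero_if_multiples_bounded)
      fix t :: real
      let ?c = "complex_of_real t * F y \<eta> z"
      have "Re (U (?c *\<^sub>C z) (?c *\<^sub>C z)) = 0"
        using U.null_left[OF z] by (simp only: U.scale_left mult_zero_right zero_complex.sel)
      then have "2 * Re (F y \<eta> (?c *\<^sub>C z)) \<le> s * Re (U \<eta> \<eta>)"
        using contr[OF y s, of \<eta> "?c *\<^sub>C z"] by simp
      moreover have "F y \<eta> (?c *\<^sub>C z) = complex_of_real t * (cnj (F y \<eta> z) * F y \<eta> z)"
        unfolding F_def sesq_scale_right by (simp add: mult.assoc)
      ultimately show "2 * Re (complex_of_real t * (cnj (F y \<eta> z) * F y \<eta> z)) \<le> s * Re (U \<eta> \<eta>)" by simp
    qed
  qed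
  define d :: "nat \<Rightarrow> nat \<Rightarrow> complex" where "d i = (\<lambda>b. if b = i then 1 else 0)" for i
  obtain k e where e: "\<And>a b. a < k \<Longrightarrow> b < k \<Longrightarrow> U (e a) (e b) = (if a = b then 1 else 0)"
    and null: "\<And>i. i < n \<Longrightarrow> Re (U (U.residual k e (d i)) (U.residual k e (d i))) = 0"
    using U.orthonormalization[of n d] by blast
  define \<phi> where "\<phi> y a b = sesq n w y (e b) (e a)" for y a b
  have in_states: "(k, \<phi>) \<in> states"
    unfolding states_def mem_Collect_eq prod.case
  proof (intro conjI)
    define w' where "w' a b = (\<Sum>c<n. \<Sum>d<n. (e b d * cnj (e a c)) *\<^sub>C w c d)" for a b
    have wV: "w c d \<in> V" if "c < n" "d < n" for c d using w that by (auto simp: mats_def)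
    have "w' \<in> mats k V" unfolding mats_def w'_def using wV by (auto intro!: V_sum V_scale)
    moreover have "\<phi> y a b = T y (w' a b)" if y: "y \<in> X" for y a b
    proof -
      have "T y (w' a b) = (\<Sum>c<n. T y (\<Sum>d<n. (e b d * cnj (e a c)) *\<^sub>C w c d))"
        unfolding w'_def using wV y by (intro T_sum_right V_sum V_scale) auto
      also have "\<dots> = (\<Sum>c<n. \<Sum>d<n. T y ((e b d * cnj (e a c)) *\<^sub>C w c d))"
        using wV y by (intro sum.cong refl T_sum_right V_scale) auto
      also have "\<dots> = \<phi> y a b"
        unfolding \<phi>_def sesq_def using wV y by (intro sum.cong refl) (simp add: T_scale_right mult_ac)
      finally show ?thesis by (rule sym)
    qed
    ultimately show "\<exists>w\<in>mats k V. \<forall>x\<in>X. \<forall>a<k. \<forall>b<k. \<phi> x a b = T x (w a b)" by blast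
    show "\<forall>a<k. \<forall>b<k. \<phi> (id_op H) a b = (if a = b then 1 else 0)"
      using e by (auto simp: \<phi>_def U_def F_def)
    show "\<forall>m. \<forall>c\<in>mats m X. H.accretive m c \<longrightarrow> (\<forall>\<zeta>. 0 \<le> Re (amp m k \<phi> c \<zeta>))"
    proof (intro allI ballI impI)
      fix m c \<zeta> assume c: "c \<in> mats m X" "H.accretive m c"
      have "amp m k \<phi> c \<zeta> = (\<Sum>i<m. \<Sum>j<m. F (c i j) (\<Sum>b<k. \<zeta> j b *\<^sub>C e b) (\<Sum>a<k. \<zeta> i a *\<^sub>C e a))"
        unfolding F_def by (rule amp_sesq[OF c(1)]) (simp add: \<phi>_def)
      then show "0 \<le> Re (amp m k \<phi> c \<zeta>)" using F_pos[OF c, of "\<lambda>i. \<Sum>a<k. \<zeta> i a *\<^sub>C e a"] by simp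
    qed
  qed
  define \<zeta> where "\<zeta> i a = U (d i) (e a)" for i a
  have "amp n k \<phi> x \<zeta> = (\<Sum>i<n. \<Sum>j<n. F (x i j) (\<Sum>b<k. \<zeta> j b *\<^sub>C e b) (\<Sum>a<k. \<zeta> i a *\<^sub>C e a))"
    unfolding F_def by (rule amp_sesq[OF x(1)]) (simp add: \<phi>_def)
  also have "\<dots> = (\<Sum>i<n. \<Sum>j<n. F (x i j) (d j) (d i))"
  proof (intro sum.cong refl)
    fix i j assume ij: "i \<in> {..<n}" "j \<in> {..<n}"
    then have xX: "x i j \<in> X" using x by (auto simp: mats_def)
    have split: "d i = (\<Sum>a<k. \<zeta> i a *\<^sub>C e a) + U.residual k e (d i)" for i
      by (simp add: \<zeta>_def U.residual_def)
    have "F (x i j) (d j) (d i) = F (x i j) ((\<Sum>a<k. \<zeta> j a *\<^sub>C e a) + U.residual k e (d j)) (d i)"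
      using split[of j] by simp
    also have "\<dots> = F (x i j) (\<Sum>a<k. \<zeta> j a *\<^sub>C e a) (d i) + F (x i j) (U.residual k e (d j)) (d i)"
      unfolding F_def by (rule sesq_add_left)
    also have "F (x i j) (U.residual k e (d j)) (d i) = 0" using ij by (intro null_left xX null) auto
    also have "F (x i j) (\<Sum>a<k. \<zeta> j a *\<^sub>C e a) (d i)
        = F (x i j) (\<Sum>a<k. \<zeta> j a *\<^sub>C e a) ((\<Sum>a<k. \<zeta> i a *\<^sub>C e a) + U.residual k e (d i))"
      using split[of i] by simp
    also have "\<dots> = F (x i j) (\<Sum>a<k. \<zeta> j a *\<^sub>C e a) (\<Sum>a<k. \<zeta> i a *\<^sub>C e a)
        + F (x i j) (\<Sum>a<k. \<zeta> j a *\<^sub>C e a) (U.residual k e (d i))"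
      unfolding F_def by (rule sesq_add_right)
    also have "F (x i j) (\<Sum>a<k. \<zeta> j a *\<^sub>C e a) (U.residual k e (d i)) = 0"
      using ij by (intro null_right xX null) auto
    finally show "F (x i j) (\<Sum>b<k. \<zeta> j b *\<^sub>C e b) (\<Sum>a<k. \<zeta> i a *\<^sub>C e a) = F (x i j) (d j) (d i)" by simp
  qed
  also have "\<dots> = pair n w x"
    unfolding pair_def
  proof (intro sum.cong refl)
    fix i j assume ij: "i \<in> {..<n}" "j \<in> {..<n}"
    have "F (x i j) (d j) (d i) = (\<Sum>a<n. \<Sum>b<n. if b = j then (if a = i then T (x i j) (w a b) else 0) else 0)"
      unfolding F_def sesq_def d_def by (intro sum.cong refl) auto
    also have "\<dots> = T (x i j) (w i j)" using ij by (simp add: sum.delta)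
    finally show "F (x i j) (d j) (d i) = T (x i j) (w i j)" .
  qed
  finally have "Re (amp n k \<phi> x \<zeta>) < 0" using neg by simp
  then show ?thesis using in_states by blast
qed

end

section \<open>The Hilbert space of square summable families\<close>

definition ell2 :: "'s set \<Rightarrow> ('s \<Rightarrow> complex) hspace" where
  "ell2 S = \<lparr>hcarrier = {f. (\<forall>s. s \<notin> S \<longrightarrow> f s = 0) \<and> (\<lambda>s. (cmod (f s))\<^sup>2) summable_on UNIV},
    hinner = (\<lambda>f g. \<Sum>\<^sub>\<infinity>s. f s * cnj (g s))\<rparr>"

lemma ell2_carrier_iff:
  "f \<in> hcarrier (ell2 S) \<longleftrightarrow> (\<forall>s. s \<notin> S \<longrightarrow> f s = 0) \<and> (\<lambda>s. (cmod (f s))\<^sup>2) summable_on UNIV"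
  by (simp add: ell2_def)

lemma ell2_inner: "hinner (ell2 S) f g = (\<Sum>\<^sub>\<infinity>s. f s * cnj (g s))"
  by (simp add: ell2_def)

lemma ell2_summable:
  "f \<in> hcarrier (ell2 S) \<Longrightarrow> (\<lambda>s. (cmod (f s))\<^sup>2) summable_on UNIV"
  "f \<in> hcarrier (ell2 S) \<Longrightarrow> s \<notin> S \<Longrightarrow> f s = 0"
  by (auto simp: ell2_carrier_iff)

lemma ell2_inner_summable:
  assumes "f \<in> hcarrier (ell2 S)" "g \<in> hcarrier (ell2 S)"
  shows "(\<lambda>s. f s * cnj (g s)) summable_on UNIV"
proof (rule abs_summable_summable, rule abs_summable_product)
  show "(\<lambda>s. norm (f s * f s)) summable_on UNIV"
    using ell2_summable(1)[OF assms(1)] by (simp add: norm_mult power2_eq_square)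
  show "(\<lambda>s. norm (cnj (g s) * cnj (g s))) summable_on UNIV"
    using ell2_summable(1)[OF assms(2)] by (simp add: norm_mult power2_eq_square)
qed

lemma ell2_inner_self:
  assumes "f \<in> hcarrier (ell2 S)"
  shows "hinner (ell2 S) f f = of_real (\<Sum>\<^sub>\<infinity>s. (cmod (f s))\<^sup>2)"
proof -
  have "(\<lambda>s. f s * cnj (f s)) = (\<lambda>s. of_real ((cmod (f s))\<^sup>2))"
    by (intro ext complex_norm_square[symmetric])
  then show ?thesis
    unfolding ell2_inner
    using infsumI[OF has_sum_of_real[OF has_sum_infsum[OF ell2_summable(1)[OF assms]]]] by simp
qed

lemma ell2_hnorm_sq:
  assumes "f \<in> hcarrier (ell2 S)"
  shows "(hnorm (ell2 S) f)\<^sup>2 = (\<Sum>\<^sub>\<infinity>s. (cmod (f s))\<^sup>2)"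
  unfolding hnorm_def ell2_inner_self[OF assms] by (simp add: infsum_nonneg)

lemma ell2_hnorm_nonneg:
  assumes "f \<in> hcarrier (ell2 S)"
  shows "hnorm (ell2 S) f \<ge> 0"
  unfolding hnorm_def ell2_inner_self[OF assms] by (simp add: infsum_nonneg)

lemma ell2_finite_sum_le:
  assumes "f \<in> hcarrier (ell2 S)" "finite F"
  shows "(\<Sum>s\<in>F. (cmod (f s))\<^sup>2) \<le> (hnorm (ell2 S) f)\<^sup>2"
  unfolding ell2_hnorm_sq[OF assms(1)]
  using ell2_summable(1)[OF assms(1)] assms(2) by (intro finite_sum_le_infsum) auto

lemma ell2_memI:
  assumes supp: "\<And>s. s \<notin> S \<Longrightarrow> f s = 0" and le: "\<And>F. finite F \<Longrightarrow> (\<Sum>s\<in>F. (cmod (f s))\<^sup>2) \<le> C"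
  shows "f \<in> hcarrier (ell2 S)" "(hnorm (ell2 S) f)\<^sup>2 \<le> C"
proof -
  have sm: "(\<lambda>s. (cmod (f s))\<^sup>2) summable_on UNIV"
    using le by (intro nonneg_bdd_above_summable_on bdd_aboveI2[of _ _ C]) auto
  then show f: "f \<in> hcarrier (ell2 S)" using supp by (simp add: ell2_carrier_iff)
  show "(hnorm (ell2 S) f)\<^sup>2 \<le> C"
    unfolding ell2_hnorm_sq[OF f] using sm le by (rule infsum_le_finite_sums)
qed

lemma ell2_csubspace: "csubspace (hcarrier (ell2 S))"
proof (rule complex_vector.subspaceI)
  show "0 \<in> hcarrier (ell2 S)" by (simp add: ell2_carrier_iff)
next
  fix f g assume f: "f \<in> hcarrier (ell2 S)" and g: "g \<in> hcarrier (ell2 S)"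
  have "(\<lambda>s. 2 * (cmod (f s))\<^sup>2 + 2 * (cmod (g s))\<^sup>2) summable_on UNIV"
    by (intro summable_on_add summable_on_cmult_right ell2_summable(1)[OF f] ell2_summable(1)[OF g])
  then have "(\<lambda>s. (cmod ((f + g) s))\<^sup>2) summable_on UNIV"
  proof (rule summable_on_comparison_test)
    fix s
    have "(cmod (f s + g s))\<^sup>2 \<le> (cmod (f s) + cmod (g s))\<^sup>2"
      by (intro power_mono norm_triangle_ineq) auto
    also have "\<dots> \<le> 2 * (cmod (f s))\<^sup>2 + 2 * (cmod (g s))\<^sup>2"
      using sum_squares_bound[of "cmod (f s)" "cmod (g s)"] by (simp add: power2_sum)
    finally show "(cmod ((f + g) s))\<^sup>2 \<le> 2 * (cmod (f s))\<^sup>2 + 2 * (cmod (g s))\<^sup>2" by simp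
  qed auto
  then show "f + g \<in> hcarrier (ell2 S)"
    using f g by (simp add: ell2_carrier_iff)
next
  fix c f assume f: "f \<in> hcarrier (ell2 S)"
  have "(\<lambda>s. (cmod c)\<^sup>2 * (cmod (f s))\<^sup>2) summable_on UNIV"
    by (intro summable_on_cmult_right ell2_summable(1)[OF f])
  then show "c *\<^sub>C f \<in> hcarrier (ell2 S)"
    using f by (simp add: ell2_carrier_iff scaleC_fun_def scaleC_complex_def norm_mult power_mult_distrib)
qed

text \<open>A Cauchy sequence converges pointwise, and the estimates for finite partial sums pass to the limit.\<close>

lemma ell2_complete:
  fixes S :: "'s set"
  shows "complete_wrt (hnorm (ell2 S)) (hcarrier (ell2 S))"
  unfolding complete_wrt_def
proof (intro allI impI, elim conjE)
  fix f :: "nat \<Rightarrow> 's \<Rightarrow> complex"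
  assume f': "\<forall>n. f n \<in> hcarrier (ell2 S)"
    and cau: "\<forall>e>0. \<exists>M. \<forall>m\<ge>M. \<forall>n\<ge>M. hnorm (ell2 S) (f m - f n) < e"
  have f: "f n \<in> hcarrier (ell2 S)" for n using f' by blast
  have diff: "f m - f n \<in> hcarrier (ell2 S)" for m n
    using complex_vector.subspace_diff[OF ell2_csubspace f f] .
  note nn = ell2_hnorm_nonneg
  have "\<exists>l. (\<lambda>n. f n s) \<longlonglongrightarrow> l" for s
  proof -
    have "Cauchy (\<lambda>n. f n s)"
    proof (rule CauchyI)
      fix e :: real assume e: "e > 0"
      then obtain M where M: "\<And>m n. m \<ge> M \<Longrightarrow> n \<ge> M \<Longrightarrow> hnorm (ell2 S) (f m - f n) < e"
        using cau by blast
      have "norm (f m s - f n s) < e" if "m \<ge> M" "n \<ge> M" for m n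
      proof -
        have "(cmod (f m s - f n s))\<^sup>2 \<le> (hnorm (ell2 S) (f m - f n))\<^sup>2"
          using ell2_finite_sum_le[OF diff, of "{s}" m n] by simp
        then have "cmod (f m s - f n s) \<le> hnorm (ell2 S) (f m - f n)"
          using nn[OF diff] by (rule power2_le_imp_le)
        then show ?thesis using M[OF that] by simp
      qed
      then show "\<exists>M. \<forall>m\<ge>M. \<forall>n\<ge>M. norm (f m s - f n s) < e" by blast
    qed
    then show ?thesis by (simp add: Cauchy_convergent_iff convergent_def)
  qed
  then obtain l where l: "\<And>s. (\<lambda>n. f n s) \<longlonglongrightarrow> l s" by metis
  have supp: "l s = 0" if "s \<notin> S" for s
    using LIMSEQ_unique[OF l[of s]] ell2_summable(2)[OF f that] by simp
  have close: "f m - l \<in> hcarrier (ell2 S) \<and> (hnorm (ell2 S) (f m - l))\<^sup>2 \<le> e\<^sup>2"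
    if e: "e > 0" and M: "\<And>m n. m \<ge> M \<Longrightarrow> n \<ge> M \<Longrightarrow> hnorm (ell2 S) (f m - f n) < e" and m: "m \<ge> M" for e m M
  proof -
    have 1: "(f m - l) s = 0" if "s \<notin> S" for s
      using supp[OF that] ell2_summable(2)[OF f that] by simp
    have 2: "(\<Sum>s\<in>F. (cmod ((f m - l) s))\<^sup>2) \<le> e\<^sup>2" if F: "finite F" for F
    proof (rule LIMSEQ_le_const2)
      show "(\<lambda>n. \<Sum>s\<in>F. (cmod (f m s - f n s))\<^sup>2) \<longlonglongrightarrow> (\<Sum>s\<in>F. (cmod ((f m - l) s))\<^sup>2)"
        unfolding minus_apply by (intro tendsto_intros l)
      have "(\<Sum>s\<in>F. (cmod (f m s - f n s))\<^sup>2) \<le> e\<^sup>2" if "n \<ge> M" for n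
      proof -
        have "(\<Sum>s\<in>F. (cmod (f m s - f n s))\<^sup>2) \<le> (hnorm (ell2 S) (f m - f n))\<^sup>2"
          using ell2_finite_sum_le[OF diff F, of m n] by simp
        also have "\<dots> \<le> e\<^sup>2" using M[OF m that] nn[OF diff] by (intro power_mono) auto
        finally show ?thesis .
      qed
      then show "\<exists>N. \<forall>n\<ge>N. (\<Sum>s\<in>F. (cmod (f m s - f n s))\<^sup>2) \<le> e\<^sup>2" by blast
    qed
    show ?thesis using ell2_memI[of S "f m - l", OF 1 2] by blast
  qed
  have lS: "l \<in> hcarrier (ell2 S)"
  proof -
    obtain M where M: "\<And>m n. m \<ge> M \<Longrightarrow> n \<ge> M \<Longrightarrow> hnorm (ell2 S) (f m - f n) < 1"
      using cau[rule_format, OF zero_less_one] by blast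
    have "f M - l \<in> hcarrier (ell2 S)"
      using close[OF zero_less_one M order_refl, of M] by simp
    then have "f M - (f M - l) \<in> hcarrier (ell2 S)"
      by (rule complex_vector.subspace_diff[OF ell2_csubspace f])
    then show ?thesis by simp
  qed
  have "(\<lambda>n. hnorm (ell2 S) (f n - l)) \<longlonglongrightarrow> 0"
  proof (rule LIMSEQ_I)
    fix r :: real assume r: "r > 0"
    then obtain M where M: "\<And>m n. m \<ge> M \<Longrightarrow> n \<ge> M \<Longrightarrow> hnorm (ell2 S) (f m - f n) < r / 2"
      using cau[rule_format, OF half_gt_zero[OF r]] by blast
    have "norm (hnorm (ell2 S) (f m - l) - 0) < r" if "m \<ge> M" for m
    proof -
      have c: "f m - l \<in> hcarrier (ell2 S)" "(hnorm (ell2 S) (f m - l))\<^sup>2 \<le> (r / 2)\<^sup>2"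
        using close[OF half_gt_zero[OF r] M that] by simp_all
      have "hnorm (ell2 S) (f m - l) \<le> r / 2"
        by (rule power2_le_imp_le[OF c(2)]) (use r in simp)
      then show ?thesis using nn[OF c(1)] r by simp
    qed
    then show "\<exists>M. \<forall>n\<ge>M. norm (hnorm (ell2 S) (f n - l) - 0) < r" by blast
  qed
  then show "\<exists>l\<in>hcarrier (ell2 S). (\<lambda>n. hnorm (ell2 S) (f n - l)) \<longlonglongrightarrow> 0" using lS by blast
qed

lemma hilbert_space_ell2: "hilbert_space (ell2 S)"
proof
  show "csubspace (hcarrier (ell2 S))" by (rule ell2_csubspace)
  show "complete_wrt (hnorm (ell2 S)) (hcarrier (ell2 S))" by (rule ell2_complete)
next
  fix g assume g: "g \<in> hcarrier (ell2 S)"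
  show "clinear_on (hcarrier (ell2 S)) (\<lambda>x. hinner (ell2 S) x g)"
    unfolding clinear_on_def
  proof (intro conjI ballI allI)
    fix f f' assume f: "f \<in> hcarrier (ell2 S)" "f' \<in> hcarrier (ell2 S)"
    show "hinner (ell2 S) (f + f') g = hinner (ell2 S) f g + hinner (ell2 S) f' g"
      using infsum_add[OF ell2_inner_summable[OF f(1) g] ell2_inner_summable[OF f(2) g]]
      by (simp add: ell2_inner distrib_right)
  next
    fix c f assume f: "f \<in> hcarrier (ell2 S)"
    show "hinner (ell2 S) (c *\<^sub>C f) g = c *\<^sub>C hinner (ell2 S) f g"
      by (simp add: ell2_inner scaleC_fun_def scaleC_complex_def mult.assoc infsum_cmult_right')
  qed
next
  fix f g assume "f \<in> hcarrier (ell2 S)" "g \<in> hcarrier (ell2 S)"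
  show "hinner (ell2 S) g f = cnj (hinner (ell2 S) f g)"
    by (simp add: ell2_inner infsum_cnj[symmetric] mult.commute del: infsum_cnj)
next
  fix f assume f: "f \<in> hcarrier (ell2 S)" and "f \<noteq> 0"
  then obtain s where s: "f s \<noteq> 0" by (auto simp: fun_eq_iff)
  have "(\<Sum>s\<in>{s}. (cmod (f s))\<^sup>2) \<le> (\<Sum>\<^sub>\<infinity>s. (cmod (f s))\<^sup>2)"
    using ell2_summable(1)[OF f] by (intro finite_sum_le_infsum) auto
  moreover have "(\<Sum>s\<in>{s}. (cmod (f s))\<^sup>2) > 0" using s by simp
  ultimately show "Re (hinner (ell2 S) f f) > 0"
    unfolding ell2_inner_self[OF f] by (simp only: Re_complex_of_real)
qed

lemma ell2_inner_finite:
  assumes "finite F" "\<And>s. s \<notin> F \<Longrightarrow> g s = 0"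
  shows "hinner (ell2 S) f g = (\<Sum>s\<in>F. f s * cnj (g s))"
proof -
  have "hinner (ell2 S) f g = infsum (\<lambda>s. f s * cnj (g s)) F"
    unfolding ell2_inner using assms by (intro infsum_cong_neutral) auto
  then show ?thesis using assms by simp
qed

lemma ell2_finite_support:
  assumes "finite F" "F \<subseteq> S" "\<And>s. s \<notin> F \<Longrightarrow> f s = 0"
  shows "f \<in> hcarrier (ell2 S)"
proof -
  have "(\<lambda>s. (cmod (f s))\<^sup>2) summable_on F" using assms by simp
  then have "(\<lambda>s. (cmod (f s))\<^sup>2) summable_on UNIV"
    using assms by (subst summable_on_cong_neutral[where T = F]) auto
  then show ?thesis using assms by (auto simp: ell2_carrier_iff)
qed

definition restrict_vec :: "'s set \<Rightarrow> ('s \<Rightarrow> complex) \<Rightarrow> 's \<Rightarrow> complex" where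
  "restrict_vec F f = (\<lambda>s. if s \<in> F then f s else 0)"

lemma ell2_truncation:
  assumes f: "f \<in> hcarrier (ell2 S)" and e: "e > 0"
  shows "\<exists>F\<subseteq>S. finite F \<and> restrict_vec F f \<in> hcarrier (ell2 S) \<and> hnorm (ell2 S) (f - restrict_vec F f) \<le> e"
proof -
  obtain F where F: "finite F" "dist (\<Sum>s\<in>F. (cmod (f s))\<^sup>2) (\<Sum>\<^sub>\<infinity>s. (cmod (f s))\<^sup>2) \<le> e\<^sup>2"
    using infsum_finite_approximation[OF ell2_summable(1)[OF f], of "e\<^sup>2"] e by auto
  define F' where "F' = F \<inter> S"
  have res: "restrict_vec F' f \<in> hcarrier (ell2 S)"
    using F by (intro ell2_finite_support[of F']) (auto simp: F'_def restrict_vec_def)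
  have "(hnorm (ell2 S) (f - restrict_vec F' f))\<^sup>2 \<le> e\<^sup>2"
  proof (rule ell2_memI(2))
    fix s assume "s \<notin> S"
    then show "(f - restrict_vec F' f) s = 0" using ell2_summable(2)[OF f] by (simp add: restrict_vec_def)
  next
    fix E :: "'a set" assume E: "finite E"
    have "(\<Sum>s\<in>E. (cmod ((f - restrict_vec F' f) s))\<^sup>2) = (\<Sum>s\<in>E - F. (cmod (f s))\<^sup>2)"
      using E ell2_summable(2)[OF f]
      by (intro sum.mono_neutral_cong_right) (auto simp: restrict_vec_def F'_def)
    also have "\<dots> = (\<Sum>s\<in>E \<union> F. (cmod (f s))\<^sup>2) - (\<Sum>s\<in>F. (cmod (f s))\<^sup>2)"
      using sum.subset_diff[of F "E \<union> F" "\<lambda>s. (cmod (f s))\<^sup>2"] E F(1) by (simp add: Un_Diff)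
    also have "\<dots> \<le> (\<Sum>\<^sub>\<infinity>s. (cmod (f s))\<^sup>2) - (\<Sum>s\<in>F. (cmod (f s))\<^sup>2)"
      using ell2_summable(1)[OF f] E F(1) by (intro diff_right_mono finite_sum_le_infsum) auto
    finally show "(\<Sum>s\<in>E. (cmod ((f - restrict_vec F' f) s))\<^sup>2) \<le> e\<^sup>2"
      using F(2) by (simp add: dist_real_def)
  qed
  then have "hnorm (ell2 S) (f - restrict_vec F' f) \<le> e"
    by (rule power2_le_imp_le) (use e in simp)
  then show ?thesis using F(1) res by (intro exI[of _ F']) (auto simp: F'_def)
qed

section \<open>The block diagonal representation\<close>

lemma has_sum_sum_finite:
  fixes f :: "'i \<Rightarrow> 's \<Rightarrow> 'b::topological_comm_monoid_add"
  assumes "finite I" "\<And>i. i \<in> I \<Longrightarrow> (f i has_sum v i) A"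
  shows "((\<lambda>x. \<Sum>i\<in>I. f i x) has_sum (\<Sum>i\<in>I. v i)) A"
  using assms by (induction I) (auto intro: has_sum_add)

text \<open>Triples \<open>(k, \<phi>, a)\<close> with \<open>a < k\<close> index the standard basis vectors of the direct sum.  Finite unions of
  blocks are cofinal among the finite sets of triples, so that infinite sums are controlled by the sums over
  blocks.\<close>

definition blocks :: "(nat \<times> 'p) set \<Rightarrow> (nat \<times> 'p \<times> nat) set" where
  "blocks B = {(k, \<phi>, a). (k, \<phi>) \<in> B \<and> a < k}"

lemma blocks_eq: "blocks B = (\<lambda>(\<beta>, a). (fst \<beta>, snd \<beta>, a)) ` (SIGMA \<beta>:B. {..<fst \<beta>})"
  by (force simp: blocks_def)

lemma finite_blocks: "finite B \<Longrightarrow> finite (blocks B)"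
  unfolding blocks_eq by (intro finite_imageI finite_SigmaI) auto

lemma sum_blocks:
  fixes g :: "nat \<times> 'p \<times> nat \<Rightarrow> 'b::comm_monoid_add"
  assumes "finite B"
  shows "sum g (blocks B) = (\<Sum>\<beta>\<in>B. \<Sum>a<fst \<beta>. g (fst \<beta>, snd \<beta>, a))"
proof -
  have "sum g (blocks B) = (\<Sum>(\<beta>, a)\<in>(SIGMA \<beta>:B. {..<fst \<beta>}). g (fst \<beta>, snd \<beta>, a))"
    unfolding blocks_eq by (subst sum.reindex) (auto simp: inj_on_def case_prod_beta prod_eq_iff)
  also have "\<dots> = (\<Sum>\<beta>\<in>B. \<Sum>a<fst \<beta>. g (fst \<beta>, snd \<beta>, a))"
    using assms by (intro sum.Sigma[symmetric]) auto
  finally show ?thesis .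
qed

lemma blocks_cofinal:
  assumes "finite F" "F \<subseteq> blocks B"
  shows "\<exists>B'\<subseteq>B. finite B' \<and> F \<subseteq> blocks B'"
  using assms
  by (intro exI[of _ "(\<lambda>(k, \<phi>, a). (k, \<phi>)) ` F"]) (force simp: blocks_def)

lemma has_sum_blocks_nonneg:
  fixes g :: "nat \<times> 'p \<times> nat \<Rightarrow> real"
  assumes g: "(g has_sum v) UNIV" and zero: "\<And>s. s \<notin> blocks B \<Longrightarrow> g s = 0"
    and nonneg: "\<And>\<beta>. \<beta> \<in> B \<Longrightarrow> 0 \<le> (\<Sum>a<fst \<beta>. g (fst \<beta>, snd \<beta>, a))"
  shows "0 \<le> v"
proof (rule ccontr)
  assume "\<not> 0 \<le> v"
  then have "\<forall>\<^sub>F F in finite_subsets_at_top UNIV. sum g F < 0"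
    using g by (auto simp: has_sum_def intro: order_tendstoD(2))
  then obtain F where F: "finite F" "\<And>F'. finite F' \<Longrightarrow> F \<subseteq> F' \<Longrightarrow> sum g F' < 0"
    by (auto simp: eventually_finite_subsets_at_top)
  obtain B' where B': "B' \<subseteq> B" "finite B'" "F \<inter> blocks B \<subseteq> blocks B'"
    using blocks_cofinal[of "F \<inter> blocks B" B] F(1) by auto
  have "g s = 0" if "s \<in> F" "s \<notin> blocks B'" for s
    using B'(3) zero that by blast
  then have "sum g (F \<union> blocks B') = sum g (blocks B')"
    using F(1) finite_blocks[OF B'(2)] by (intro sum.mono_neutral_right) auto
  also have "\<dots> \<ge> 0"
    unfolding sum_blocks[OF B'(2)] by (rule sum_nonneg) (use nonneg B'(1) in blast)
  finally show False using F(2)[of "F \<union> blocks B'"] F(1) finite_blocks[OF B'(2)] by auto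
qed

lemma finite_sum_le_blocks:
  fixes g :: "nat \<times> 'p \<times> nat \<Rightarrow> real"
  assumes zero: "\<And>s. s \<notin> blocks B \<Longrightarrow> g s = 0" and nonneg: "\<And>s. g s \<ge> 0"
    and le: "\<And>B'. finite B' \<Longrightarrow> B' \<subseteq> B \<Longrightarrow> (\<Sum>\<beta>\<in>B'. \<Sum>a<fst \<beta>. g (fst \<beta>, snd \<beta>, a)) \<le> C"
    and F: "finite F"
  shows "sum g F \<le> C"
proof -
  obtain B' where B': "B' \<subseteq> B" "finite B'" "F \<inter> blocks B \<subseteq> blocks B'"
    using blocks_cofinal[of "F \<inter> blocks B" B] F by auto
  have "sum g F = sum g (F \<inter> blocks B)"
    using F zero by (intro sum.mono_neutral_right) auto
  also have "\<dots> \<le> sum g (blocks B')"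
    using B' nonneg finite_blocks[OF B'(2)] by (intro sum_mono2) auto
  also have "\<dots> \<le> C" unfolding sum_blocks[OF B'(2)] using le[OF B'(2,1)] .
  finally show ?thesis .
qed

lemma scaleC_fun_apply: "(c *\<^sub>C f) x = c *\<^sub>C f x"
  by (simp add: scaleC_fun_def)

context dual_unital_operator_space
begin

text \<open>The Hilbert space direct sum of the spaces \<open>\<complex>\<^sup>k\<close> over all matrix states \<open>(k, \<phi>)\<close>; below, \<open>\<Phi>\<close> is the direct
  sum of the maps \<open>\<phi>\<close>.\<close>

definition L :: "('h rep_index \<Rightarrow> complex) hspace" where
  "L = ell2 (blocks states)"

sublocale L: hilbert_space L
  unfolding L_def by (rule hilbert_space_ell2)

definition \<Phi> :: "('h \<Rightarrow> 'h) \<Rightarrow> ('h rep_index \<Rightarrow> complex) \<Rightarrow> ('h rep_index \<Rightarrow> complex)" where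
  "\<Phi> x \<xi> = (\<lambda>(k, \<phi>, a). if \<xi> \<in> hcarrier L \<and> (k, \<phi>, a) \<in> blocks states then \<Sum>b<k. \<phi> x a b * \<xi> (k, \<phi>, b) else 0)"

lemma stateD:
  assumes "(k, \<phi>) \<in> states"
  shows "\<exists>w\<in>mats k V. \<forall>x\<in>X. \<forall>a<k. \<forall>b<k. \<phi> x a b = T x (w a b)"
    "\<And>a b. a < k \<Longrightarrow> b < k \<Longrightarrow> \<phi> (id_op H) a b = (if a = b then 1 else 0)"
    "\<And>m c \<zeta>. c \<in> mats m X \<Longrightarrow> H.accretive m c \<Longrightarrow> 0 \<le> Re (amp m k \<phi> c \<zeta>)"
  using assms by (auto simp: states_def)

lemma state_add:
  "\<lbrakk>(k, \<phi>) \<in> states; x \<in> X; y \<in> X; a < k; b < k\<rbrakk> \<Longrightarrow> \<phi> (x + y) a b = \<phi> x a b + \<phi> y a b"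
  using stateD(1)[of k \<phi>] by (auto simp: X_add T_add)

lemma state_scale:
  "\<lbrakk>(k, \<phi>) \<in> states; x \<in> X; a < k; b < k\<rbrakk> \<Longrightarrow> \<phi> (c *\<^sub>C x) a b = c * \<phi> x a b"
  using stateD(1)[of k \<phi>] by (auto simp: X_scale T_scale)

lemma state_zero: "\<lbrakk>(k, \<phi>) \<in> states; a < k; b < k\<rbrakk> \<Longrightarrow> \<phi> 0 a b = 0"
  using stateD(1)[of k \<phi>] X_zero T_zero by auto

text \<open>Since \<open>\<parallel>x\<parallel> \<le> s\<close>, the block matrix of \<open>x\<close> is accretive, and so is its image under \<open>\<phi>\<close>.  The form of this
  image is evaluated at the vector with the components \<open>s\<inverse> \<phi>(x) \<zeta>\<close> and \<open>\<zeta>\<close>.\<close>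

lemma state_contractive:
  assumes \<phi>: "(k, \<phi>) \<in> states" and x: "x \<in> X" and s: "s > 0" "op_norm H x \<le> s"
  shows "(\<Sum>a<k. (cmod (\<Sum>b<k. \<phi> x a b * \<zeta> b))\<^sup>2) \<le> s\<^sup>2 * (\<Sum>b<k. (cmod (\<zeta> b))\<^sup>2)"
proof -
  define y where "y a = (\<Sum>b<k. \<phi> x a b * \<zeta> b)" for a
  define N where "N = (\<Sum>a<k. (cmod (y a))\<^sup>2)"
  define M where "M = (\<Sum>b<k. (cmod (\<zeta> b))\<^sup>2)"
  define \<omega> where "\<omega> i = (if i = 0 then \<lambda>a. y a / of_real s else \<zeta>)" for i :: nat
  have xX: "(\<lambda>_ _. x) \<in> mats 1 X" using x by (simp add: mats_def)
  have "H.accretive (1 + 1) (H.block 1 s (\<lambda>_ _. x))"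
    using H.norm_le_iff_accretive_block[OF mats_X_bd[OF xX] s(1)] s(2) by (simp add: op_norm_def)
  then have "0 \<le> Re (amp (1 + 1) k \<phi> (H.block 1 s (\<lambda>_ _. x)) \<omega>)"
    by (intro stateD(3)[OF \<phi>] H.block_in xX X_csub id_in)
  also have "amp (1 + 1) k \<phi> (H.block 1 s (\<lambda>_ _. x)) \<omega> =
      (\<Sum>a<k. \<Sum>b<k. \<phi> (of_real s *\<^sub>C id_op H) a b * \<omega> 0 b * cnj (\<omega> 0 a))
    + (\<Sum>a<k. \<Sum>b<k. \<phi> ((-2) *\<^sub>C x) a b * \<zeta> b * cnj (\<omega> 0 a))
    + (\<Sum>a<k. \<Sum>b<k. \<phi> 0 a b * \<omega> 0 b * cnj (\<zeta> a))
    + (\<Sum>a<k. \<Sum>b<k. \<phi> (of_real s *\<^sub>C id_op H) a b * \<zeta> b * cnj (\<zeta> a))"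
    by (simp add: amp_def lessThan_Suc H.block_def \<omega>_def del: complex_vector.scale_minus_left)
  also have "(\<Sum>a<k. \<Sum>b<k. \<phi> 0 a b * \<omega> 0 b * cnj (\<zeta> a)) = 0"
    using state_zero[OF \<phi>] by (intro sum.neutral ballI) auto
  also have "(\<Sum>a<k. \<Sum>b<k. \<phi> (of_real s *\<^sub>C id_op H) a b * \<zeta> b * cnj (\<zeta> a)) = of_real (s * M)"
  proof -
    have "(\<Sum>b<k. \<phi> (of_real s *\<^sub>C id_op H) a b * \<zeta> b * cnj (\<zeta> a)) = of_real (s * (cmod (\<zeta> a))\<^sup>2)" if "a < k" for a
    proof -
      have "(\<Sum>b<k. \<phi> (of_real s *\<^sub>C id_op H) a b * \<zeta> b * cnj (\<zeta> a)) = (\<Sum>b<k. if b = a then of_real s * (\<zeta> a * cnj (\<zeta> a)) else 0)"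
        using that by (intro sum.cong refl) (auto simp: state_scale[OF \<phi> id_in] stateD(2)[OF \<phi>])
      then show ?thesis using that by (simp add: complex_norm_square[symmetric])
    qed
    then show ?thesis by (simp add: M_def sum_distrib_left)
  qed
  also have "(\<Sum>a<k. \<Sum>b<k. \<phi> (of_real s *\<^sub>C id_op H) a b * \<omega> 0 b * cnj (\<omega> 0 a)) = of_real (N / s)"
  proof -
    have "(\<Sum>b<k. \<phi> (of_real s *\<^sub>C id_op H) a b * \<omega> 0 b * cnj (\<omega> 0 a)) = of_real ((cmod (y a))\<^sup>2 / s)" if "a < k" for a
    proof -
      have "(\<Sum>b<k. \<phi> (of_real s *\<^sub>C id_op H) a b * \<omega> 0 b * cnj (\<omega> 0 a)) = (\<Sum>b<k. if b = a then of_real s * (\<omega> 0 a * cnj (\<omega> 0 a)) else 0)"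
        using that by (intro sum.cong refl) (auto simp: state_scale[OF \<phi> id_in] stateD(2)[OF \<phi>])
      also have "\<dots> = of_real s * of_real ((cmod (\<omega> 0 a))\<^sup>2)"
        using that by (simp add: complex_norm_square[symmetric])
      also have "cmod (\<omega> 0 a) = cmod (y a) / s" using s by (simp add: \<omega>_def norm_divide)
      finally show ?thesis using s by (simp add: power_divide power2_eq_square)
    qed
    then show ?thesis by (simp add: N_def sum_divide_distrib)
  qed
  also have "(\<Sum>a<k. \<Sum>b<k. \<phi> ((-2) *\<^sub>C x) a b * \<zeta> b * cnj (\<omega> 0 a)) = of_real (- 2 * N / s)"
  proof -
    have "(\<Sum>b<k. \<phi> ((-2) *\<^sub>C x) a b * \<zeta> b * cnj (\<omega> 0 a)) = of_real (- 2 * (cmod (y a))\<^sup>2 / s)" if "a < k" for a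
    proof -
      have "(\<Sum>b<k. \<phi> ((-2) *\<^sub>C x) a b * \<zeta> b * cnj (\<omega> 0 a)) = (\<Sum>b<k. (-2) * cnj (\<omega> 0 a) * (\<phi> x a b * \<zeta> b))"
        using that state_scale[OF \<phi> x that, of _ "-2"] by (intro sum.cong refl) (simp del: complex_vector.scale_minus_left)
      also have "\<dots> = (-2) * cnj (\<omega> 0 a) * y a" by (simp only: y_def sum_distrib_left)
      also have "\<dots> = (-2) * (y a * cnj (y a)) / of_real s" by (simp add: \<omega>_def)
      finally show ?thesis by (simp add: complex_norm_square[symmetric])
    qed
    then show ?thesis by (simp add: N_def sum_divide_distrib sum_distrib_left sum_negf)
  qed
  finally have "0 \<le> N / s - 2 * N / s + s * M" by simp
  then have "N \<le> s * s * M" using s by (simp add: field_simps)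
  then show ?thesis by (simp add: N_def M_def y_def power2_eq_square)
qed

lemma \<Phi>_apply:
  assumes "\<xi> \<in> hcarrier L" "(k, \<phi>) \<in> states" "a < k"
  shows "\<Phi> x \<xi> (k, \<phi>, a) = (\<Sum>b<k. \<phi> x a b * \<xi> (k, \<phi>, b))"
  using assms by (simp add: \<Phi>_def blocks_def)

lemma \<Phi>_zero_outside: "s \<notin> blocks states \<Longrightarrow> \<Phi> x \<xi> s = 0"
  by (cases s) (simp add: \<Phi>_def)

lemma \<Phi>_bound:
  assumes x: "x \<in> X" and s: "s > 0" "op_norm H x \<le> s" and \<xi>: "\<xi> \<in> hcarrier L"
  shows "\<Phi> x \<xi> \<in> hcarrier L" "(hnorm L (\<Phi> x \<xi>))\<^sup>2 \<le> s\<^sup>2 * (hnorm L \<xi>)\<^sup>2"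
proof -
  have le: "(\<Sum>s\<in>F. (cmod (\<Phi> x \<xi> s))\<^sup>2) \<le> s\<^sup>2 * (hnorm L \<xi>)\<^sup>2" if "finite F" for F
  proof (rule finite_sum_le_blocks[where B = states])
    fix B' assume B': "finite B'" "B' \<subseteq> states"
    have "(\<Sum>\<beta>\<in>B'. \<Sum>a<fst \<beta>. (cmod (\<Phi> x \<xi> (fst \<beta>, snd \<beta>, a)))\<^sup>2)
        \<le> (\<Sum>\<beta>\<in>B'. s\<^sup>2 * (\<Sum>b<fst \<beta>. (cmod (\<xi> (fst \<beta>, snd \<beta>, b)))\<^sup>2))"
    proof (rule sum_mono)
      fix \<beta> assume "\<beta> \<in> B'"
      then have \<beta>: "(fst \<beta>, snd \<beta>) \<in> states" using B' by auto
      show "(\<Sum>a<fst \<beta>. (cmod (\<Phi> x \<xi> (fst \<beta>, snd \<beta>, a)))\<^sup>2) \<le> s\<^sup>2 * (\<Sum>b<fst \<beta>. (cmod (\<xi> (fst \<beta>, snd \<beta>, b)))\<^sup>2)"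
        using state_contractive[OF \<beta> x s, of "\<lambda>b. \<xi> (fst \<beta>, snd \<beta>, b)"] \<Phi>_apply[OF \<xi> \<beta>] by simp
    qed
    also have "\<dots> = s\<^sup>2 * (\<Sum>s\<in>blocks B'. (cmod (\<xi> s))\<^sup>2)"
      by (simp add: sum_blocks[OF B'(1)] sum_distrib_left)
    also have "\<dots> \<le> s\<^sup>2 * (hnorm L \<xi>)\<^sup>2"
      using \<xi> finite_blocks[OF B'(1)] unfolding L_def by (intro mult_left_mono ell2_finite_sum_le) auto
    finally show "(\<Sum>\<beta>\<in>B'. \<Sum>a<fst \<beta>. (cmod (\<Phi> x \<xi> (fst \<beta>, snd \<beta>, a)))\<^sup>2) \<le> s\<^sup>2 * (hnorm L \<xi>)\<^sup>2" .
  qed (use that \<Phi>_zero_outside in auto)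
  show "\<Phi> x \<xi> \<in> hcarrier L" "(hnorm L (\<Phi> x \<xi>))\<^sup>2 \<le> s\<^sup>2 * (hnorm L \<xi>)\<^sup>2"
    using ell2_memI[of "blocks states" "\<Phi> x \<xi>", OF \<Phi>_zero_outside le] by (auto simp: L_def)
qed

lemma \<Phi>_bounded: "x \<in> X \<Longrightarrow> \<Phi> x \<in> bounded_ops L"
proof -
  assume x: "x \<in> X"
  define s where "s = op_norm H x + 1"
  have s: "s > 0" "op_norm H x \<le> s" using norm_nonneg(1)[OF x] by (auto simp: s_def)
  have "clinear_on (hcarrier L) (\<Phi> x)"
    unfolding clinear_on_def
  proof (intro conjI ballI allI ext)
    fix \<xi> \<eta> and t :: "'h rep_index" assume "\<xi> \<in> hcarrier L" "\<eta> \<in> hcarrier L"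
    then show "\<Phi> x (\<xi> + \<eta>) t = (\<Phi> x \<xi> + \<Phi> x \<eta>) t"
      by (cases t) (auto simp: \<Phi>_def sum.distrib distrib_left)
  next
    fix c \<xi> and t :: "'h rep_index" assume "\<xi> \<in> hcarrier L"
    then show "\<Phi> x (c *\<^sub>C \<xi>) t = (c *\<^sub>C \<Phi> x \<xi>) t"
      by (cases t) (simp add: \<Phi>_def scaleC_fun_apply scaleC_complex_def sum_distrib_left mult_ac)
  qed
  moreover have "\<Phi> x \<xi> = 0" if "\<xi> \<notin> hcarrier L" for \<xi>
    using that by (auto simp: \<Phi>_def fun_eq_iff)
  moreover have "hnorm L (\<Phi> x \<xi>) \<le> s * hnorm L \<xi>" if "\<xi> \<in> hcarrier L" for \<xi>
    by (rule power2_le_imp_le) (use \<Phi>_bound[OF x s that] s that in \<open>auto simp: power_mult_distrib\<close>)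
  ultimately show ?thesis
    using \<Phi>_bound(1)[OF x s] unfolding bounded_ops_def by blast
qed

lemma \<Phi>_add: "x \<in> X \<Longrightarrow> y \<in> X \<Longrightarrow> \<Phi> (x + y) = \<Phi> x + \<Phi> y"
  by (auto simp: \<Phi>_def blocks_def fun_eq_iff state_add distrib_right sum.distrib intro!: sum.cong)

lemma \<Phi>_scale: "x \<in> X \<Longrightarrow> \<Phi> (c *\<^sub>C x) = c *\<^sub>C \<Phi> x"
  by (auto simp: \<Phi>_def blocks_def fun_eq_iff state_scale scaleC_fun_apply scaleC_complex_def sum_distrib_left mult_ac intro!: sum.cong)

lemma \<Phi>_id: "\<Phi> (id_op H) = id_op L"
proof (intro ext)
  fix \<xi> and s :: "'h rep_index"
  obtain k \<phi> a where s: "s = (k, \<phi>, a)" by (cases s)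
  show "\<Phi> (id_op H) \<xi> s = id_op L \<xi> s"
  proof (cases "\<xi> \<in> hcarrier L \<and> s \<in> blocks states")
    case True
    then have \<phi>: "(k, \<phi>) \<in> states" "a < k" by (auto simp: s blocks_def)
    have "(\<Sum>b<k. \<phi> (id_op H) a b * \<xi> (k, \<phi>, b)) = (\<Sum>b<k. if b = a then \<xi> (k, \<phi>, a) else 0)"
      using \<phi>(2) by (intro sum.cong refl) (auto simp: stateD(2)[OF \<phi>(1)])
    then show ?thesis using True \<phi> by (simp add: s \<Phi>_apply id_op_def)
  next
    case False
    then show ?thesis
      using ell2_summable(2)[of \<xi> "blocks states" s]
      by (auto simp: id_op_def \<Phi>_def s L_def)
  qed
qed

lemma \<Phi>_clinear: "clinear_on X \<Phi>"
  by (simp add: clinear_on_def \<Phi>_add \<Phi>_scale)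

text \<open>Matrix states preserve accretivity, and the form of \<open>\<Phi>\<close> is the sum of the forms of its blocks.
  Conversely, if \<open>c\<close> is not accretive, this is detected by a single block.\<close>

lemma \<Phi>_accretive_iff:
  assumes c: "c \<in> mats n X"
  shows "L.accretive n (\<lambda>i j. \<Phi> (c i j)) \<longleftrightarrow> H.accretive n c"
proof
  assume acc: "H.accretive n c"
  show "L.accretive n (\<lambda>i j. \<Phi> (c i j))"
    unfolding L.accretive_def
  proof (intro allI impI)
    fix \<zeta> assume \<zeta>: "\<forall>i<n. \<zeta> i \<in> hcarrier L"
    define g where "g s = (\<Sum>i<n. \<Sum>j<n. \<Phi> (c i j) (\<zeta> j) s * cnj (\<zeta> i s))" for s
    have "((\<lambda>s. \<Phi> (c i j) (\<zeta> j) s * cnj (\<zeta> i s)) has_sum hinner L (\<Phi> (c i j) (\<zeta> j)) (\<zeta> i)) UNIV"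
      if "i < n" "j < n" for i j
      unfolding L_def ell2_inner using that \<zeta> L.bounded_opsD(2)[OF \<Phi>_bounded[OF matsD[OF c that]]]
      by (intro has_sum_infsum ell2_inner_summable[of _ "blocks states"]) (auto simp: L_def)
    then have "(g has_sum L.form {..<n} (\<lambda>i j. \<Phi> (c i j)) \<zeta> \<zeta>) UNIV"
      unfolding g_def L.form_def by (intro has_sum_sum_finite) auto
    then have hs: "((\<lambda>s. Re (g s)) has_sum Re (L.form {..<n} (\<lambda>i j. \<Phi> (c i j)) \<zeta> \<zeta>)) UNIV"
      by (rule has_sum_Re)
    show "0 \<le> Re (L.form {..<n} (\<lambda>i j. \<Phi> (c i j)) \<zeta> \<zeta>)"
    proof (rule has_sum_blocks_nonneg[OF hs, where B = states])
      show "Re (g s) = 0" if "s \<notin> blocks states" for s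
        using \<Phi>_zero_outside[OF that] by (simp add: g_def)
      fix \<beta> assume \<beta>: "\<beta> \<in> states"
      obtain k \<phi> where k: "\<beta> = (k, \<phi>)" by (cases \<beta>)
      define \<omega> where "\<omega> j b = \<zeta> j (k, \<phi>, b)" for j b
      have "(\<Sum>a<k. g (k, \<phi>, a)) = (\<Sum>a<k. \<Sum>i<n. \<Sum>j<n. \<Sum>b<k. \<phi> (c i j) a b * \<omega> j b * cnj (\<omega> i a))"
        using \<zeta> \<beta> unfolding g_def by (intro sum.cong refl) (simp add: \<Phi>_apply k \<omega>_def sum_distrib_right)
      also have "\<dots> = (\<Sum>i<n. \<Sum>a<k. \<Sum>j<n. \<Sum>b<k. \<phi> (c i j) a b * \<omega> j b * cnj (\<omega> i a))"
        by (rule sum.swap)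
      also have "\<dots> = amp n k \<phi> c \<omega>"
        unfolding amp_def by (intro sum.cong refl sum.swap)
      finally have "0 \<le> Re (\<Sum>a<k. g (k, \<phi>, a))"
        using stateD(3)[OF _ c acc, of k \<phi>] \<beta> k by simp
      then show "0 \<le> (\<Sum>a<fst \<beta>. Re (g (fst \<beta>, snd \<beta>, a)))" by (simp add: k)
    qed
  qed
next
  assume acc: "L.accretive n (\<lambda>i j. \<Phi> (c i j))"
  show "H.accretive n c"
  proof (rule ccontr)
    assume "\<not> H.accretive n c"
    then obtain k \<phi> \<zeta> where \<phi>: "(k, \<phi>) \<in> states" and neg: "Re (amp n k \<phi> c \<zeta>) < 0"
      using matrix_state_detects[OF c] by blast
    define \<xi> where "\<xi> i = (\<lambda>(k', \<phi>', a). if k' = k \<and> \<phi>' = \<phi> \<and> a < k then \<zeta> i a else 0)" for i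
    have supp: "\<xi> i s = 0" if "s \<notin> blocks {(k, \<phi>)}" for i s
      using that by (cases s) (auto simp: \<xi>_def blocks_def)
    have fin: "finite (blocks {(k, \<phi>)})" by (rule finite_blocks) simp
    have \<xi>: "\<xi> i \<in> hcarrier L" for i
      unfolding L_def using \<phi> by (intro ell2_finite_support[OF fin _ supp]) (auto simp: blocks_def)
    have "L.form {..<n} (\<lambda>i j. \<Phi> (c i j)) \<xi> \<xi> = amp n k \<phi> c \<zeta>"
      unfolding L.form_def amp_def
    proof (intro sum.cong refl)
      fix i j
      have "hinner L (\<Phi> (c i j) (\<xi> j)) (\<xi> i) = (\<Sum>a<k. \<Phi> (c i j) (\<xi> j) (k, \<phi>, a) * cnj (\<xi> i (k, \<phi>, a)))"
        unfolding L_def 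
        by (subst ell2_inner_finite[OF fin supp]) (simp_all add: sum_blocks)
      also have "\<dots> = (\<Sum>a<k. \<Sum>b<k. \<phi> (c i j) a b * \<zeta> j b * cnj (\<zeta> i a))"
        using \<phi> \<xi> by (intro sum.cong refl) (simp add: \<Phi>_apply \<xi>_def sum_distrib_right)
      finally show "hinner L (\<Phi> (c i j) (\<xi> j)) (\<xi> i) = \<dots>" .
    qed
    then have "0 \<le> Re (amp n k \<phi> c \<zeta>)"
      using acc[unfolded L.accretive_def, rule_format, of \<xi>] \<xi> by simp
    then show False using neg by simp
  qed
qed

lemma \<Phi>_mats: "x \<in> mats n X \<Longrightarrow> (\<lambda>i j. \<Phi> (x i j)) \<in> mats n (bounded_ops L)"
  using \<Phi>_bounded by (simp add: mats_def)

text \<open>The unital map \<open>\<Phi>\<close> takes the block matrix of \<open>x\<close> to that of the image of \<open>x\<close>.\<close>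

theorem \<Phi>_mnorm:
  assumes x: "x \<in> mats n X"
  shows "op_mnorm L n (\<lambda>i j. \<Phi> (x i j)) = op_mnorm H n x"
proof -
  have iff: "op_mnorm L n (\<lambda>i j. \<Phi> (x i j)) \<le> s \<longleftrightarrow> op_mnorm H n x \<le> s" if s: "s > 0" for s
  proof -
    have zero: "\<Phi> 0 = 0" using \<Phi>_scale[OF X_zero, of 0] by simp
    have "L.block n s (\<lambda>i j. \<Phi> (x i j)) i j = \<Phi> (H.block n s x i j)" if "i < n + n" "j < n + n" for i j
    proof -
      consider "i = j" | "i \<noteq> j" "i < n" "n \<le> j" | "i \<noteq> j" "\<not> (i < n \<and> n \<le> j)" by blast
      then show ?thesis
      proof cases
        case 1
        then show ?thesis using \<Phi>_scale[OF id_in, of "of_real s"] by (simp add: L.block_def H.block_def \<Phi>_id)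
      next
        case 2
        then have "x i (j - n) \<in> X" using that x by (auto simp: mats_def)
        from \<Phi>_scale[OF this, of "-2"] show ?thesis
          by (simp only: L.block_def H.block_def 2 if_True if_False simp_thms)
      next
        case 3
        then show ?thesis
          by (simp only: L.block_def H.block_def zero if_False simp_thms)
      qed
    qed
    then have "L.accretive (n + n) (L.block n s (\<lambda>i j. \<Phi> (x i j))) \<longleftrightarrow>
        L.accretive (n + n) (\<lambda>i j. \<Phi> (H.block n s x i j))"
      by (rule L.accretive_cong)
    then show ?thesis
      unfolding L.norm_le_iff_accretive_block[OF \<Phi>_mats[OF x] s] H.norm_le_iff_accretive_block[OF mats_X_bd[OF x] s]
        \<Phi>_accretive_iff[OF H.block_in[OF x X_csub id_in]] by simp
  qed
  have nonneg: "op_mnorm L n (\<lambda>i j. \<Phi> (x i j)) \<ge> 0" "op_mnorm H n x \<ge> 0"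
    using \<Phi>_mats[OF x] mnorm_nonneg[OF x] by (auto intro!: L.mat_norm_nonneg simp: mats_def)
  show ?thesis
  proof (rule antisym; rule field_le_epsilon)
    fix e :: real assume "e > 0"
    then show "op_mnorm L n (\<lambda>i j. \<Phi> (x i j)) \<le> op_mnorm H n x + e"
      "op_mnorm H n x \<le> op_mnorm L n (\<lambda>i j. \<Phi> (x i j)) + e"
      using iff[of "op_mnorm H n x + e"] iff[of "op_mnorm L n (\<lambda>i j. \<Phi> (x i j)) + e"] nonneg by auto
  qed
qed

lemma \<Phi>_norm: "x \<in> X \<Longrightarrow> op_norm L (\<Phi> x) = op_norm H x"
  using \<Phi>_mnorm[of "\<lambda>_ _. x" 1] by (simp add: op_norm_def mats_def)

end

section \<open>Normal functionals\<close>

context hilbert_space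
begin

text \<open>Normal functionals are handled through representing sequences of vectors; \<open>nset c\<close> contains the pairs
  of sequences that represent a functional of norm at most \<open>c\<close> in the evident way.\<close>

definition nfun :: "(nat \<Rightarrow> 'h) \<times> (nat \<Rightarrow> 'h) \<Rightarrow> ('h \<Rightarrow> 'h) \<Rightarrow> complex" where
  "nfun p A = (\<Sum>n. hinner H (A (fst p n)) (snd p n))"

definition nset :: "real \<Rightarrow> ((nat \<Rightarrow> 'h) \<times> (nat \<Rightarrow> 'h)) set" where
  "nset c = {(\<xi>, \<eta>). range \<xi> \<subseteq> hcarrier H \<and> range \<eta> \<subseteq> hcarrier H \<and>
     summable (\<lambda>n. (hnorm H (\<xi> n))\<^sup>2) \<and> summable (\<lambda>n. (hnorm H (\<eta> n))\<^sup>2) \<and>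
     (\<Sum>n. (hnorm H (\<xi> n))\<^sup>2) \<le> c \<and> (\<Sum>n. (hnorm H (\<eta> n))\<^sup>2) \<le> c}"

lemma normal_functionals_eq: "normal_functionals H = {nfun p | p c. p \<in> nset c}"
proof (intro set_eqI iffI)
  fix f assume "f \<in> normal_functionals H"
  then obtain \<xi> \<eta> where \<xi>: "f = (\<lambda>A. \<Sum>n. hinner H (A (\<xi> n)) (\<eta> n))"
    "range \<xi> \<subseteq> hcarrier H" "range \<eta> \<subseteq> hcarrier H"
    "summable (\<lambda>n. (hnorm H (\<xi> n))\<^sup>2)" "summable (\<lambda>n. (hnorm H (\<eta> n))\<^sup>2)"
    unfolding normal_functionals_def by blast
  have "(\<xi>, \<eta>) \<in> nset (max (\<Sum>n. (hnorm H (\<xi> n))\<^sup>2) (\<Sum>n. (hnorm H (\<eta> n))\<^sup>2))"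
    using \<xi> by (simp add: nset_def)
  moreover have "f = nfun (\<xi>, \<eta>)" by (simp add: \<xi>(1) nfun_def fun_eq_iff)
  ultimately show "f \<in> {nfun p | p c. p \<in> nset c}" by blast
next
  fix f assume "f \<in> {nfun p | p c. p \<in> nset c}"
  then obtain p c where p: "f = nfun p" "p \<in> nset c" by blast
  obtain \<xi> \<eta> where "p = (\<xi>, \<eta>)" by (cases p)
  moreover from this have "f = (\<lambda>A. \<Sum>n. hinner H (A (\<xi> n)) (\<eta> n))"
    using p(1) by (simp add: nfun_def fun_eq_iff)
  ultimately show "f \<in> normal_functionals H"
    using p(2) unfolding normal_functionals_def nset_def by blast
qed

lemma nsetD:
  assumes "p \<in> nset c"
  shows "fst p n \<in> hcarrier H" "snd p n \<in> hcarrier H"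
    "summable (\<lambda>n. (hnorm H (fst p n))\<^sup>2)" "summable (\<lambda>n. (hnorm H (snd p n))\<^sup>2)"
    "(\<Sum>n. (hnorm H (fst p n))\<^sup>2) \<le> c" "(\<Sum>n. (hnorm H (snd p n))\<^sup>2) \<le> c"
  using assms by (auto simp: nset_def)

lemma nsetI:
  assumes "\<And>n. fst p n \<in> hcarrier H" "\<And>n. snd p n \<in> hcarrier H"
    "summable (\<lambda>n. (hnorm H (fst p n))\<^sup>2)" "summable (\<lambda>n. (hnorm H (snd p n))\<^sup>2)"
    "(\<Sum>n. (hnorm H (fst p n))\<^sup>2) \<le> c" "(\<Sum>n. (hnorm H (snd p n))\<^sup>2) \<le> c"
  shows "p \<in> nset c"
  using assms by (cases p) (auto simp: nset_def)

lemma nfun_term_le: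
  assumes p: "p \<in> nset c" and A: "A \<in> bounded_ops H"
  shows "cmod (hinner H (A (fst p n)) (snd p n))
    \<le> op_norm H A * (((hnorm H (fst p n))\<^sup>2 + (hnorm H (snd p n))\<^sup>2) / 2)"
proof -
  let ?a = "hnorm H (fst p n)" and ?b = "hnorm H (snd p n)"
  have "cmod (hinner H (A (fst p n)) (snd p n)) \<le> op_norm H A * (?a * ?b)"
    using op_norm_form[OF A nsetD(1,2)[OF p]] by (simp add: mult.assoc)
  also have "\<dots> \<le> op_norm H A * ((?a\<^sup>2 + ?b\<^sup>2) / 2)"
    using sum_squares_bound[of ?a ?b] op_norm_nonneg[OF A] by (intro mult_left_mono) auto
  finally show ?thesis .
qed

lemma nset_summable:
  assumes p: "p \<in> nset c"
  shows "summable (\<lambda>n. ((hnorm H (fst p n))\<^sup>2 + (hnorm H (snd p n))\<^sup>2) / 2)"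
    "(\<Sum>n. ((hnorm H (fst p n))\<^sup>2 + (hnorm H (snd p n))\<^sup>2) / 2) \<le> c"
proof -
  note s = summable_add[OF nsetD(3,4)[OF p]]
  show "summable (\<lambda>n. ((hnorm H (fst p n))\<^sup>2 + (hnorm H (snd p n))\<^sup>2) / 2)"
    using s by (rule summable_divide)
  show "(\<Sum>n. ((hnorm H (fst p n))\<^sup>2 + (hnorm H (snd p n))\<^sup>2) / 2) \<le> c"
    using nsetD(5,6)[OF p] by (simp add: suminf_divide[OF s] suminf_add[OF nsetD(3,4)[OF p], symmetric])
qed

lemma nfun_summable:
  assumes p: "p \<in> nset c" and A: "A \<in> bounded_ops H"
  shows "summable (\<lambda>n. cmod (hinner H (A (fst p n)) (snd p n)))"
  by (rule summable_comparison_test'[OF summable_mult[OF nset_summable(1)[OF p], of "op_norm H A"], of 0])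
    (use nfun_term_le[OF p A] in simp)

lemma nfun_sums:
  assumes p: "p \<in> nset c" and A: "A \<in> bounded_ops H"
  shows "(\<lambda>n. hinner H (A (fst p n)) (snd p n)) sums nfun p A"
  unfolding nfun_def by (rule summable_sums[OF summable_norm_cancel[OF nfun_summable[OF p A]]])

lemma nfun_tail_le:
  assumes p: "p \<in> nset c" and A: "A \<in> bounded_ops H"
  shows "cmod (nfun p A - (\<Sum>n<N. hinner H (A (fst p n)) (snd p n)))
    \<le> op_norm H A * (\<Sum>n. ((hnorm H (fst p (n + N)))\<^sup>2 + (hnorm H (snd p (n + N)))\<^sup>2) / 2)"
proof -
  note s = nfun_summable[OF p A]
  have "nfun p A - (\<Sum>n<N. hinner H (A (fst p n)) (snd p n)) = (\<Sum>n. hinner H (A (fst p (n + N))) (snd p (n + N)))"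
    unfolding nfun_def using suminf_split_initial_segment[OF summable_norm_cancel[OF s], of N] by simp
  also have "cmod \<dots> \<le> (\<Sum>n. cmod (hinner H (A (fst p (n + N))) (snd p (n + N))))"
    using s by (intro summable_norm) (rule summable_ignore_initial_segment)
  also have "\<dots> \<le> (\<Sum>n. op_norm H A * (((hnorm H (fst p (n + N)))\<^sup>2 + (hnorm H (snd p (n + N)))\<^sup>2) / 2))"
    by (intro suminf_le nfun_term_le[OF p A] summable_mult summable_ignore_initial_segment[OF s]
        summable_ignore_initial_segment[OF nset_summable(1)[OF p]])
  also have "\<dots> = op_norm H A * (\<Sum>n. ((hnorm H (fst p (n + N)))\<^sup>2 + (hnorm H (snd p (n + N)))\<^sup>2) / 2)"
    by (intro suminf_mult summable_ignore_initial_segment[OF nset_summable(1)[OF p]])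
  finally show ?thesis .
qed

lemma nfun_le:
  assumes p: "p \<in> nset c" and A: "A \<in> bounded_ops H"
  shows "cmod (nfun p A) \<le> op_norm H A * c"
  using nfun_tail_le[OF p A, of 0] mult_left_mono[OF nset_summable(2)[OF p] op_norm_nonneg[OF A]]
  by simp

lemma nfun_add:
  assumes p: "p \<in> nset c" and A: "A \<in> bounded_ops H" and B: "B \<in> bounded_ops H"
  shows "nfun p (A + B) = nfun p A + nfun p B"
proof -
  have "hinner H ((A + B) (fst p n)) (snd p n) = hinner H (A (fst p n)) (snd p n) + hinner H (B (fst p n)) (snd p n)" for n
    using bounded_opsD(2)[OF A nsetD(1)[OF p]] bounded_opsD(2)[OF B nsetD(1)[OF p]] nsetD(2)[OF p]
    by (simp add: inner_add_left)
  then show ?thesis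
    using sums_add[OF nfun_sums[OF p A] nfun_sums[OF p B]] by (simp add: nfun_def sums_iff)
qed

lemma nfun_scale_op:
  assumes p: "p \<in> nset c" and A: "A \<in> bounded_ops H"
  shows "nfun p (a *\<^sub>C A) = a * nfun p A"
proof -
  have "hinner H ((a *\<^sub>C A) (fst p n)) (snd p n) = a * hinner H (A (fst p n)) (snd p n)" for n
    using bounded_opsD(2)[OF A nsetD(1)[OF p]] nsetD(2)[OF p]
    by (simp add: inner_scaleC_left scaleC_fun_apply)
  then show ?thesis
    using sums_mult[OF nfun_sums[OF p A], of a] by (simp add: nfun_def sums_iff)
qed

lemma nset_scale:
  assumes p: "p \<in> nset c"
  shows "\<exists>q\<in>nset (cmod a * c). \<forall>A\<in>bounded_ops H. nfun q A = a * nfun p A"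
proof -
  \<comment> \<open>The factor \<open>a = r s\<close> is distributed evenly over the two sequences.\<close>
  define r where "r = complex_of_real (sqrt (cmod a))"
  define s where "s = (if a = 0 then 0 else a / r)"
  have rs: "r * s = a" "(cmod r)\<^sup>2 = cmod a" "(cmod s)\<^sup>2 = cmod a"
    by (auto simp: s_def r_def norm_divide power_divide power2_eq_square real_sqrt_mult[symmetric] simp del: real_sqrt_mult)
  define q where "q = ((\<lambda>n. s *\<^sub>C fst p n), (\<lambda>n. cnj r *\<^sub>C snd p n))"
  have eq: "(hnorm H (fst q n))\<^sup>2 = cmod a * (hnorm H (fst p n))\<^sup>2"
    "(hnorm H (snd q n))\<^sup>2 = cmod a * (hnorm H (snd p n))\<^sup>2" for n
    using nsetD(1,2)[OF p] rs by (simp_all add: q_def power_mult_distrib)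
  have "q \<in> nset (cmod a * c)"
  proof (rule nsetI)
    show "fst q n \<in> hcarrier H" "snd q n \<in> hcarrier H" for n
      using nsetD(1,2)[OF p] by (auto simp: q_def)
    show "summable (\<lambda>n. (hnorm H (fst q n))\<^sup>2)" "summable (\<lambda>n. (hnorm H (snd q n))\<^sup>2)"
      unfolding eq by (intro summable_mult nsetD[OF p])+
    show "(\<Sum>n. (hnorm H (fst q n))\<^sup>2) \<le> cmod a * c" "(\<Sum>n. (hnorm H (snd q n))\<^sup>2) \<le> cmod a * c"
      unfolding eq using nsetD(3-6)[OF p] by (auto simp: suminf_mult intro!: mult_left_mono)
  qed
  moreover have "nfun q A = a * nfun p A" if A: "A \<in> bounded_ops H" for A
  proof -
    have "hinner H (A (fst q n)) (snd q n) = a * hinner H (A (fst p n)) (snd p n)" for n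
    proof -
      have "A (s *\<^sub>C fst p n) = s *\<^sub>C A (fst p n)"
        by (rule clinear_on_scaleC[OF bounded_opsD(1)[OF A] nsetD(1)[OF p]])
      then show ?thesis
        using bounded_opsD(2)[OF A nsetD(1)[OF p]] nsetD(2)[OF p] rs(1)
        by (simp add: q_def inner_scaleC_left inner_scaleC_right mult.assoc[symmetric] mult.commute)
    qed
    then show ?thesis
      using sums_mult[OF nfun_sums[OF p A], of a] by (simp add: nfun_def[of q] sums_iff)
  qed
  ultimately show ?thesis by blast
qed

lemma vector_functional:
  assumes "\<xi> \<in> hcarrier H" "\<eta> \<in> hcarrier H" "(hnorm H \<xi>)\<^sup>2 \<le> c" "(hnorm H \<eta>)\<^sup>2 \<le> c"
  shows "\<exists>p\<in>nset c. \<forall>A\<in>bounded_ops H. nfun p A = hinner H (A \<xi>) \<eta>"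
proof -
  define p where "p = ((\<lambda>n::nat. if n = 0 then \<xi> else 0), (\<lambda>n::nat. if n = 0 then \<eta> else 0))"
  have s: "(\<lambda>n. (hnorm H (fst p n))\<^sup>2) sums (hnorm H \<xi>)\<^sup>2" "(\<lambda>n. (hnorm H (snd p n))\<^sup>2) sums (hnorm H \<eta>)\<^sup>2"
    using sums_single[of 0 "\<lambda>_. (hnorm H \<xi>)\<^sup>2"] sums_single[of 0 "\<lambda>_. (hnorm H \<eta>)\<^sup>2"]
    by (auto simp: p_def if_distrib[of "hnorm H"] if_distrib[of "\<lambda>x. x\<^sup>2"] cong: if_cong)
  have "p \<in> nset c"
    using s assms by (intro nsetI) (auto simp: sums_iff p_def)
  moreover have "nfun p A = hinner H (A \<xi>) \<eta>" if A: "A \<in> bounded_ops H" for A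
  proof -
    have "(\<lambda>n. hinner H (A (fst p n)) (snd p n)) = (\<lambda>n. if n = 0 then hinner H (A \<xi>) \<eta> else 0)"
      using bounded_opsD(2)[OF A zero_in] by (auto simp: p_def)
    then show ?thesis
      using sums_single[of 0 "\<lambda>_. hinner H (A \<xi>) \<eta>"] by (simp add: nfun_def sums_iff)
  qed
  ultimately show ?thesis by blast
qed

text \<open>Countably many square summable sequences are merged into one along a bijection between \<open>\<nat> \<times> \<nat>\<close>
  and \<open>\<nat>\<close>, so that a norm convergent series of normal functionals is again a normal functional.\<close>

lemma sums_prod_decode:
  fixes g :: "nat \<times> nat \<Rightarrow> real"
  assumes g: "\<And>k. (\<lambda>n. g (k, n)) sums s k" and s: "s sums t" and nonneg: "\<And>k n. g (k, n) \<ge> 0"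
  shows "g summable_on UNIV" "(\<lambda>m. g (prod_decode m)) sums t"
proof -
  have s0: "s k \<ge> 0" for k
    using g[of k] suminf_nonneg[of "\<lambda>n. g (k, n)"] nonneg by (simp add: sums_iff)
  have hg: "((\<lambda>n. g (k, n)) has_sum s k) UNIV" for k
    by (rule sums_nonneg_imp_has_sum[OF g nonneg])
  have hs: "(s has_sum t) UNIV" by (rule sums_nonneg_imp_has_sum[OF s s0])
  then have sm: "s summable_on UNIV" by (auto simp: summable_on_def)
  have "g summable_on (SIGMA k:UNIV. UNIV)"
    using hg sm nonneg by (intro summable_on_SigmaI[where g = s]) auto
  then show sg: "g summable_on UNIV" by simp
  have "(g has_sum t) (SIGMA k:UNIV. UNIV)"
    using hg hs sg by (intro has_sum_SigmaI[where g = s]) auto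
  then have "(g has_sum t) UNIV" by simp
  then have "((\<lambda>m. g (prod_decode m)) has_sum t) UNIV"
    by (subst has_sum_reindex_bij_betw[OF bij_prod_decode])
  then show "(\<lambda>m. g (prod_decode m)) sums t" by (rule has_sum_imp_sums)
qed

lemma nset_countable_sum:
  assumes p: "\<And>k. p k \<in> nset (c k)" and c: "summable c"
  shows "\<exists>q\<in>nset (suminf c). \<forall>A\<in>bounded_ops H. (\<lambda>k. nfun (p k) A) sums nfun q A"
proof -
  define q where "q = ((\<lambda>m. fst (p (fst (prod_decode m))) (snd (prod_decode m))),
    (\<lambda>m. snd (p (fst (prod_decode m))) (snd (prod_decode m))))"
  define g1 where "g1 = (\<lambda>(k, n). (hnorm H (fst (p k) n))\<^sup>2)"
  define g2 where "g2 = (\<lambda>(k, n). (hnorm H (snd (p k) n))\<^sup>2)"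
  define s1 where "s1 k = (\<Sum>n. g1 (k, n))" for k
  define s2 where "s2 k = (\<Sum>n. g2 (k, n))" for k
  have g: "(\<lambda>n. g1 (k, n)) sums s1 k" "(\<lambda>n. g2 (k, n)) sums s2 k" for k
    using nsetD(3,4)[OF p[of k]] by (auto simp: g1_def g2_def s1_def s2_def intro: summable_sums)
  have le: "s1 k \<le> c k" "s2 k \<le> c k" for k
    using nsetD(5,6)[OF p[of k]] by (auto simp: s1_def s2_def g1_def g2_def)
  have pos: "g1 (k, n) \<ge> 0" "g2 (k, n) \<ge> 0" for k n by (auto simp: g1_def g2_def)
  have spos: "s1 k \<ge> 0" "s2 k \<ge> 0" for k
    using g[of k] suminf_nonneg[of "\<lambda>n. g1 (k, n)"] suminf_nonneg[of "\<lambda>n. g2 (k, n)"] pos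
    by (auto simp: sums_iff)
  have sm: "summable s1" "summable s2"
    using le spos by (auto intro!: summable_comparison_test'[OF c, of 0])
  have dec1: "g1 summable_on UNIV" "(\<lambda>m. g1 (prod_decode m)) sums suminf s1"
    using sums_prod_decode[of g1, OF g(1) summable_sums[OF sm(1)] pos(1)] by auto
  have dec2: "g2 summable_on UNIV" "(\<lambda>m. g2 (prod_decode m)) sums suminf s2"
    using sums_prod_decode[of g2, OF g(2) summable_sums[OF sm(2)] pos(2)] by auto
  have q1: "(hnorm H (fst q m))\<^sup>2 = g1 (prod_decode m)" and q2: "(hnorm H (snd q m))\<^sup>2 = g2 (prod_decode m)" for m
    by (simp_all add: q_def g1_def g2_def case_prod_beta)
  have q: "q \<in> nset (suminf c)"
  proof (rule nsetI)
    show "fst q n \<in> hcarrier H" "snd q n \<in> hcarrier H" for n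
      using nsetD(1,2)[OF p] by (auto simp: q_def)
    show "summable (\<lambda>n. (hnorm H (fst q n))\<^sup>2)" "summable (\<lambda>n. (hnorm H (snd q n))\<^sup>2)"
      unfolding q1 q2 using dec1 dec2 by (auto simp: sums_iff)
    show "(\<Sum>n. (hnorm H (fst q n))\<^sup>2) \<le> suminf c" "(\<Sum>n. (hnorm H (snd q n))\<^sup>2) \<le> suminf c"
      unfolding q1 q2 using dec1 dec2 suminf_le[OF le(1) sm(1) c] suminf_le[OF le(2) sm(2) c]
      by (auto simp: sums_iff)
  qed
  have "(\<lambda>k. nfun (p k) A) sums nfun q A" if A: "A \<in> bounded_ops H" for A
  proof -
    define F where "F = (\<lambda>(k, n). hinner H (A (fst (p k) n)) (snd (p k) n))"
    have Fle: "cmod (F s) \<le> op_norm H A * ((g1 s + g2 s) / 2)" for s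
      using nfun_term_le[OF p[of "fst s"] A, of "snd s"] by (simp add: F_def g1_def g2_def case_prod_beta)
    have "(\<lambda>s. op_norm H A * ((g1 s + g2 s) / 2)) summable_on UNIV"
      using summable_on_cmult_right[OF summable_on_add[OF dec1(1) dec2(1)], of "op_norm H A / 2"] by simp
    then have "(\<lambda>s. norm (F s)) summable_on UNIV"
      by (rule summable_on_comparison_test) (use Fle in auto)
    then have F: "F summable_on UNIV" by (rule abs_summable_summable)
    have "((\<lambda>m. F (prod_decode m)) has_sum infsum F UNIV) UNIV"
      by (subst has_sum_reindex_bij_betw[OF bij_prod_decode]) (rule has_sum_infsum[OF F])
    then have "(\<lambda>m. F (prod_decode m)) sums infsum F UNIV" by (rule has_sum_imp_sums)
    moreover have "F (prod_decode m) = hinner H (A (fst q m)) (snd q m)" for m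
      by (simp add: F_def q_def case_prod_beta)
    ultimately have 1: "nfun q A = infsum F UNIV" by (simp add: nfun_def sums_iff)
    have 2: "((\<lambda>n. F (k, n)) has_sum nfun (p k) A) UNIV" for k
      using norm_summable_imp_has_sum[OF nfun_summable[OF p[of k] A] nfun_sums[OF p[of k] A]]
      by (simp add: F_def)
    have "(F has_sum infsum F UNIV) (SIGMA k:UNIV. UNIV)"
      using has_sum_infsum[OF F] by simp
    then have "((\<lambda>k. nfun (p k) A) has_sum infsum F UNIV) UNIV"
      by (rule has_sum_SigmaD) (rule 2)
    then show ?thesis unfolding 1 by (rule has_sum_imp_sums)
  qed
  then show ?thesis using q by blast
qed

lemma nset_add:
  assumes p: "p \<in> nset c" and q: "q \<in> nset d"
  shows "\<exists>r\<in>nset (c + d). \<forall>A\<in>bounded_ops H. nfun r A = nfun p A + nfun q A"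
proof -
  define P where "P k = (if k = 0 then p else if k = 1 then q else ((\<lambda>_. 0), (\<lambda>_. 0)))" for k :: nat
  define C where "C k = (if k = 0 then c else if k = 1 then d else 0)" for k :: nat
  have z: "((\<lambda>_. 0), (\<lambda>_. 0)) \<in> nset 0" by (rule nsetI) auto
  have P: "P k \<in> nset (C k)" for k using p q z by (auto simp: P_def C_def)
  have C: "C sums (c + d)"
  proof -
    have "C sums (\<Sum>k\<in>{0, 1}. C k)" by (rule sums_finite) (auto simp: C_def)
    then show ?thesis by (simp add: C_def)
  qed
  obtain r where r: "r \<in> nset (suminf C)" "\<And>A. A \<in> bounded_ops H \<Longrightarrow> (\<lambda>k. nfun (P k) A) sums nfun r A"
    using nset_countable_sum[OF P sums_summable[OF C]] by blast
  have "nfun r A = nfun p A + nfun q A" if A: "A \<in> bounded_ops H" for A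
  proof -
    have "nfun (P k) A = 0" if "k \<notin> {0, 1}" for k
      using that bounded_opsD(2)[OF A zero_in] by (simp add: P_def nfun_def)
    then have "(\<lambda>k. nfun (P k) A) sums (\<Sum>k\<in>{0, 1}. nfun (P k) A)" by (intro sums_finite) auto
    then show ?thesis using sums_unique2[OF r(2)[OF A]] by (simp add: P_def)
  qed
  then show ?thesis using r(1) C by (auto simp: sums_iff)
qed

end

section \<open>The representation and the predual\<close>

context dual_unital_operator_space
begin

text \<open>The functional \<open>g\<close> belongs to the predual.\<close>

definition represented :: "(('h \<Rightarrow> 'h) \<Rightarrow> complex) \<Rightarrow> bool" where
  "represented g \<longleftrightarrow> (\<exists>v\<in>V. \<forall>x\<in>X. g x = T x v)"

lemma represented_add: "represented f \<Longrightarrow> represented g \<Longrightarrow> represented (\<lambda>x. f x + g x)"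
  unfolding represented_def by (metis T_add_right V_add)

lemma represented_scale: "represented f \<Longrightarrow> represented (\<lambda>x. c * f x)"
  unfolding represented_def by (metis T_scale_right V_scale)

lemma represented_zero: "represented (\<lambda>x. 0)"
  unfolding represented_def using V_zero T_zero_right by (intro bexI[of _ 0]) auto

lemma represented_sum:
  "(\<And>i. i \<in> I \<Longrightarrow> represented (f i)) \<Longrightarrow> represented (\<lambda>x. \<Sum>i\<in>I. f i x)"
  by (induction I rule: infinite_finite_induct) (simp_all add: represented_zero represented_add)

lemma represented_cong: "represented f \<Longrightarrow> (\<And>x. x \<in> X \<Longrightarrow> f x = g x) \<Longrightarrow> represented g"
  by (simp add: represented_def)

text \<open>The predual is norm closed among the functionals on \<open>X\<close>, because \<open>V\<close> is complete and is normed by \<open>X\<close>.\<close>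

lemma represented_limit:
  assumes "\<And>e. e > 0 \<Longrightarrow> \<exists>f. represented f \<and> (\<forall>x\<in>X. cmod (g x - f x) \<le> e * op_norm H x)"
  shows "represented g"
proof -
  have "\<exists>v\<in>V. \<forall>x\<in>X. cmod (g x - T x v) \<le> 1 / 2 ^ k * op_norm H x" for k :: nat
  proof -
    obtain f where f: "represented f" "\<And>x. x \<in> X \<Longrightarrow> cmod (g x - f x) \<le> 1 / 2 ^ k * op_norm H x"
      using assms[of "1 / 2 ^ k"] by auto
    then obtain v where "v \<in> V" "\<And>x. x \<in> X \<Longrightarrow> f x = T x v" by (auto simp: represented_def)
    then show ?thesis using f(2) by (intro bexI[of _ v]) auto
  qed
  then obtain s where s: "\<And>k. s k \<in> V" "\<And>k x. x \<in> X \<Longrightarrow> cmod (g x - T x (s k)) \<le> 1 / 2 ^ k * op_norm H x"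
    by metis
  have "op_norm K (s (Suc k) - s k) \<le> 2 / 2 ^ k" for k
  proof (rule predual_norm_le)
    fix x assume x: "x \<in> X"
    have "T x (s (Suc k) - s k) = (g x - T x (s k)) - (g x - T x (s (Suc k)))"
      using x s(1) by (simp add: T_diff_right)
    then have "cmod (T x (s (Suc k) - s k)) \<le> cmod (g x - T x (s k)) + cmod (g x - T x (s (Suc k)))"
      using norm_triangle_ineq4 by metis
    also have "\<dots> \<le> 1 / 2 ^ k * op_norm H x + 1 / 2 ^ Suc k * op_norm H x"
      by (intro add_mono s(2) x)
    also have "\<dots> \<le> 2 / 2 ^ k * op_norm H x"
      using norm_nonneg(1)[OF x] by (simp add: field_simps)
    finally show "cmod (T x (s (Suc k) - s k)) \<le> 2 / 2 ^ k * op_norm H x" .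
  qed (use s V_diff in auto)
  then obtain v where v: "v \<in> V" "\<And>k. op_norm K (s k - v) \<le> 2 * 2 / 2 ^ k"
    using predual_geometric_limit[of s 2] s(1) by auto
  have "g x = T x v" if x: "x \<in> X" for x
  proof -
    have "cmod (g x - T x v) \<le> 5 * op_norm H x / 2 ^ k" for k
    proof -
      have "cmod (g x - T x v) \<le> cmod (g x - T x (s k)) + cmod (T x (s k - v))"
        using norm_triangle_ineq[of "g x - T x (s k)" "T x (s k - v)"] x s(1) v(1) by (simp add: T_diff_right)
      also have "\<dots> \<le> 1 / 2 ^ k * op_norm H x + op_norm H x * (2 * 2 / 2 ^ k)"
        using pairing_le[OF x V_diff[OF s(1)[of k] v(1)]] mult_left_mono[OF v(2)[of k] norm_nonneg(1)[OF x]]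
        by (intro add_mono s(2) x) linarith
      finally show ?thesis by (simp add: field_simps)
    qed
    moreover have "(\<lambda>k. 5 * op_norm H x / 2 ^ k) \<longlonglongrightarrow> 0"
      using tendsto_mult_right_zero[OF LIMSEQ_power_zero[of "1/2::real"], of "5 * op_norm H x"]
      by (simp add: power_divide)
    ultimately have "cmod (g x - T x v) \<le> 0" by (intro LIMSEQ_le_const) auto
    then show ?thesis by simp
  qed
  then show ?thesis using v(1) by (auto simp: represented_def)
qed

text \<open>Since \<open>\<Phi>\<close> is block diagonal with finite blocks, truncating only \<open>\<eta>\<close> to finitely many coordinates leaves a
  finite combination of entries of matrix states, and these lie in the predual.\<close>

lemma represented_coefficient:
  assumes \<xi>: "\<xi> \<in> hcarrier L" and \<eta>: "\<eta> \<in> hcarrier L"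
  shows "represented (\<lambda>x. hinner L (\<Phi> x \<xi>) \<eta>)"
proof (rule represented_limit)
  fix e :: real assume e: "e > 0"
  define d where "d = e / (hnorm L \<xi> + 1)"
  have d: "d > 0" "hnorm L \<xi> * d \<le> e" using e L.hnorm_nonneg[OF \<xi>] by (auto simp: d_def field_simps)
  obtain F where F: "F \<subseteq> blocks states" "finite F" "restrict_vec F \<eta> \<in> hcarrier L"
    "hnorm L (\<eta> - restrict_vec F \<eta>) \<le> d"
    using ell2_truncation[of \<eta> "blocks states" d] \<eta> d(1) unfolding L_def by blast
  define \<eta>' where "\<eta>' = restrict_vec F \<eta>"
  have "represented (\<lambda>x. \<Sum>s\<in>F. \<Phi> x \<xi> s * cnj (\<eta> s))"
  proof (rule represented_sum)
    fix s assume "s \<in> F"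
    then obtain k \<phi> a where s: "s = (k, \<phi>, a)" "(k, \<phi>) \<in> states" "a < k"
      using F(1) by (cases s) (auto simp: blocks_def)
    obtain w where w: "w \<in> mats k V" "\<And>x a b. x \<in> X \<Longrightarrow> a < k \<Longrightarrow> b < k \<Longrightarrow> \<phi> x a b = T x (w a b)"
      using stateD(1)[OF s(2)] by blast
    have "represented (\<lambda>x. \<Sum>b<k. (\<xi> (k, \<phi>, b) * cnj (\<eta> s)) * \<phi> x a b)"
    proof (intro represented_sum represented_scale)
      fix b assume "b \<in> {..<k}"
      then show "represented (\<lambda>x. \<phi> x a b)"
        unfolding represented_def using w s(3) by (intro bexI[of _ "w a b"]) (auto simp: mats_def)
    qed
    then show "represented (\<lambda>x. \<Phi> x \<xi> s * cnj (\<eta> s))"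
      by (rule represented_cong) (simp add: s \<Phi>_apply[OF \<xi> s(2,3)] sum_distrib_right sum_distrib_left mult_ac)
  qed
  moreover have "hinner L (\<Phi> x \<xi>) \<eta>' = (\<Sum>s\<in>F. \<Phi> x \<xi> s * cnj (\<eta> s))" for x
    unfolding L_def using F(2) by (subst ell2_inner_finite[of F]) (auto simp: \<eta>'_def restrict_vec_def)
  ultimately have rep: "represented (\<lambda>x. hinner L (\<Phi> x \<xi>) \<eta>')" by simp
  have "cmod (hinner L (\<Phi> x \<xi>) \<eta> - hinner L (\<Phi> x \<xi>) \<eta>') \<le> e * op_norm H x" if x: "x \<in> X" for x
  proof -
    have \<eta>': "\<eta>' \<in> hcarrier L" using F by (simp add: \<eta>'_def)
    have y: "\<Phi> x \<xi> \<in> hcarrier L" using L.bounded_opsD(2)[OF \<Phi>_bounded[OF x] \<xi>] .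
    have "hinner L (\<Phi> x \<xi>) \<eta> = hinner L (\<Phi> x \<xi>) ((\<eta> - \<eta>') + \<eta>')" by simp
    also have "\<dots> = hinner L (\<Phi> x \<xi>) (\<eta> - \<eta>') + hinner L (\<Phi> x \<xi>) \<eta>'"
      using y \<eta> \<eta>' by (intro L.inner_add_right L.diff_in)
    finally have "cmod (hinner L (\<Phi> x \<xi>) \<eta> - hinner L (\<Phi> x \<xi>) \<eta>') = cmod (hinner L (\<Phi> x \<xi>) (\<eta> - \<eta>'))"
      by simp
    also have "\<dots> \<le> op_norm H x * hnorm L \<xi> * hnorm L (\<eta> - \<eta>')"
      using L.op_norm_form[OF \<Phi>_bounded[OF x] \<xi>, of "\<eta> - \<eta>'"] \<eta> \<eta>' by (simp add: \<Phi>_norm[OF x])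
    also have "\<dots> \<le> op_norm H x * hnorm L \<xi> * d"
      using F(4) norm_nonneg(1)[OF x] \<xi> by (intro mult_left_mono) (auto simp: \<eta>'_def)
    also have "\<dots> \<le> e * op_norm H x"
      using mult_left_mono[OF d(2) norm_nonneg(1)[OF x]] by (simp add: mult_ac)
    finally show ?thesis .
  qed
  then show "\<exists>f. represented f \<and> (\<forall>x\<in>X. cmod (hinner L (\<Phi> x \<xi>) \<eta> - f x) \<le> e * op_norm H x)"
    using rep by blast
qed

theorem represented_normal:
  assumes p: "p \<in> L.nset c"
  shows "represented (\<lambda>x. L.nfun p (\<Phi> x))"
proof (rule represented_limit)
  fix e :: real assume e: "e > 0"
  define h where "h n = ((hnorm L (fst p n))\<^sup>2 + (hnorm L (snd p n))\<^sup>2) / 2" for n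
  have lim: "(\<lambda>N. \<Sum>n. h (n + N)) \<longlonglongrightarrow> 0"
    using L.nset_summable(1)[OF p] unfolding h_def[symmetric] by (rule suminf_exist_split2)
  then obtain N where N: "(\<Sum>n. h (n + N)) < e"
    using order_tendstoD(2)[OF lim e] by (auto simp: eventually_sequentially)
  have "represented (\<lambda>x. \<Sum>n<N. hinner L (\<Phi> x (fst p n)) (snd p n))"
    by (intro represented_sum represented_coefficient L.nsetD[OF p])
  moreover have "cmod (L.nfun p (\<Phi> x) - (\<Sum>n<N. hinner L (\<Phi> x (fst p n)) (snd p n))) \<le> e * op_norm H x"
    if x: "x \<in> X" for x
    using L.nfun_tail_le[OF p \<Phi>_bounded[OF x], of N] mult_left_mono[OF less_imp_le[OF N] norm_nonneg(1)[OF x]]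
    by (simp add: h_def \<Phi>_norm[OF x] mult.commute)
  ultimately show "\<exists>f. represented f \<and> (\<forall>x\<in>X. cmod (L.nfun p (\<Phi> x) - f x) \<le> e * op_norm H x)"
    by blast
qed

lemma norming_vectors:
  assumes x: "x \<in> X"
  shows "\<exists>\<xi>\<in>hcarrier L. \<exists>\<eta>\<in>hcarrier L. hnorm L \<xi> \<le> 1 \<and> hnorm L \<eta> \<le> 1 \<and>
    op_norm H x \<le> 2 * Re (hinner L (\<Phi> x \<xi>) \<eta>)"
proof (cases "op_norm H x = 0")
  case True
  then show ?thesis
    using L.inner_zero_right[OF L.bounded_opsD(2)[OF \<Phi>_bounded[OF x] L.zero_in]]
    by (intro bexI[of _ 0] conjI) auto
next
  case False
  then have pos: "op_norm H x > 0" using norm_nonneg(1)[OF x] by simp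
  note bd = \<Phi>_bounded[OF x]
  have "\<not> (\<forall>\<xi>\<in>hcarrier L. hnorm L (\<Phi> x \<xi>) \<le> op_norm H x / 2 * hnorm L \<xi>)"
    using L.op_norm_le[OF bd, of "op_norm H x / 2"] pos by (auto simp: \<Phi>_norm[OF x])
  then obtain \<zeta> where \<zeta>: "\<zeta> \<in> hcarrier L" "hnorm L (\<Phi> x \<zeta>) > op_norm H x / 2 * hnorm L \<zeta>" by force
  have y: "\<Phi> x \<zeta> \<in> hcarrier L" using L.bounded_opsD(2)[OF bd \<zeta>(1)] .
  have "hnorm L \<zeta> \<noteq> 0"
  proof
    assume "hnorm L \<zeta> = 0"
    then have "hnorm L (\<Phi> x \<zeta>) \<le> 0" using L.op_norm_apply[OF bd \<zeta>(1)] by simp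
    then show False using \<zeta> \<open>hnorm L \<zeta> = 0\<close> by simp
  qed
  then have z: "hnorm L \<zeta> > 0" using L.hnorm_nonneg[OF \<zeta>(1)] by linarith
  then have yp: "hnorm L (\<Phi> x \<zeta>) > 0"
    using \<zeta>(2) mult_pos_pos[OF half_gt_zero[OF pos] z] by linarith
  define \<xi> where "\<xi> = complex_of_real (1 / hnorm L \<zeta>) *\<^sub>C \<zeta>"
  define \<eta> where "\<eta> = complex_of_real (1 / hnorm L (\<Phi> x \<zeta>)) *\<^sub>C \<Phi> x \<zeta>"
  have "\<Phi> x \<xi> = complex_of_real (1 / hnorm L \<zeta>) *\<^sub>C \<Phi> x \<zeta>"
    unfolding \<xi>_def by (rule clinear_on_scaleC[OF L.bounded_opsD(1)[OF bd] \<zeta>(1)])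
  then have "hinner L (\<Phi> x \<xi>) \<eta> = complex_of_real (1 / hnorm L \<zeta>) * (cnj (complex_of_real (1 / hnorm L (\<Phi> x \<zeta>)))
      * complex_of_real ((hnorm L (\<Phi> x \<zeta>))\<^sup>2))"
    using y by (simp only: \<eta>_def L.inner_scaleC_left L.inner_scaleC_right L.scaleC_in L.inner_self mult_ac)
  also have "\<dots> = complex_of_real (hnorm L (\<Phi> x \<zeta>) / hnorm L \<zeta>)"
    using yp by (simp add: power2_eq_square)
  finally have "Re (hinner L (\<Phi> x \<xi>) \<eta>) = hnorm L (\<Phi> x \<zeta>) / hnorm L \<zeta>" by simp
  also have "\<dots> > op_norm H x / 2" using \<zeta>(2) z by (simp add: pos_less_divide_eq)
  finally have "op_norm H x \<le> 2 * Re (hinner L (\<Phi> x \<xi>) \<eta>)" by simp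
  moreover have "\<xi> \<in> hcarrier L" "\<eta> \<in> hcarrier L" "hnorm L \<xi> = 1" "hnorm L \<eta> = 1"
    using \<zeta>(1) y z yp by (auto simp: \<xi>_def \<eta>_def norm_divide)
  ultimately show ?thesis by (intro bexI[of _ \<xi>] bexI[of _ \<eta>]) auto
qed

text \<open>The unit ball is invariant under rotations by complex scalars of modulus \<open>1\<close>, so that a lower bound for the real part
  bounds the modulus.\<close>

lemma homogeneous_bound:
  assumes f: "clinear_on X f" and le: "\<And>x. x \<in> unit_ball \<Longrightarrow> Re (f x) > - a" and x: "x \<in> X"
  shows "cmod (f x) \<le> a * op_norm H x"
proof -
  have le': "cmod (f y) \<le> a" if y: "y \<in> unit_ball" for y
  proof (cases "f y = 0")
    case True
    have "(0::'h \<Rightarrow> 'h) \<in> unit_ball" using X_zero by (simp add: unit_ball_def)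
    then show ?thesis using le[of 0] clinear_on_zero[OF f X_csub] True by simp
  next
    case False
    define c where "c = - of_real (cmod (f y)) / f y"
    have yX: "y \<in> X" using y by (simp add: unit_ball_def)
    have "cmod c = 1" using False by (simp add: c_def norm_divide)
    then have "c *\<^sub>C y \<in> unit_ball" using y yX by (simp add: unit_ball_def X_scale norm_mono_scaleC)
    from le[OF this] have "Re (c * f y) > - a"
      using clinear_on_scaleC[OF f yX, of c] by (simp add: scaleC_complex_def)
    moreover have "c * f y = - of_real (cmod (f y))" using False by (simp add: c_def)
    ultimately show ?thesis by simp
  qed
  show ?thesis
  proof (rule field_le_epsilon)
    fix e :: real assume e: "e > 0"
    have "(0::'h \<Rightarrow> 'h) \<in> unit_ball" using X_zero by (simp add: unit_ball_def)
    then have a: "a > 0" using le[of 0] clinear_on_zero[OF f X_csub] by simp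
    define r where "r = op_norm H x + e / a"
    have r: "r > 0" "op_norm H x \<le> r" using norm_nonneg(1)[OF x] e a by (auto simp: r_def add_nonneg_pos)
    have "complex_of_real (1 / r) *\<^sub>C x \<in> unit_ball"
      using r x norm_mono_scaleC(2)[OF x, of "complex_of_real (1 / r)"] by (simp add: unit_ball_def X_scale norm_divide)
    from le'[OF this] have "cmod (f x) / r \<le> a"
      using clinear_on_scaleC[OF f x, of "complex_of_real (1 / r)"] r(1)
      by (simp add: scaleC_complex_def norm_mult norm_divide)
    then have "cmod (f x) \<le> a * r" using r(1) by (simp add: pos_divide_le_eq)
    also have "\<dots> = a * op_norm H x + e" using a by (simp add: r_def field_simps)
    finally show "cmod (f x) \<le> a * op_norm H x + e" .
  qed
qed

text \<open>By minimax on the unit ball, the normal functional may depend on \<open>x\<close>.  For a single \<open>x\<close>, the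
  value of \<open>v\<close> has real part at most \<open>\<epsilon> \<parallel>x\<parallel>\<close>, which a vector functional of norm \<open>2 \<epsilon>\<close> attains at \<open>\<Phi> x\<close>, as \<open>\<Phi>\<close> is isometric.\<close>

lemma approximate_lifting:
  assumes v: "v \<in> V" "op_norm K v \<le> \<epsilon>" and \<epsilon>: "\<epsilon> > 0"
  shows "\<exists>p\<in>L.nset (2 * \<epsilon>). \<exists>v'\<in>V. op_norm K v' \<le> \<epsilon> / 2 \<and> (\<forall>x\<in>X. T x v' = T x v - L.nfun p (\<Phi> x))"
proof -
  define Y where "Y = subtopology weakstar unit_ball"
  have unit_ballX: "unit_ball \<subseteq> X" by (auto simp: unit_ball_def)
  have top: "topspace Y = unit_ball" using unit_ballX by (auto simp: Y_def)
  define \<Theta> where "\<Theta> = (\<lambda>p x. Re (L.nfun p (\<Phi> x)) - Re (T x v) + \<epsilon> / 2) ` L.nset (2 * \<epsilon>)"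
  have "\<exists>f\<in>\<Theta>. \<forall>x\<in>topspace Y. f x > 0"
  proof (rule minimax)
    show "compact_space Y" unfolding Y_def by (rule compact_space_subtopology[OF compactin_unit_ball])
    show "\<Theta> \<noteq> {}"
      using L.vector_functional[OF L.zero_in L.zero_in, of "2 * \<epsilon>"] \<epsilon> by (auto simp: \<Theta>_def)
    show "continuous_map Y euclideanreal f" if f: "f \<in> \<Theta>" for f
    proof -
      obtain p where p: "p \<in> L.nset (2 * \<epsilon>)" "f = (\<lambda>x. Re (L.nfun p (\<Phi> x)) - Re (T x v) + \<epsilon> / 2)"
        using f by (auto simp: \<Theta>_def)
      obtain u where u: "u \<in> V" "\<And>x. x \<in> X \<Longrightarrow> L.nfun p (\<Phi> x) = T x u"
        using represented_normal[OF p(1)] by (auto simp: represented_def)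
      have Re: "continuous_map Y euclideanreal (\<lambda>x. Re (T x w))" if "w \<in> V" for w
      proof -
        have "continuous_map weakstar euclideanreal (Re \<circ> (\<lambda>x. T x w))"
          using that by (intro continuous_map_compose[OF continuous_map_eval]) (auto simp: continuous_on_Re)
        then show ?thesis unfolding Y_def o_def by (rule continuous_map_from_subtopology)
      qed
      have "continuous_map Y euclideanreal (\<lambda>x. Re (T x u) - Re (T x v) + \<epsilon> / 2)"
        by (intro continuous_map_add continuous_map_diff Re u v) simp
      then show ?thesis
        unfolding p(2) by (rule continuous_map_eq) (use u unit_ballX in \<open>auto simp: top\<close>)
    qed
    show "\<exists>e\<in>topspace Y. \<forall>f\<in>\<Theta>. f e = (1 - t) * f c + t * f d"
      if c: "c \<in> topspace Y" and d: "d \<in> topspace Y" and t: "0 \<le> t" "t \<le> 1" for c d t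
    proof
      let ?e = "complex_of_real (1 - t) *\<^sub>C c + complex_of_real t *\<^sub>C d"
      show "?e \<in> topspace Y" using convex_unit_ball[of c d t] c d t by (simp only: top)
      have cX: "c \<in> X" "d \<in> X" using c d unit_ballX by (auto simp: top)
      have \<Phi>e: "\<Phi> ?e = complex_of_real (1 - t) *\<^sub>C \<Phi> c + complex_of_real t *\<^sub>C \<Phi> d"
        using cX by (simp only: \<Phi>_add \<Phi>_scale X_scale)
      have Te: "T ?e v = complex_of_real (1 - t) * T c v + complex_of_real t * T d v"
        using cX by (simp only: T_add T_scale X_scale)
      show "\<forall>f\<in>\<Theta>. f ?e = (1 - t) * f c + t * f d"
      proof
        fix f assume "f \<in> \<Theta>"
        then obtain p where p: "p \<in> L.nset (2 * \<epsilon>)" "f = (\<lambda>x. Re (L.nfun p (\<Phi> x)) - Re (T x v) + \<epsilon> / 2)"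
          by (auto simp: \<Theta>_def)
        have ne: "L.nfun p (\<Phi> ?e) = complex_of_real (1 - t) * L.nfun p (\<Phi> c) + complex_of_real t * L.nfun p (\<Phi> d)"
          unfolding \<Phi>e using \<Phi>_bounded[OF cX(1)] \<Phi>_bounded[OF cX(2)]
          by (simp only: L.nfun_add[OF p(1)] L.nfun_scale_op[OF p(1)]
              complex_vector.subspace_scale[OF L.csubspace_bounded_ops])
        show "f ?e = (1 - t) * f c + t * f d"
          unfolding p(2) ne Te by (simp add: field_simps)
      qed
    qed
    show "\<exists>h\<in>\<Theta>. \<forall>x\<in>topspace Y. h x = (1 - t) * f x + t * g x"
      if fg: "f \<in> \<Theta>" "g \<in> \<Theta>" and t: "0 \<le> t" "t \<le> 1" for f g t
    proof -
      obtain p q where p: "p \<in> L.nset (2 * \<epsilon>)" "f = (\<lambda>x. Re (L.nfun p (\<Phi> x)) - Re (T x v) + \<epsilon> / 2)"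
        and q: "q \<in> L.nset (2 * \<epsilon>)" "g = (\<lambda>x. Re (L.nfun q (\<Phi> x)) - Re (T x v) + \<epsilon> / 2)"
        using fg by (auto simp: \<Theta>_def)
      obtain p' where p': "p' \<in> L.nset (cmod (complex_of_real (1 - t)) * (2 * \<epsilon>))"
        "\<And>A. A \<in> bounded_ops L \<Longrightarrow> L.nfun p' A = complex_of_real (1 - t) * L.nfun p A"
        using L.nset_scale[OF p(1)] by blast
      obtain q' where q': "q' \<in> L.nset (cmod (complex_of_real t) * (2 * \<epsilon>))"
        "\<And>A. A \<in> bounded_ops L \<Longrightarrow> L.nfun q' A = complex_of_real t * L.nfun q A"
        using L.nset_scale[OF q(1)] by blast
      obtain r where r: "r \<in> L.nset (cmod (complex_of_real (1 - t)) * (2 * \<epsilon>) + cmod (complex_of_real t) * (2 * \<epsilon>))"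
        "\<And>A. A \<in> bounded_ops L \<Longrightarrow> L.nfun r A = L.nfun p' A + L.nfun q' A"
        using L.nset_add[OF p'(1) q'(1)] by blast
      have "cmod (complex_of_real (1 - t)) * (2 * \<epsilon>) + cmod (complex_of_real t) * (2 * \<epsilon>) = 2 * \<epsilon>"
        unfolding norm_of_real using t by (simp add: algebra_simps)
      then have r1: "r \<in> L.nset (2 * \<epsilon>)" using r(1) by (simp only:)
      have "Re (L.nfun r (\<Phi> x)) - Re (T x v) + \<epsilon> / 2 = (1 - t) * f x + t * g x" if "x \<in> topspace Y" for x
      proof -
        have x: "\<Phi> x \<in> bounded_ops L" using that unit_ballX by (auto simp: top intro: \<Phi>_bounded)
        show ?thesis unfolding p(2) q(2) r(2)[OF x] p'(2)[OF x] q'(2)[OF x] by (simp add: field_simps)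
      qed
      then have "\<forall>x\<in>topspace Y. Re (L.nfun r (\<Phi> x)) - Re (T x v) + \<epsilon> / 2 = (1 - t) * f x + t * g x"
        by (rule ballI)
      moreover have "(\<lambda>x. Re (L.nfun r (\<Phi> x)) - Re (T x v) + \<epsilon> / 2) \<in> \<Theta>"
        unfolding \<Theta>_def by (rule imageI[OF r1])
      ultimately show ?thesis by (rule bexI)
    qed
    show "\<exists>f\<in>\<Theta>. f x > 0" if "x \<in> topspace Y" for x
    proof -
      have x: "x \<in> X" using that unit_ballX by (auto simp: top)
      obtain \<xi> \<eta> where \<xi>: "\<xi> \<in> hcarrier L" "\<eta> \<in> hcarrier L" "hnorm L \<xi> \<le> 1" "hnorm L \<eta> \<le> 1"
        "op_norm H x \<le> 2 * Re (hinner L (\<Phi> x \<xi>) \<eta>)" using norming_vectors[OF x] by blast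
      have "(hnorm L \<xi>)\<^sup>2 \<le> 1" "(hnorm L \<eta>)\<^sup>2 \<le> 1"
        using \<xi> by (auto simp: power_le_one)
      then obtain p where p: "p \<in> L.nset 1" "L.nfun p (\<Phi> x) = hinner L (\<Phi> x \<xi>) \<eta>"
        using L.vector_functional[OF \<xi>(1,2), of 1] \<Phi>_bounded[OF x] by blast
      obtain q where q: "q \<in> L.nset (cmod (of_real (2 * \<epsilon>)) * 1)"
        "L.nfun q (\<Phi> x) = of_real (2 * \<epsilon>) * L.nfun p (\<Phi> x)"
        using L.nset_scale[OF p(1), of "of_real (2 * \<epsilon>)"] \<Phi>_bounded[OF x] by blast
      have "cmod (of_real (2 * \<epsilon>)) * 1 = 2 * \<epsilon>" unfolding norm_of_real using \<epsilon> by simp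
      then have q1: "q \<in> L.nset (2 * \<epsilon>)" using q(1) by (simp only:)
      have "Re (T x v) \<le> op_norm H x * \<epsilon>"
        using pairing_le[OF x v(1)] mult_left_mono[OF v(2) norm_nonneg(1)[OF x]]
          complex_Re_le_cmod[of "T x v"] by linarith
      also have "\<dots> \<le> 2 * Re (hinner L (\<Phi> x \<xi>) \<eta>) * \<epsilon>" using \<xi>(5) \<epsilon> by (intro mult_right_mono) auto
      also have "\<dots> = Re (L.nfun q (\<Phi> x))" unfolding q(2) p(2) by simp
      finally have "Re (L.nfun q (\<Phi> x)) - Re (T x v) + \<epsilon> / 2 > 0" using \<epsilon> by linarith
      then show ?thesis
        by (intro bexI[of _ "\<lambda>x. Re (L.nfun q (\<Phi> x)) - Re (T x v) + \<epsilon> / 2"]) (auto simp: \<Theta>_def q1)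
    qed
  qed
  then obtain p where p: "p \<in> L.nset (2 * \<epsilon>)"
    "\<And>x. x \<in> unit_ball \<Longrightarrow> Re (L.nfun p (\<Phi> x)) - Re (T x v) + \<epsilon> / 2 > 0"
    by (auto simp: \<Theta>_def top)
  obtain u where u: "u \<in> V" "\<And>x. x \<in> X \<Longrightarrow> L.nfun p (\<Phi> x) = T x u"
    using represented_normal[OF p(1)] by (auto simp: represented_def)
  have "op_norm K (v - u) \<le> \<epsilon> / 2"
  proof (rule predual_norm_le)
    fix x assume x: "x \<in> X"
    have lin: "clinear_on X (\<lambda>x. T x (u - v))" by (rule T_clinear_left)
    have "cmod (T x (u - v)) \<le> \<epsilon> / 2 * op_norm H x"
    proof (rule homogeneous_bound[OF lin _ x])
      fix y assume y: "y \<in> unit_ball"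
      then have "y \<in> X" by (simp add: unit_ball_def)
      then show "Re (T y (u - v)) > - (\<epsilon> / 2)"
        using p(2)[OF y] u v by (simp add: T_diff_right)
    qed
    then show "cmod (T x (v - u)) \<le> \<epsilon> / 2 * op_norm H x"
      using x u v by (simp add: T_diff_right norm_minus_commute)
  qed (use u v \<epsilon> V_diff in auto)
  moreover have "T x (v - u) = T x v - L.nfun p (\<Phi> x)" if "x \<in> X" for x
    using that u v by (simp add: T_diff_right)
  ultimately show ?thesis using p(1) V_diff[OF v(1) u(1)] by blast
qed

text \<open>Iterating \<open>approximate_lifting\<close> on the remainders gives a series of normal functionals of norms at most
  \<open>2 \<parallel>v\<parallel> / 2\<^sup>k\<close>; the sum of these bounds is \<open>4 \<parallel>v\<parallel>\<close>.\<close>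

theorem predual_lifting:
  assumes v: "v \<in> V"
  shows "\<exists>p\<in>L.nset (4 * op_norm K v). \<forall>x\<in>X. L.nfun p (\<Phi> x) = T x v"
proof (cases "op_norm K v = 0")
  case True
  then have "v = 0" using norm_zero_imp_zero[OF v] by simp
  moreover obtain p where "p \<in> L.nset 0" "\<And>A. A \<in> bounded_ops L \<Longrightarrow> L.nfun p A = hinner L (A 0) 0"
    using L.vector_functional[OF L.zero_in L.zero_in, of 0] by auto
  ultimately show ?thesis
    using True \<Phi>_bounded L.bounded_opsD(2)[OF \<Phi>_bounded L.zero_in] T_zero_right by (intro bexI[of _ p]) auto
next
  case False
  define \<epsilon> where "\<epsilon> k = op_norm K v / 2 ^ k" for k :: nat
  have \<epsilon>: "\<epsilon> k > 0" for k using False norm_nonneg(2)[OF v] by (simp add: \<epsilon>_def)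
  define P where "P k u \<longleftrightarrow> u \<in> V \<and> op_norm K u \<le> \<epsilon> k \<and> (k = 0 \<longrightarrow> u = v)" for k u
  define Q where "Q k u u' \<longleftrightarrow> (\<exists>p\<in>L.nset (2 * \<epsilon> k). \<forall>x\<in>X. T x u' = T x u - L.nfun p (\<Phi> x))" for k u u'
  have "\<exists>s. \<forall>k. P k (s k) \<and> Q k (s k) (s (Suc k))"
  proof (rule dependent_nat_choice)
    show "\<exists>u. P 0 u" using v by (auto simp: P_def \<epsilon>_def)
    show "\<exists>u'. P (Suc k) u' \<and> Q k u u'" if "P k u" for u k
    proof -
      have "\<epsilon> (Suc k) = \<epsilon> k / 2" by (simp add: \<epsilon>_def)
      then show ?thesis
        using approximate_lifting[of u "\<epsilon> k"] that \<epsilon>[of k] unfolding P_def Q_def by (metis Zero_not_Suc)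
    qed
  qed
  then obtain s where s: "\<And>k. P k (s k)" "\<And>k. Q k (s k) (s (Suc k))" by blast
  obtain p where p: "\<And>k. p k \<in> L.nset (2 * \<epsilon> k)"
    "\<And>k x. x \<in> X \<Longrightarrow> T x (s (Suc k)) = T x (s k) - L.nfun (p k) (\<Phi> x)"
    using s(2) unfolding Q_def by metis
  have sums: "(\<lambda>k. 2 * \<epsilon> k) sums (4 * op_norm K v)"
    using sums_mult[OF power_half_series, of "4 * op_norm K v"] by (simp add: \<epsilon>_def power_divide)
  obtain q where q: "q \<in> L.nset (\<Sum>k. 2 * \<epsilon> k)" "\<And>A. A \<in> bounded_ops L \<Longrightarrow> (\<lambda>k. L.nfun (p k) A) sums L.nfun q A"
    using L.nset_countable_sum[OF p(1) sums_summable[OF sums]] by blast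
  have "L.nfun q (\<Phi> x) = T x v" if x: "x \<in> X" for x
  proof -
    have "(\<lambda>k. T x (s k)) \<longlonglongrightarrow> 0"
    proof (rule Lim_null_comparison)
      show "\<forall>\<^sub>F k in sequentially. norm (T x (s k)) \<le> op_norm H x * \<epsilon> k"
      proof (rule always_eventually, rule allI)
        fix k
        have "s k \<in> V" "op_norm K (s k) \<le> \<epsilon> k" using s(1)[of k] by (auto simp: P_def)
        then show "norm (T x (s k)) \<le> op_norm H x * \<epsilon> k"
          using pairing_le[OF x] mult_left_mono[OF _ norm_nonneg(1)[OF x]] order_trans by blast
      qed
      show "(\<lambda>k. op_norm H x * \<epsilon> k) \<longlonglongrightarrow> 0"
        using tendsto_mult_right_zero[OF LIMSEQ_power_zero[of "1/2::real"], of "op_norm H x * op_norm K v"]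
        by (simp add: \<epsilon>_def power_divide)
    qed
    then have "(\<lambda>k. T x (s k) - T x (s (Suc k))) sums (T x (s 0) - 0)" by (rule telescope_sums')
    moreover have "T x (s k) - T x (s (Suc k)) = L.nfun (p k) (\<Phi> x)" for k using p(2)[OF x, of k] by simp
    ultimately have "(\<lambda>k. L.nfun (p k) (\<Phi> x)) sums T x (s 0)" by simp
    moreover have "s 0 = v" using s(1)[of 0] by (simp add: P_def)
    ultimately show ?thesis using q(2)[OF \<Phi>_bounded[OF x]] sums_unique2 by blast
  qed
  then show ?thesis using q(1) sums by (auto simp: sums_iff)
qed

end

section \<open>The weak* homeomorphism\<close>

context dual_unital_operator_space
begin

lemma \<Phi>_diff: "x \<in> X \<Longrightarrow> y \<in> X \<Longrightarrow> \<Phi> (x - y) = \<Phi> x - \<Phi> y"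
  by (rule clinear_on_diff[OF \<Phi>_clinear X_csub])

lemma \<Phi>_inj: "inj_on \<Phi> X"
proof (rule inj_onI)
  fix x y assume xy: "x \<in> X" "y \<in> X" "\<Phi> x = \<Phi> y"
  then have "\<Phi> (x - y) = 0" using \<Phi>_diff[OF xy(1,2)] by simp
  then have "op_norm H (x - y) = 0"
    using \<Phi>_norm[OF X_diff[OF xy(1,2)]] L.op_norm_zero by simp
  then have "x - y = 0" using H.op_norm_eq_0[OF X_bd[OF X_diff[OF xy(1,2)]]] by simp
  then show "x = y" by simp
qed

lemma \<Phi>_csubspace: "csubspace (\<Phi> ` X)"
proof (rule complex_vector.subspaceI)
  show "0 \<in> \<Phi> ` X" using \<Phi>_scale[OF X_zero, of 0] X_zero by (intro image_eqI[of _ _ 0]) auto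
  show "A + B \<in> \<Phi> ` X" if "A \<in> \<Phi> ` X" "B \<in> \<Phi> ` X" for A B
    using that by (auto simp: \<Phi>_add[symmetric] X_add)
  show "c *\<^sub>C A \<in> \<Phi> ` X" if "A \<in> \<Phi> ` X" for c A
    using that by (auto simp: \<Phi>_scale[symmetric] X_scale)
qed

lemma \<Phi>_complete_isometry: "complete_isometry X (op_mnorm H) (bounded_ops L) (op_mnorm L) \<Phi>"
  using \<Phi>_clinear \<Phi>_bounded \<Phi>_mnorm by (auto simp: complete_isometry_def)

text \<open>Both topologies are initial topologies, and by \<open>represented_normal\<close> and \<open>predual_lifting\<close> they are induced by the
  same functionals.\<close>

lemma \<Phi>_homeomorphic:
  "homeomorphic_map weakstar (subtopology (op_weakstar L) (\<Phi> ` X)) \<Phi>"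
proof (rule homeomorphic_maps_imp_map)
  let ?Y = "subtopology (op_weakstar L) (\<Phi> ` X)"
  let ?g = "inv_into X \<Phi>"
  have top: "topspace ?Y = \<Phi> ` X"
    using \<Phi>_bounded by (auto simp: op_weakstar_def)
  have inv: "?g (\<Phi> x) = x" if "x \<in> X" for x using inv_into_f_f[OF \<Phi>_inj that] .
  have "continuous_map weakstar (op_weakstar L) \<Phi>"
    unfolding op_weakstar_def
  proof (rule continuous_map_into_initial_topology)
    show "\<Phi> \<in> topspace weakstar \<rightarrow> bounded_ops L" using \<Phi>_bounded by auto
    fix f assume "f \<in> normal_functionals L"
    then obtain p c where p: "f = L.nfun p" "p \<in> L.nset c" by (auto simp: L.normal_functionals_eq)
    obtain v where v: "v \<in> V" "\<And>x. x \<in> X \<Longrightarrow> L.nfun p (\<Phi> x) = T x v"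
      using represented_normal[OF p(2)] by (auto simp: represented_def)
    show "continuous_map weakstar euclidean (\<lambda>x. f (\<Phi> x))"
      by (rule continuous_map_eq[OF continuous_map_eval[OF v(1)]]) (simp add: p(1) v(2))
  qed
  then have 1: "continuous_map weakstar ?Y \<Phi>"
    by (simp add: continuous_map_in_subtopology)
  have 2: "continuous_map ?Y weakstar ?g"
  proof (rule continuous_map_into_weakstar)
    show "?g \<in> topspace ?Y \<rightarrow> X" unfolding top using inv by auto
    fix v assume v: "v \<in> V"
    obtain p where p: "p \<in> L.nset (4 * op_norm K v)" "\<And>x. x \<in> X \<Longrightarrow> L.nfun p (\<Phi> x) = T x v"
      using predual_lifting[OF v] by blast
    have "L.nfun p \<in> normal_functionals L" using p(1) unfolding L.normal_functionals_eq by blast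
    then have "continuous_map ?Y euclidean (L.nfun p)"
      unfolding op_weakstar_def
      by (intro continuous_map_from_subtopology continuous_map_initial_topology)
    then show "continuous_map ?Y euclidean (\<lambda>A. T (?g A) v)"
    proof (rule continuous_map_eq)
      fix A assume "A \<in> topspace ?Y"
      then obtain x where "x \<in> X" "A = \<Phi> x" unfolding top by blast
      then show "L.nfun p A = T (?g A) v" using p(2) inv by simp
    qed
  qed
  show "homeomorphic_maps weakstar ?Y \<Phi> ?g"
    unfolding homeomorphic_maps_def top using 1 2 inv by auto
qed

text \<open>An operator \<open>A\<close> that is annihilated by the annihilator of \<open>\<Phi> ` X\<close> defines a functional on \<open>V\<close>: lift \<open>v\<close> to a
  normal functional and evaluate it at \<open>A\<close>, which does not depend on the lift.  It is bounded by the norm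
  control in \<open>predual_lifting\<close>, hence is given by an element \<open>x\<close> of \<open>X\<close>, and \<open>A = \<Phi> x\<close>, as both agree under all
  normal functionals.\<close>

lemma annihilated_in_range:
  assumes A: "A \<in> bounded_ops L"
    and ann: "\<And>p c. p \<in> L.nset c \<Longrightarrow> (\<forall>x\<in>X. L.nfun p (\<Phi> x) = 0) \<Longrightarrow> L.nfun p A = 0"
  shows "A \<in> \<Phi> ` X"
proof -
  have agree: "L.nfun p A = L.nfun q A"
    if p: "p \<in> L.nset c" and q: "q \<in> L.nset d" and eq: "\<And>x. x \<in> X \<Longrightarrow> L.nfun p (\<Phi> x) = L.nfun q (\<Phi> x)"
    for p q c d
  proof -
    obtain q' where q': "q' \<in> L.nset (cmod (-1) * d)" "\<And>A. A \<in> bounded_ops L \<Longrightarrow> L.nfun q' A = -1 * L.nfun q A"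
      using L.nset_scale[OF q] by blast
    obtain r where r: "r \<in> L.nset (c + cmod (-1) * d)" "\<And>A. A \<in> bounded_ops L \<Longrightarrow> L.nfun r A = L.nfun p A + L.nfun q' A"
      using L.nset_add[OF p q'(1)] by blast
    have "L.nfun r A = 0"
      using r(1) by (rule ann) (simp add: r(2) q'(2) \<Phi>_bounded eq)
    then show ?thesis using r(2)[OF A] q'(2)[OF A] by simp
  qed
  obtain P where P: "\<And>v. v \<in> V \<Longrightarrow> P v \<in> L.nset (4 * op_norm K v)"
    "\<And>v x. v \<in> V \<Longrightarrow> x \<in> X \<Longrightarrow> L.nfun (P v) (\<Phi> x) = T x v"
    using predual_lifting by metis
  define g where "g v = L.nfun (P v) A" for v
  have "clinear_on V g"
    unfolding clinear_on_def
  proof (intro conjI ballI allI)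
    fix v w assume v: "v \<in> V" and w: "w \<in> V"
    obtain r where r: "r \<in> L.nset (4 * op_norm K v + 4 * op_norm K w)"
      "\<And>A. A \<in> bounded_ops L \<Longrightarrow> L.nfun r A = L.nfun (P v) A + L.nfun (P w) A"
      using L.nset_add[OF P(1)[OF v] P(1)[OF w]] by blast
    have "L.nfun (P (v + w)) A = L.nfun r A"
      by (rule agree[OF P(1)[OF V_add[OF v w]] r(1)]) (simp add: P(2) V_add v w r(2) \<Phi>_bounded T_add_right)
    then show "g (v + w) = g v + g w" by (simp add: g_def r(2)[OF A])
  next
    fix c v assume v: "v \<in> V"
    obtain r where r: "r \<in> L.nset (cmod c * (4 * op_norm K v))"
      "\<And>A. A \<in> bounded_ops L \<Longrightarrow> L.nfun r A = c * L.nfun (P v) A"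
      using L.nset_scale[OF P(1)[OF v]] by blast
    have "L.nfun (P (c *\<^sub>C v)) A = L.nfun r A"
      by (rule agree[OF P(1)[OF V_scale[OF v]] r(1)]) (simp add: P(2) V_scale v r(2) \<Phi>_bounded T_scale_right)
    then show "g (c *\<^sub>C v) = c *\<^sub>C g v" by (simp add: g_def r(2)[OF A] scaleC_complex_def)
  qed
  moreover have "cmod (g v) \<le> 4 * op_norm L A * op_norm K v" if "v \<in> V" for v
    using L.nfun_le[OF P(1)[OF that] A] by (simp add: g_def mult_ac)
  ultimately obtain x where x: "x \<in> X" "\<And>v. v \<in> V \<Longrightarrow> T x v = g v"
    using functional_representation[of g "4 * op_norm L A"] L.op_norm_nonneg[OF A] by auto
  have "A \<zeta> = \<Phi> x \<zeta>" for \<zeta>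
  proof (cases "\<zeta> \<in> hcarrier L")
    case True
    define d where "d = A \<zeta> - \<Phi> x \<zeta>"
    have AD: "A \<zeta> \<in> hcarrier L" "\<Phi> x \<zeta> \<in> hcarrier L"
      using L.bounded_opsD(2)[OF A True] L.bounded_opsD(2)[OF \<Phi>_bounded[OF x(1)] True] by auto
    have d: "d \<in> hcarrier L" using AD by (simp add: d_def)
    obtain p where p: "p \<in> L.nset (max ((hnorm L \<zeta>)\<^sup>2) ((hnorm L d)\<^sup>2))"
      "\<And>A. A \<in> bounded_ops L \<Longrightarrow> L.nfun p A = hinner L (A \<zeta>) d"
      using L.vector_functional[OF True d max.cobounded1 max.cobounded2] by blast
    obtain v where v: "v \<in> V" "\<And>x. x \<in> X \<Longrightarrow> L.nfun p (\<Phi> x) = T x v"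
      using represented_normal[OF p(1)] by (auto simp: represented_def)
    have "L.nfun p A = L.nfun (P v) A"
      by (rule agree[OF p(1) P(1)[OF v(1)]]) (simp add: v P(2))
    also have "\<dots> = L.nfun p (\<Phi> x)" using x v by (simp add: g_def)
    finally have "hinner L (A \<zeta>) d = hinner L (\<Phi> x \<zeta>) d"
      using p(2)[OF A] p(2)[OF \<Phi>_bounded[OF x(1)]] by simp
    moreover have "hinner L (A \<zeta>) d = hinner L (d + \<Phi> x \<zeta>) d" by (simp add: d_def)
    ultimately have "hinner L d d = 0" using L.inner_add_left[OF d AD(2) d] by simp
    then have "d = 0" using L.inner_pos[OF d] by force
    then show ?thesis by (simp add: d_def)
  next
    case False
    then show ?thesis
      using L.bounded_opsD(3)[OF A False] L.bounded_opsD(3)[OF \<Phi>_bounded[OF x(1)] False] by simp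
  qed
  then have "A = \<Phi> x" by (rule ext)
  then show ?thesis using x(1) by blast
qed

lemma \<Phi>_range_closed: "closedin (op_weakstar L) (\<Phi> ` X)"
proof -
  define \<A> where "\<A> = {p. (\<exists>c. p \<in> L.nset c) \<and> (\<forall>x\<in>X. L.nfun p (\<Phi> x) = 0)}"
  define \<C> where "\<C> = insert (bounded_ops L) ((\<lambda>p. {A \<in> bounded_ops L. L.nfun p A \<in> {0}}) ` \<A>)"
  have top: "topspace (op_weakstar L) = bounded_ops L" by (simp add: op_weakstar_def)
  have "closedin (op_weakstar L) {A \<in> bounded_ops L. L.nfun p A \<in> {0}}" if "p \<in> \<A>" for p
  proof -
    have "L.nfun p \<in> normal_functionals L"
      using that unfolding \<A>_def L.normal_functionals_eq by blast
    then have "continuous_map (op_weakstar L) euclidean (L.nfun p)"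
      unfolding op_weakstar_def by (rule continuous_map_initial_topology)
    then have "closedin (op_weakstar L) {A \<in> topspace (op_weakstar L). L.nfun p A \<in> {0}}"
      by (rule closedin_continuous_map_preimage) simp
    then show ?thesis unfolding top .
  qed
  moreover have "closedin (op_weakstar L) (bounded_ops L)" using closedin_topspace[of "op_weakstar L"] unfolding top .
  ultimately have "closedin (op_weakstar L) (\<Inter>\<C>)"
    by (intro closedin_Inter) (auto simp: \<C>_def)
  moreover have "\<Inter>\<C> = \<Phi> ` X"
  proof
    show "\<Phi> ` X \<subseteq> \<Inter>\<C>" using \<Phi>_bounded by (auto simp: \<C>_def \<A>_def)
    show "\<Inter>\<C> \<subseteq> \<Phi> ` X"
    proof
      fix A assume A: "A \<in> \<Inter>\<C>"
      show "A \<in> \<Phi> ` X"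
      proof (rule annihilated_in_range)
        show "A \<in> bounded_ops L" using A by (simp add: \<C>_def)
        show "L.nfun p A = 0" if "p \<in> L.nset c" "\<forall>x\<in>X. L.nfun p (\<Phi> x) = 0" for p c
        proof -
          have "p \<in> \<A>" using that by (auto simp: \<A>_def)
          then show ?thesis using A by (auto simp: \<C>_def)
        qed
      qed
    qed
  qed
  ultimately show ?thesis by simp
qed

end

theorem theorem2p8:
  fixes H :: "'h::complex_vector hspace" and X :: "('h \<Rightarrow> 'h) set"
    and K :: "'k::complex_vector hspace" and V :: "('k \<Rightarrow> 'k) set"
    and T :: "('h \<Rightarrow> 'h) \<Rightarrow> (('k \<Rightarrow> 'k) \<Rightarrow> complex)"
  assumes "hilbert_space H" and "unital_operator_space H X"
    and "hilbert_space K" and "operator_space K V"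
    and "complete_isometry X (op_mnorm H) (dual_space K V) (dual_mnorm K V) T"
    and "T ` X = dual_space K V"
  shows "\<exists>(L :: ('h rep_index \<Rightarrow> complex) hspace) \<Phi>.
    hilbert_space L \<and>
    complete_isometry X (op_mnorm H) (bounded_ops L) (op_mnorm L) \<Phi> \<and>
    \<Phi> (id_op H) = id_op L \<and>
    csubspace (\<Phi> ` X) \<and> id_op L \<in> \<Phi> ` X \<and> closedin (op_weakstar L) (\<Phi> ` X) \<and>
    homeomorphic_map (pullback_topology X T (dual_weakstar K V))
      (subtopology (op_weakstar L) (\<Phi> ` X)) \<Phi>"
proof -
  interpret D: dual_unital_operator_space H K X V T
    by (intro dual_unital_operator_space.intro dual_unital_operator_space_axioms.intro assms)
  show ?thesis
  proof (intro exI conjI)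
    show "hilbert_space D.L" by (rule D.L.hilbert_space_axioms)
    show "complete_isometry X (op_mnorm H) (bounded_ops D.L) (op_mnorm D.L) D.\<Phi>"
      by (rule D.\<Phi>_complete_isometry)
    show "D.\<Phi> (id_op H) = id_op D.L" by (rule D.\<Phi>_id)
    show "csubspace (D.\<Phi> ` X)" by (rule D.\<Phi>_csubspace)
    show "id_op D.L \<in> D.\<Phi> ` X" 
      unfolding D.\<Phi>_id[symmetric] by (rule imageI) (rule D.id_in)
    show "closedin (op_weakstar D.L) (D.\<Phi> ` X)" by (rule D.\<Phi>_range_closed)
    show "homeomorphic_map (pullback_topology X T (dual_weakstar K V))
        (subtopology (op_weakstar D.L) (D.\<Phi> ` X)) D.\<Phi>"
      using D.\<Phi>_homeomorphic unfolding D.weakstar_def .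
  qed
qed

end
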